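(* There exists an absolute constant $\eta>0$ with the following property. Let $x$ be a sufficiently large real number (larger than some absolute constant), let \[ Q=\prod_{p\le x}p \] be the product of all primes $p\le x$, let $k\ge0$ be an integer with $k\le\eta x$, and let $s_1,\ldots,s_k\in\mathbb Z$ be pairwise distinct integers with $|s_i|\le e^{3x}$ for all $i$. Then, for every $b\in\mathbb Z$, there exists an integer $t$ with $1\le t\le e^x$ such that each number $b+Qt+s_i$ ($1\le i\le k$) is divisible by a prime in the interval \[ \left(x^6,\ \exp\!\left(\frac{x}{(\log x)^5}\right)\right]. \]
   Context: Logarithms are natural. The letter $p$ denotes a prime. The case $k=0$ (no shifts) is allowed. The assertion concerns divisibility only: the integers $b+Qt+s_i$ are not required to be positive, nor the prime divisors to be proper. The constant $\eta$ and the threshold for $x$ do not depend on $k$, $b$ or the $s_i$. *)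

theory Defs
  imports Complex_Main "HOL-Computational_Algebra.Primes"
begin

definition primorial :: "real \<Rightarrow> nat" where
  "primorial x = (\<Prod>p | prime p \<and> real p \<le> x. p)"

end

theory Submission
  imports Defs "HOL-Library.FuncSet" "HOL-Number_Theory.Cong" "HOL-Computational_Algebra.Squarefree"
    "HOL-Analysis.Harmonic_Numbers" "HOL-Real_Asymp.Real_Asymp"
begin

text \<open>
  Call the indices \<open>i = 1, \<dots>, k\<close> boxes and say that \<open>t\<close> covers box \<open>i\<close> if \<open>n\<^sub>i(t) = b + Q t + s\<^sub>i\<close> has a
  prime divisor in the window.  Discard the at most \<open>x\<^sup>6\<close> primes of the window that divide some
  difference \<open>s\<^sub>i - s\<^sub>j\<close>.  Each remaining prime \<open>p\<close> is coprime to \<open>Q\<close>, so it divides \<open>n\<^sub>i(t)\<close> exactly when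
  \<open>t\<close> lies in one residue class modulo \<open>p\<close>, and these \<open>k\<close> classes are distinct.  Two simple strategies
  fail.  Giving every box a prime of its own by the Chinese remainder theorem needs a modulus
  above \<open>x\<^sup>6\<^sup>k\<close>, a logarithm too much in the exponent.  For random \<open>t\<close>, the expected number of
  uncovered boxes is a power of \<open>log x\<close>, not less than one.

  Instead consider a product \<open>f = f\<^sub>1 \<cdots> f\<^sub>k\<close> of functions of \<open>t\<close>, where \<open>f\<^sub>i\<close> vanishes whenever box \<open>i\<close> is
  uncovered; a point with \<open>f(t) \<noteq> 0\<close> covers everything.  Expand \<open>f\<^sub>i\<close> in products of the mean-zero functions
  \<open>1/p - 1[p divides n\<^sub>i(t)]\<close>, indexed by squarefree \<open>d\<close> with prime factors among the admissible ones:
  the constant term is 1 and the term of \<open>d\<close> has coefficient \<open>- a\<^sub>d\<close>.  At an uncovered point the function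
  belonging to \<open>d\<close> equals \<open>1/d\<close>, so \<open>f\<^sub>i\<close> vanishes there exactly if the sum of \<open>a\<^sub>d/d\<close> is 1.  The
  functions are almost orthogonal, with squared norm about \<open>1/d\<close>, and an interval of length \<open>e\<^sup>x\<close>
  sees this orthogonality only for moduli well below \<open>e\<^sup>x\<close>.  So \<open>a\<close> should minimise
  the energy, the sum of \<open>a\<^sub>d\<^sup>2 (log d)/d\<close>: the minimiser is \<open>a\<^sub>d = C / log d\<close>, and the energy is
  \<open>C\<close>, the reciprocal of the sum of \<open>1/(d log d)\<close>.

  The decisive point is that \<open>C\<close> is bounded (\<open>sum_weights_ge\<close>).  Integers free of primes below \<open>x\<^sup>6\<close> have density
  about \<open>1/log x\<close>, so among \<open>d \<le> Z = exp (x/log\<^sup>5 x)\<close> each scale \<open>log d ~ 2\<^sup>j log x\<close> contributes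
  about \<open>1/log x\<close> to the sum, and there are about \<open>log x\<close> scales.  Using
  composite \<open>d\<close> thus wins the missing logarithm.  Under the spectral measure of \<open>f\<close> (mass proportional
  to the squared coefficient over the modulus) the logarithm of the modulus is a sum of
  \<open>k\<close> almost independent terms, each at most \<open>log Z\<close>, with mean at most \<open>C k\<close>, a small multiple of \<open>x\<close>.
  A Chernoff bound (\<open>norm_tail\<close>) shows that the part of \<open>f\<close> with moduli above \<open>exp (x/8)/Z\<close>
  has relative mass at most \<open>exp (- c log\<^sup>5 x)\<close>, which beats every power of \<open>x\<close>.

  Let \<open>F\<close> be the part of \<open>f\<close> with moduli at most \<open>exp (x/8)\<close>.  If box \<open>i\<close> is uncovered at \<open>t\<close>,
  summing out the terms of box \<open>i\<close> leaves \<open>F(t) = G\<^sub>i(t)\<close>, where \<open>G\<^sub>i\<close> involves only the other boxes and its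
  coefficients carry a factor measuring how far the sum of \<open>a\<^sub>d/d\<close>, cut off by the
  truncation, falls short of 1 (\<open>wave_sum_uncovered\<close>).  That factor is
  tiny unless the modulus is within a factor \<open>Z\<close> of the cut, where there is almost no mass.  If every
  \<open>t\<close> left a box uncovered, the sum of \<open>F\<^sup>2\<close> over the interval would be at most the sum of all \<open>G\<^sub>i\<^sup>2\<close>, but the
  squared norms of the \<open>G\<^sub>i\<close> add up to much less than that of \<open>F\<close>.
\<close>

section \<open>Periodic sums and quadratic forms\<close>

lemma sum_period_mult:
  fixes f g :: "nat \<Rightarrow> real"
  assumes "coprime m n" "m > 0" "n > 0"
    and f: "\<And>t. f t = f (t mod m)" and g: "\<And>t. g t = g (t mod n)"
  shows "(\<Sum>t<m * n. f t * g t) = (\<Sum>t<m. f t) * (\<Sum>t<n. g t)"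
proof -
  let ?h = "\<lambda>t. (t mod m, t mod n)"
  have inj: "inj_on ?h {..<m * n}"
  proof (rule inj_onI)
    fix x y assume x: "x \<in> {..<m * n}" and y: "y \<in> {..<m * n}" and e: "?h x = ?h y"
    have "[x = y] (mod m * n)"
    proof (rule coprime_cong_mult_nat[OF _ _ assms(1)])
      show "[x = y] (mod m)" "[x = y] (mod n)" using e by (simp_all add: Cong.cong_def)
    qed
    then show "x = y" using x y by (simp add: Cong.cong_def)
  qed
  have img: "?h ` {..<m * n} = {..<m} \<times> {..<n}"
  proof (rule card_subset_eq)
    show "?h ` {..<m * n} \<subseteq> {..<m} \<times> {..<n}" using assms(2,3) by auto
    show "card (?h ` {..<m * n}) = card ({..<m} \<times> {..<n})"
      using card_image[OF inj] by (simp add: card_cartesian_product)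
  qed simp
  have "(\<Sum>t<m * n. f t * g t) = (\<Sum>t<m * n. (\<lambda>(a, b). f a * g b) (?h t))"
    by (intro sum.cong refl) (simp flip: f g)
  also have "\<dots> = (\<Sum>(a, b)\<in>{..<m} \<times> {..<n}. f a * g b)"
    by (rule sum.reindex_bij_betw) (use inj img in \<open>simp add: bij_betw_def\<close>)
  also have "\<dots> = (\<Sum>t<m. f t) * (\<Sum>t<n. g t)"
    by (simp add: sum_product sum.cartesian_product)
  finally show ?thesis .
qed

lemma sum_period_prod:
  fixes f :: "nat \<Rightarrow> nat \<Rightarrow> real"
  assumes "finite R" "\<And>p. p \<in> R \<Longrightarrow> prime p" "\<And>p t. p \<in> R \<Longrightarrow> f p t = f p (t mod p)"
  shows "(\<Sum>t<\<Prod>R. \<Prod>p\<in>R. f p t) = (\<Prod>p\<in>R. \<Sum>t<p. f p t)"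
  using assms
proof (induction R rule: finite_induct)
  case (insert q R)
  have cop: "coprime q (\<Prod>R)"
    using insert.hyps insert.prems(1) by (intro prod_coprime_right primes_coprime) auto
  have "(\<Sum>t<\<Prod>(insert q R). \<Prod>p\<in>insert q R. f p t) = (\<Sum>t<q * \<Prod>R. f q t * (\<Prod>p\<in>R. f p t))"
    using insert.hyps by simp
  also have "\<dots> = (\<Sum>t<q. f q t) * (\<Sum>t<\<Prod>R. \<Prod>p\<in>R. f p t)"
  proof (rule sum_period_mult[OF cop])
    show "q > 0" using insert.prems(1) by (simp add: prime_gt_0_nat)
    show "\<Prod>R > 0" using insert.prems(1) by (auto intro!: prod_pos simp: prime_gt_0_nat)
    show "f q t = f q (t mod q)" for t using insert.prems(2)[of q t] by blast
    show "(\<Prod>p\<in>R. f p t) = (\<Prod>p\<in>R. f p (t mod \<Prod>R))" for t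
    proof (rule prod.cong[OF refl])
      fix p assume p: "p \<in> R"
      then have "p dvd \<Prod>R" using insert.hyps by (intro dvd_prodI) auto
      then have "t mod \<Prod>R mod p = t mod p" by (simp add: mod_mod_cancel)
      then show "f p t = f p (t mod \<Prod>R)" using insert.prems(2)[of p] p by (metis insertI2)
    qed
  qed
  finally show ?case using insert.hyps insert.IH[OF insert.prems(1) insert.prems(2)] by simp
qed simp

lemma abs_sum_period_diff_le:
  fixes h :: "nat \<Rightarrow> real"
  assumes q: "q > 0" and per: "\<And>t. h t = h (t mod q)" and bd: "\<And>t. \<bar>h t\<bar> \<le> 1"
  shows "\<bar>(\<Sum>t\<in>{1..N}. h t) - real N / real q * (\<Sum>t<q. h t)\<bar> \<le> 2 * real q"
proof -
  define S where "S = (\<Sum>t<q. h t)"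
  have absS: "\<bar>\<Sum>t<n. h t\<bar> \<le> real n" for n
    by (rule order.trans[OF sum_abs]) (use sum_bounded_above[of "{..<n}" "\<lambda>t. \<bar>h t\<bar>" 1] bd in simp)
  have app: "(\<Sum>t<c + m. h t) = (\<Sum>t<c. h t) + (\<Sum>t<m. h (c + t))" for c m
    by (induction m) auto
  have full: "(\<Sum>t<q * a + r. h t) = real a * S + (\<Sum>t<r. h t)" for a r
  proof (induction a)
    case (Suc a)
    have e: "h (q * a + (r + t)) = h (r + t)" for t
      by (metis per mod_mult_self4)
    have "(\<Sum>t<q * Suc a + r. h t) = (\<Sum>t<(q * a + r) + q. h t)" by (simp add: algebra_simps)
    also have "\<dots> = (\<Sum>t<q * a + r. h t) + (\<Sum>t<q. h (q * a + r + t))"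
      by (rule app)
    also have "(\<Sum>t<q. h (q * a + r + t)) = (\<Sum>t<q. h (r + t))"
      by (intro sum.cong refl) (simp add: e add.assoc)
    also have "(\<Sum>t<q. h (r + t)) = S"
    proof -
      have inj: "inj_on (\<lambda>t. (r + t) mod q) {..<q}"
      proof (rule inj_onI)
        fix x y assume "x \<in> {..<q}" "y \<in> {..<q}" "(r + x) mod q = (r + y) mod q"
        then have "[r + x = r + y] (mod q)" by (simp add: Cong.cong_def)
        then have "[x = y] (mod q)" by (simp add: cong_add_lcancel_nat)
        then show "x = y" using \<open>x \<in> _\<close> \<open>y \<in> _\<close> by (simp add: Cong.cong_def)
      qed
      have "(\<lambda>t. (r + t) mod q) ` {..<q} = {..<q}"
        by (rule card_subset_eq) (use q card_image[OF inj] in auto)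
      then have "bij_betw (\<lambda>t. (r + t) mod q) {..<q} {..<q}" using inj by (simp add: bij_betw_def)
      then have "(\<Sum>t<q. h ((r + t) mod q)) = S"
        unfolding S_def by (rule sum.reindex_bij_betw)
      then show ?thesis by (simp flip: per)
    qed
    finally show ?case using Suc by (simp add: algebra_simps)
  qed simp
  define a r where "a = Suc N div q" and "r = Suc N mod q"
  have N: "Suc N = q * a + r" and r: "r < q" using q by (simp_all add: a_def r_def)
  have ivl: "(\<Sum>t<Suc N. h t) = h 0 + (\<Sum>t\<in>{1..N}. h t)"
    using sum.lessThan_Suc_shift[of h N] sum.atLeast1_atMost_eq[of h N] by simp
  have "(\<Sum>t\<in>{1..N}. h t) = real a * S + (\<Sum>t<r. h t) - h 0"
    using full[of a r] ivl N by simp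
  moreover have "real N / real q * S = real a * S + (real r - 1) / real q * S"
  proof -
    have "real N = real q * real a + real r - 1" using arg_cong[OF N, of real] by simp
    then have "real N = real q * real a + (real r - 1)" by simp
    then show ?thesis using q by (simp add: add_divide_distrib distrib_right)
  qed
  ultimately have "(\<Sum>t\<in>{1..N}. h t) - real N / real q * S
      = (\<Sum>t<r. h t) - h 0 - (real r - 1) / real q * S" by simp
  moreover have "\<bar>(\<Sum>t<r. h t) - h 0\<bar> \<le> real q"
  proof (cases r)
    case 0 then show ?thesis using bd[of 0] q by simp
  next
    case (Suc m)
    have "(\<Sum>t<r. h t) - h 0 = (\<Sum>t<m. h (Suc t))" using sum.lessThan_Suc_shift[of h m] Suc by simp
    also have "\<bar>\<dots>\<bar> \<le> real m"
      by (rule order.trans[OF sum_abs]) (use sum_bounded_above[of "{..<m}" "\<lambda>t. \<bar>h (Suc t)\<bar>" 1] bd in simp)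
    finally show ?thesis using Suc r by linarith
  qed
  moreover have "\<bar>(real r - 1) / real q * S\<bar> \<le> real q"
  proof -
    have "\<bar>(real r - 1) / real q\<bar> \<le> 1" using r q by (auto simp: abs_le_iff field_simps)
    then show ?thesis using absS[of q] mult_mono[of "\<bar>(real r - 1) / real q\<bar>" 1 "\<bar>S\<bar>" "real q"]
      by (simp add: abs_mult S_def)
  qed
  ultimately show ?thesis unfolding S_def[symmetric]
    using abs_triangle_ineq4[of "(\<Sum>t<r. h t) - h 0" "(real r - 1) / real q * S"] by simp
qed

text \<open>
  Schur's test in both directions: \<open>\<bar>b x * b y\<bar>\<close> is at most the mean of the two squares, so off-diagonal
  entries cost at most their absolute row sums.
\<close>

lemma quadratic_form_row_sums:
  fixes b :: "'a \<Rightarrow> real" and K :: "'a \<Rightarrow> 'a \<Rightarrow> real"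
  assumes fin: "finite S" and sym: "\<And>x y. x \<in> S \<Longrightarrow> y \<in> S \<Longrightarrow> K x y = K y x"
    and row: "\<And>x. x \<in> S \<Longrightarrow> (\<Sum>y\<in>S. \<bar>K x y\<bar>) \<le> R x"
  shows "(\<Sum>x\<in>S. \<Sum>y\<in>S. b x * b y * K x y) \<le> (\<Sum>x\<in>S. (b x)\<^sup>2 * R x)"
    and "(\<Sum>x\<in>S. \<Sum>y\<in>S. b x * b y * K x y) \<ge> (\<Sum>x\<in>S. (b x)\<^sup>2 * (2 * K x x - R x))"
proof -
  have amgm: "\<bar>b x * b y * K x y\<bar> \<le> ((b x)\<^sup>2 / 2 + (b y)\<^sup>2 / 2) * \<bar>K x y\<bar>" for x y
  proof -
    have "\<bar>b x * b y\<bar> \<le> (b x)\<^sup>2 / 2 + (b y)\<^sup>2 / 2"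
      using sum_squares_bound[of "\<bar>b x\<bar>" "\<bar>b y\<bar>"] by (simp add: abs_mult)
    then show ?thesis using mult_right_mono[of "\<bar>b x * b y\<bar>" _ "\<bar>K x y\<bar>"] by (simp add: abs_mult)
  qed
  have split: "(\<Sum>x\<in>S. \<Sum>y\<in>S. ((b x)\<^sup>2 / 2 + (b y)\<^sup>2 / 2) * \<bar>K x y\<bar>)
      = (\<Sum>x\<in>S. (b x)\<^sup>2 * (\<Sum>y\<in>S. \<bar>K x y\<bar>))"
  proof -
    have "(\<Sum>x\<in>S. \<Sum>y\<in>S. (b y)\<^sup>2 / 2 * \<bar>K x y\<bar>) = (\<Sum>y\<in>S. \<Sum>x\<in>S. (b y)\<^sup>2 / 2 * \<bar>K x y\<bar>)"
      by (rule sum.swap)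
    also have "\<dots> = (\<Sum>x\<in>S. \<Sum>y\<in>S. (b x)\<^sup>2 / 2 * \<bar>K x y\<bar>)"
      by (intro sum.cong refl) (simp add: sym)
    finally have "(\<Sum>x\<in>S. \<Sum>y\<in>S. (b y)\<^sup>2 / 2 * \<bar>K x y\<bar>) = (\<Sum>x\<in>S. \<Sum>y\<in>S. (b x)\<^sup>2 / 2 * \<bar>K x y\<bar>)" .
    then have "(\<Sum>x\<in>S. \<Sum>y\<in>S. ((b x)\<^sup>2 / 2 + (b y)\<^sup>2 / 2) * \<bar>K x y\<bar>)
        = 2 * (\<Sum>x\<in>S. \<Sum>y\<in>S. (b x)\<^sup>2 / 2 * \<bar>K x y\<bar>)"
      by (simp add: distrib_right sum.distrib)
    then show ?thesis by (simp add: sum_distrib_left)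
  qed
  have rowb: "(\<Sum>x\<in>S. (b x)\<^sup>2 * (\<Sum>y\<in>S. \<bar>K x y\<bar>)) \<le> (\<Sum>x\<in>S. (b x)\<^sup>2 * R x)"
    by (intro sum_mono mult_left_mono row) auto
  have "(\<Sum>x\<in>S. \<Sum>y\<in>S. b x * b y * K x y)
      \<le> (\<Sum>x\<in>S. \<Sum>y\<in>S. ((b x)\<^sup>2 / 2 + (b y)\<^sup>2 / 2) * \<bar>K x y\<bar>)"
    using amgm by (intro sum_mono) (auto simp: abs_le_iff)
  then show "(\<Sum>x\<in>S. \<Sum>y\<in>S. b x * b y * K x y) \<le> (\<Sum>x\<in>S. (b x)\<^sup>2 * R x)"
    using split rowb by linarith
  have "(\<Sum>x\<in>S. \<Sum>y\<in>S. (if x = y then 2 * (b x)\<^sup>2 * K x x else 0)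
         - ((b x)\<^sup>2 / 2 + (b y)\<^sup>2 / 2) * \<bar>K x y\<bar>) \<le> (\<Sum>x\<in>S. \<Sum>y\<in>S. b x * b y * K x y)"
  proof (intro sum_mono)
    fix x y
    show "(if x = y then 2 * (b x)\<^sup>2 * K x x else 0) - ((b x)\<^sup>2 / 2 + (b y)\<^sup>2 / 2) * \<bar>K x y\<bar>
        \<le> b x * b y * K x y"
    proof (cases "x = y")
      case True
      have "(b x)\<^sup>2 * K x x \<le> (b x)\<^sup>2 * \<bar>K x x\<bar>" by (intro mult_left_mono) auto
      then show ?thesis using True by (simp add: power2_eq_square)
    next
      case False
      then show ?thesis using amgm[of x y] by (auto simp: abs_le_iff)
    qed
  qed
  moreover have "(\<Sum>x\<in>S. \<Sum>y\<in>S. (if x = y then 2 * (b x)\<^sup>2 * K x x else 0)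
         - ((b x)\<^sup>2 / 2 + (b y)\<^sup>2 / 2) * \<bar>K x y\<bar>)
      = (\<Sum>x\<in>S. 2 * (b x)\<^sup>2 * K x x) - (\<Sum>x\<in>S. (b x)\<^sup>2 * (\<Sum>y\<in>S. \<bar>K x y\<bar>))"
    using fin by (simp add: sum_subtractf split)
  ultimately have "(\<Sum>x\<in>S. 2 * (b x)\<^sup>2 * K x x) - (\<Sum>x\<in>S. (b x)\<^sup>2 * R x)
      \<le> (\<Sum>x\<in>S. \<Sum>y\<in>S. b x * b y * K x y)"
    using rowb by linarith
  then show "(\<Sum>x\<in>S. \<Sum>y\<in>S. b x * b y * K x y) \<ge> (\<Sum>x\<in>S. (b x)\<^sup>2 * (2 * K x x - R x))"
    by (simp add: algebra_simps sum_subtractf)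
qed

lemma one_minus_sum_le_prod:
  fixes a :: "'a \<Rightarrow> real"
  assumes "\<And>x. x \<in> A \<Longrightarrow> 0 \<le> a x \<and> a x \<le> 1"
  shows "1 - (\<Sum>x\<in>A. a x) \<le> (\<Prod>x\<in>A. 1 - a x)"
  using assms
proof (induction A rule: infinite_finite_induct)
  case (insert x A)
  have "a x * (\<Prod>y\<in>A. 1 - a y) \<le> a x * 1"
    using insert by (intro mult_left_mono prod_le_1) auto
  then show ?case using insert by (simp add: algebra_simps)
qed auto

section \<open>Products of distinct primes\<close>

definition real_prod :: "nat set \<Rightarrow> real" where
  "real_prod A = (\<Prod>p\<in>A. real p)"

lemma inj_on_prod_primes: "inj_on Prod {A :: nat set. finite A \<and> (\<forall>p\<in>A. prime p)}"
proof (rule inj_onI)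
  fix A B :: "nat set"
  assume A: "A \<in> {A. finite A \<and> (\<forall>p\<in>A. prime p)}" and B: "B \<in> {A. finite A \<and> (\<forall>p\<in>A. prime p)}"
    and e: "\<Prod>A = \<Prod>B"
  have mem: "q \<in> C \<longleftrightarrow> prime q \<and> q dvd \<Prod>C" if C: "finite C" "\<forall>p\<in>C. prime p" for q :: nat and C
  proof
    assume "q \<in> C"
    then show "prime q \<and> q dvd \<Prod>C" using C dvd_prodI[of C q "\<lambda>x. x"] by simp
  next
    assume q: "prime q \<and> q dvd \<Prod>C"
    then obtain p where p: "p \<in> C" "q dvd p" using C prime_dvd_prod_iff[of C q "\<lambda>x. x"] by auto
    then have "q = p" using q C primes_dvd_imp_eq[of q p] by blast
    then show "q \<in> C" using p by simp
  qed
  show "A = B"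
  proof (rule set_eqI)
    fix q
    have "q \<in> A \<longleftrightarrow> prime q \<and> q dvd \<Prod>A" by (rule mem) (use A in auto)
    moreover have "q \<in> B \<longleftrightarrow> prime q \<and> q dvd \<Prod>B" by (rule mem) (use B in auto)
    ultimately show "q \<in> A \<longleftrightarrow> q \<in> B" using e by (simp only:)
  qed
qed

lemma harm_le_one_plus_ln: "n > 0 \<Longrightarrow> harm n \<le> 1 + ln (real n)"
proof (induction n rule: nat_induct_non_zero)
  case (Suc n)
  have "ln (real n / real (Suc n)) \<le> real n / real (Suc n) - 1"
    using Suc by (intro ln_le_minus_one) auto
  also have "\<dots> = - inverse (real (Suc n))" by (simp add: field_simps)
  finally have "inverse (real (Suc n)) \<le> ln (real (Suc n)) - ln (real n)"
    using Suc by (simp add: ln_div)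
  then show ?case using Suc by (simp add: harm_Suc)
qed (simp add: harm_def)

text \<open>
  Distinct sets of primes have distinct products, so the sum is part of a harmonic sum.
\<close>

lemma sum_recip_prod_primes_le:
  assumes "finite P" "\<And>p. p \<in> P \<Longrightarrow> prime p" "Z \<ge> 1"
  shows "(\<Sum>A | A \<subseteq> P \<and> real_prod A \<le> Z. 1 / real_prod A) \<le> 1 + ln Z"
proof -
  let ?F = "{A. A \<subseteq> P \<and> real_prod A \<le> Z}"
  have fin: "finite A" if "A \<subseteq> P" for A using that assms(1) finite_subset by blast
  have inj: "inj_on Prod ?F"
    by (rule inj_on_subset[OF inj_on_prod_primes]) (use fin assms in auto)
  have "(\<Sum>A\<in>?F. 1 / real_prod A) = (\<Sum>n\<in>Prod ` ?F. 1 / real n)"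
    by (subst sum.reindex[OF inj]) (simp add: real_prod_def)
  also have "\<dots> \<le> (\<Sum>n\<in>{1..nat \<lfloor>Z\<rfloor>}. 1 / real n)"
  proof (rule sum_mono2)
    show "Prod ` ?F \<subseteq> {1..nat \<lfloor>Z\<rfloor>}"
    proof (intro image_subsetI)
      fix A assume A: "A \<in> ?F"
      have "\<Prod>A > 0" using A assms(2) by (intro prod_pos) (auto simp: prime_gt_0_nat)
      moreover have "real (\<Prod>A) \<le> Z" using A by (simp add: real_prod_def)
      ultimately show "\<Prod>A \<in> {1..nat \<lfloor>Z\<rfloor>}" by (simp add: le_nat_iff le_floor_iff del: of_nat_prod) 
    qed
  qed auto
  also have "\<dots> = harm (nat \<lfloor>Z\<rfloor>)" by (simp add: harm_def inverse_eq_divide)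
  also have "\<dots> \<le> 1 + ln (real (nat \<lfloor>Z\<rfloor>))" using assms(3) by (intro harm_le_one_plus_ln) linarith
  also have "\<dots> \<le> 1 + ln Z" using assms(3) by (intro add_left_mono ln_mono) linarith+
  finally show ?thesis .
qed

section \<open>Waves attached to partial assignments of primes to boxes\<close>

text \<open>
  The abstract covering problem: box \<open>i\<close> is covered by \<open>p\<close> at \<open>t\<close> if \<open>t\<close> is congruent to \<open>r p i\<close> modulo \<open>p\<close>.
  The injectivity of \<open>r p\<close> says that a prime covers at most one box at a time.  The lower bound \<open>w\<close> on the
  primes controls all errors that come from a prime being usable by several boxes.
\<close>

locale residue_system =
  fixes P :: "nat set" and k :: nat and r :: "nat \<Rightarrow> nat \<Rightarrow> nat" and w :: real
  assumes finite_P: "finite P" and prime_P: "p \<in> P \<Longrightarrow> prime p"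
    and large_P: "p \<in> P \<Longrightarrow> w < real p" and w_ge: "w \<ge> 3"
    and r_less: "p \<in> P \<Longrightarrow> i \<in> {1..k} \<Longrightarrow> r p i < p"
    and r_inj: "p \<in> P \<Longrightarrow> inj_on (r p) {1..k}"
begin

text \<open>
  A configuration assigns each prime to a box, or to \<open>0\<close> if the prime is not used.  It stands for a
  tuple of squarefree numbers \<open>d\<^sub>1, \<dots>, d\<^sub>k\<close> that are automatically pairwise coprime, \<open>d\<^sub>i\<close> being the product
  of \<open>block \<beta> i\<close>.
\<close>

definition configs :: "(nat \<Rightarrow> nat) set" where
  "configs = P \<rightarrow>\<^sub>E {..k}"

definition block :: "(nat \<Rightarrow> nat) \<Rightarrow> nat \<Rightarrow> nat set" where
  "block \<beta> i = {p \<in> P. \<beta> p = i}"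

definition supp :: "(nat \<Rightarrow> nat) \<Rightarrow> nat set" where
  "supp \<beta> = {p \<in> P. \<beta> p \<noteq> 0}"

definition modulus :: "(nat \<Rightarrow> nat) \<Rightarrow> real" where
  "modulus \<beta> = (\<Prod>p\<in>supp \<beta>. real p)"

text \<open>
  The mean-zero function modulo \<open>p\<close> that detects whether \<open>p\<close> covers box \<open>j\<close>, with the constant \<open>1\<close> for an
  unused prime.  The sign makes it positive when \<open>p\<close> does not cover box \<open>j\<close>.
\<close>

definition local_factor :: "nat \<Rightarrow> nat \<Rightarrow> nat \<Rightarrow> real" where
  "local_factor p j t = (if j = 0 then 1 else 1 / real p - (if t mod p = r p j then 1 else 0))"

definition wave :: "(nat \<Rightarrow> nat) \<Rightarrow> nat \<Rightarrow> real" where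
  "wave \<beta> t = (\<Prod>p\<in>P. local_factor p (\<beta> p) t)"

text \<open>
  The mean of the product of two local factors over a period; see \<open>sum_local_factor_mult\<close>.
\<close>

definition corr :: "nat \<Rightarrow> nat \<Rightarrow> nat \<Rightarrow> real" where
  "corr p i j = (if i = 0 \<and> j = 0 then 1 else if i = 0 \<or> j = 0 then 0
     else (if i = j then 1 / real p else 0) - 1 / (real p)\<^sup>2)"

lemma P_pos: "p \<in> P \<Longrightarrow> p > 0"
  using prime_P prime_gt_0_nat by blast

lemma finite_supp [simp]: "finite (supp \<beta>)"
  using finite_P by (simp add: supp_def)

lemma supp_subset: "supp \<beta> \<subseteq> P"
  by (auto simp: supp_def)

lemma finite_configs: "finite configs"
  unfolding configs_def using finite_P by (intro finite_PiE) auto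

lemma modulus_ge_1: "modulus \<beta> \<ge> 1"
  unfolding modulus_def by (intro prod_ge_1) (use P_pos supp_subset in \<open>force simp: Suc_le_eq\<close>)

lemma local_factor_mod: "local_factor p j t = local_factor p j (t mod p)"
  by (simp add: local_factor_def)

lemma abs_local_factor_le: "p \<in> P \<Longrightarrow> \<bar>local_factor p j t\<bar> \<le> 1"
  using P_pos[of p] by (auto simp: local_factor_def abs_le_iff field_simps)

lemma sum_local_factor_mult:
  assumes p: "p \<in> P" and i: "i \<le> k" and j: "j \<le> k"
  shows "(\<Sum>t<p. local_factor p i t * local_factor p j t) = real p * corr p i j"
proof -
  have pp: "real p > 0" using P_pos[OF p] by simp
  define e where "e i t = (if t = r p i then 1 else 0 :: real)" for i t
  have local_factor: "local_factor p i t = 1 / real p - e i t" if "t < p" "i \<noteq> 0" for i t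
    using that by (simp add: local_factor_def e_def)
  have sum_e: "(\<Sum>t<p. e i t) = 1" if "i \<in> {1..k}" for i
    using r_less[OF p that] by (simp add: e_def)
  have sum_ee: "(\<Sum>t<p. e i t * e j t) = (if i = j then 1 else 0)" if "i \<in> {1..k}" "j \<in> {1..k}" for i j
  proof -
    have "e i t * e j t = (if i = j then e i t else 0)" for t
      using inj_onD[OF r_inj[OF p], of i j] that by (auto simp: e_def)
    then have "(\<Sum>t<p. e i t * e j t) = (\<Sum>t<p. if i = j then e i t else 0)" by (rule sum.cong[OF refl])
    then show ?thesis using sum_e[OF that(1)] by (cases "i = j") simp_all
  qed
  show ?thesis
  proof (cases "i = 0 \<or> j = 0")
    case True
    have "(\<Sum>t<p. local_factor p i t) = 0" if "i \<in> {1..k}" for i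
      using that sum_e[OF that] pp by (simp add: local_factor sum_subtractf)
    then show ?thesis using True i j pp by (auto simp: local_factor_def[of p 0] corr_def)
  next
    case False
    then have ij: "i \<in> {1..k}" "j \<in> {1..k}" using i j by auto
    have "(\<Sum>t<p. local_factor p i t * local_factor p j t)
        = (\<Sum>t<p. 1 / (real p)\<^sup>2 - e i t / real p - e j t / real p + e i t * e j t)"
      using False by (intro sum.cong refl) (simp add: local_factor algebra_simps power2_eq_square)
    also have "\<dots> = 1 / real p - 1 / real p - 1 / real p + (if i = j then 1 else 0)"
      using pp by (simp add: sum.distrib sum_subtractf sum_ee[OF ij] sum_e[OF ij(1)] sum_e[OF ij(2)]
          flip: sum_divide_distrib) (simp add: power2_eq_square)
    also have "\<dots> = real p * corr p i j"
      using False pp by (simp add: corr_def power2_eq_square field_simps)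
    finally show ?thesis .
  qed
qed

text \<open>
  The product of two waves has period at most the product of the moduli, and its mean factors over the
  primes by the Chinese remainder theorem; only the incomplete last period of \<open>{1..N}\<close> is lost.
\<close>

lemma wave_correlation:
  assumes \<beta>: "\<beta> \<in> configs" and \<gamma>: "\<gamma> \<in> configs"
  shows "\<bar>(\<Sum>t\<in>{1..N}. wave \<beta> t * wave \<gamma> t) - real N * (\<Prod>p\<in>P. corr p (\<beta> p) (\<gamma> p))\<bar>
    \<le> 2 * modulus \<beta> * modulus \<gamma>"
proof -
  define R where "R = supp \<beta> \<union> supp \<gamma>"
  define h where "h p t = local_factor p (\<beta> p) t * local_factor p (\<gamma> p) t" for p t
  define H where "H t = (\<Prod>p\<in>R. h p t)" for t
  have R: "finite R" "R \<subseteq> P" by (auto simp: R_def supp_def finite_P)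
  have bk: "\<beta> p \<le> k" "\<gamma> p \<le> k" if "p \<in> P" for p
    using \<beta> \<gamma> that by (auto simp: configs_def PiE_iff)
  have out: "\<beta> p = 0" "\<gamma> p = 0" if "p \<in> P - R" for p using that by (auto simp: R_def supp_def)
  have H: "wave \<beta> t * wave \<gamma> t = H t" for t
    unfolding wave_def H_def h_def prod.distrib[symmetric]
    by (rule prod.mono_neutral_right) (use R finite_P out in \<open>auto simp: local_factor_def\<close>)
  have hmod: "h p t = h p (t mod p)" for p t unfolding h_def using local_factor_mod by metis
  have q: "\<Prod>R > 0" using R P_pos by (intro prod_pos) auto
  have Hmod: "H t = H (t mod \<Prod>R)" for t
    unfolding H_def
  proof (rule prod.cong[OF refl])
    fix p assume "p \<in> R"
    then have "p dvd \<Prod>R" using R by (intro dvd_prodI) auto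
    then show "h p t = h p (t mod \<Prod>R)" using hmod[of p t] hmod[of p "t mod \<Prod>R"] by (simp add: mod_mod_cancel)
  qed
  have Hle: "\<bar>H t\<bar> \<le> 1" for t
    unfolding H_def abs_prod h_def abs_mult
    by (intro prod_le_1) (use R abs_local_factor_le in \<open>auto intro!: mult_le_one\<close>)
  have "(\<Sum>t<\<Prod>R. H t) = (\<Prod>p\<in>R. \<Sum>t<p. h p t)"
    unfolding H_def by (rule sum_period_prod) (use R prime_P hmod in auto)
  also have "\<dots> = (\<Prod>p\<in>R. real p * corr p (\<beta> p) (\<gamma> p))"
    unfolding h_def using R bk by (intro prod.cong refl sum_local_factor_mult) auto
  also have "\<dots> = real (\<Prod>R) * (\<Prod>p\<in>P. corr p (\<beta> p) (\<gamma> p))"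
  proof -
    have "(\<Prod>p\<in>P. corr p (\<beta> p) (\<gamma> p)) = (\<Prod>p\<in>R. corr p (\<beta> p) (\<gamma> p))"
      by (rule prod.mono_neutral_right) (use R finite_P out in \<open>auto simp: corr_def\<close>)
    then show ?thesis by (simp add: prod.distrib)
  qed
  finally have "real N / real (\<Prod>R) * (\<Sum>t<\<Prod>R. H t) = real N * (\<Prod>p\<in>P. corr p (\<beta> p) (\<gamma> p))"
    using q by (simp del: of_nat_prod)
  then have "\<bar>(\<Sum>t\<in>{1..N}. H t) - real N * (\<Prod>p\<in>P. corr p (\<beta> p) (\<gamma> p))\<bar> \<le> 2 * real (\<Prod>R)"
    using abs_sum_period_diff_le[OF q, of H N] Hmod Hle by metis
  also have "real (\<Prod>R) \<le> modulus \<beta> * modulus \<gamma>"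
  proof -
    have "real (\<Prod>R) * 1 \<le> (\<Prod>p\<in>supp \<beta> \<union> supp \<gamma>. real p) * (\<Prod>p\<in>supp \<beta> \<inter> supp \<gamma>. real p)"
      unfolding R_def of_nat_prod using P_pos supp_subset
      by (intro mult_left_mono prod_ge_1 prod_nonneg) (force simp: Suc_le_eq)+
    then show ?thesis by (simp add: modulus_def prod.union_inter)
  qed
  finally show ?thesis by (simp add: H)
qed

text \<open>
  Two waves correlate only if they use the same primes, and sending a prime to a different box costs a
  factor of order \<open>1/p\<close>.  The sum over all configurations factors over the primes.
\<close>

lemma corr_row_sum:
  assumes \<beta>: "\<beta> \<in> configs" and S: "S \<subseteq> configs"
  shows "(\<Sum>\<gamma>\<in>S. \<bar>\<Prod>p\<in>P. corr p (\<beta> p) (\<gamma> p)\<bar>) \<le> exp (real k * real (card (supp \<beta>)) / w) / modulus \<beta>"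
proof -
  have "(\<Sum>\<gamma>\<in>S. \<bar>\<Prod>p\<in>P. corr p (\<beta> p) (\<gamma> p)\<bar>) \<le> (\<Sum>\<gamma>\<in>configs. \<Prod>p\<in>P. \<bar>corr p (\<beta> p) (\<gamma> p)\<bar>)"
    unfolding abs_prod by (intro sum_mono2 finite_configs S) (auto intro: prod_nonneg)
  also have "\<dots> = (\<Prod>p\<in>P. \<Sum>j\<le>k. \<bar>corr p (\<beta> p) j\<bar>)"
    unfolding configs_def by (rule prod_sum_PiE[symmetric]) (auto simp: finite_P)
  also have "\<dots> \<le> (\<Prod>p\<in>P. if p \<in> supp \<beta> then exp (real k / w) / real p else 1)"
  proof (intro prod_mono conjI sum_nonneg)
    fix p assume p: "p \<in> P"
    have pp: "real p > 0" using P_pos[OF p] by simp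
    show "(\<Sum>j\<le>k. \<bar>corr p (\<beta> p) j\<bar>) \<le> (if p \<in> supp \<beta> then exp (real k / w) / real p else 1)"
    proof (cases "\<beta> p = 0")
      case True
      have "\<bar>corr p (\<beta> p) j\<bar> = (if j = 0 then 1 else 0)" for j using True by (simp add: corr_def)
      then show ?thesis using True p by (simp add: supp_def)
    next
      case False
      have bk: "\<beta> p \<le> k" using \<beta> p by (auto simp: configs_def PiE_iff)
      have "(\<Sum>j\<le>k. \<bar>corr p (\<beta> p) j\<bar>) \<le>
          (\<Sum>j\<le>k. (if j = \<beta> p then 1 / real p else 0) + (if j = 0 then 0 else 1 / (real p)\<^sup>2))"
      proof (rule sum_mono)
        fix j
        have "1 / (real p)\<^sup>2 \<le> 1 / real p" using P_pos[OF p] by (simp add: power2_eq_square field_simps)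
        moreover have "1 / (real p)\<^sup>2 \<ge> 0" by simp
        ultimately show "\<bar>corr p (\<beta> p) j\<bar> \<le> (if j = \<beta> p then 1 / real p else 0) + (if j = 0 then 0 else 1 / (real p)\<^sup>2)"
          using False unfolding corr_def by auto
      qed
      also have "\<dots> = 1 / real p + real k / (real p)\<^sup>2"
      proof -
        have "(\<Sum>j\<le>k. if j = 0 then 0 else 1 / (real p)\<^sup>2) = real k / (real p)\<^sup>2"
          by (induction k) (auto simp: add_divide_distrib)
        then show ?thesis using bk by (simp add: sum.distrib)
      qed
      also have "\<dots> = (1 + real k / real p) / real p" using pp by (simp add: field_simps power2_eq_square)
      also have "\<dots> \<le> exp (real k / w) / real p"
      proof (rule divide_right_mono)
        have "1 + real k / real p \<le> 1 + real k / w"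
          using large_P[OF p] w_ge by (intro add_left_mono divide_left_mono mult_pos_pos) auto
        then show "1 + real k / real p \<le> exp (real k / w)" using exp_ge_add_one_self[of "real k / w"] by linarith
      qed simp
      finally show ?thesis using False p by (simp add: supp_def)
    qed
  qed auto
  also have "\<dots> = (\<Prod>p\<in>supp \<beta>. exp (real k / w) / real p)"
    using supp_subset finite_P by (simp add: prod.If_cases Int_absorb1)
  also have "\<dots> = exp (real k * real (card (supp \<beta>)) / w) / modulus \<beta>"
    by (simp add: prod_dividef modulus_def mult.commute flip: exp_of_nat_mult)
  finally show ?thesis .
qed

lemma corr_diagonal:
  shows "(\<Prod>p\<in>P. corr p (\<beta> p) (\<beta> p)) \<ge> (1 - real (card (supp \<beta>)) / w) / modulus \<beta>"
proof -
  have eq: "(\<Prod>p\<in>P. corr p (\<beta> p) (\<beta> p)) = (\<Prod>p\<in>supp \<beta>. 1 - 1 / real p) / modulus \<beta>"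
  proof -
    have "(\<Prod>p\<in>P. corr p (\<beta> p) (\<beta> p)) = (\<Prod>p\<in>supp \<beta>. corr p (\<beta> p) (\<beta> p))"
      by (rule prod.mono_neutral_right) (auto simp: finite_P supp_def corr_def)
    also have "\<dots> = (\<Prod>p\<in>supp \<beta>. (1 - 1 / real p) / real p)"
      by (intro prod.cong refl) (auto simp: supp_def corr_def power2_eq_square diff_divide_distrib)
    finally show ?thesis by (simp add: prod_dividef modulus_def)
  qed
  have "1 - real (card (supp \<beta>)) / w \<le> 1 - (\<Sum>p\<in>supp \<beta>. 1 / real p)"
  proof -
    have "(\<Sum>p\<in>supp \<beta>. 1 / real p) \<le> (\<Sum>p\<in>supp \<beta>. 1 / w)"
      using w_ge by (intro sum_mono divide_left_mono mult_pos_pos) (use large_P P_pos supp_subset in \<open>force+\<close>)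
    then show ?thesis by simp
  qed
  also have "\<dots> \<le> (\<Prod>p\<in>supp \<beta>. 1 - 1 / real p)"
    by (rule one_minus_sum_le_prod) (use P_pos supp_subset in \<open>force simp: Suc_le_eq\<close>)
  finally show ?thesis unfolding eq using modulus_ge_1[of \<beta>] by (intro divide_right_mono) auto
qed

text \<open>
  The waves behave like an orthogonal system with squared norms \<open>1 / modulus\<close>, up to constant factors, as
  long as the error from the incomplete periods is small compared with \<open>N\<close>.
\<close>

lemma wave_energy_bounds:
  fixes b :: "(nat \<Rightarrow> nat) \<Rightarrow> real"
  assumes S: "S \<subseteq> configs" and few: "\<And>\<beta>. \<beta> \<in> S \<Longrightarrow> real k * real (card (supp \<beta>)) \<le> w / 8"
    and b: "\<And>\<beta>. \<beta> \<in> S \<Longrightarrow> \<bar>b \<beta>\<bar> \<le> 1"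
  shows "(\<Sum>t\<in>{1..N}. (\<Sum>\<beta>\<in>S. b \<beta> * wave \<beta> t)\<^sup>2)
      \<le> real N * (5 / 4 * (\<Sum>\<beta>\<in>S. (b \<beta>)\<^sup>2 / modulus \<beta>)) + 2 * (\<Sum>\<beta>\<in>S. modulus \<beta>)\<^sup>2" (is ?upper)
    and "(\<Sum>t\<in>{1..N}. (\<Sum>\<beta>\<in>S. b \<beta> * wave \<beta> t)\<^sup>2)
      \<ge> real N * (1 / 2 * (\<Sum>\<beta>\<in>S. (b \<beta>)\<^sup>2 / modulus \<beta>)) - 2 * (\<Sum>\<beta>\<in>S. modulus \<beta>)\<^sup>2" (is ?lower)
proof -
  define K where "K \<beta> \<gamma> = (\<Prod>p\<in>P. corr p (\<beta> p) (\<gamma> p))" for \<beta> \<gamma>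
  define Q where "Q = (\<Sum>\<beta>\<in>S. \<Sum>\<gamma>\<in>S. b \<beta> * b \<gamma> * K \<beta> \<gamma>)"
  have finS: "finite S" using S finite_configs finite_subset by blast
  have wpos: "w > 0" using w_ge by simp
  have sym: "K \<beta> \<gamma> = K \<gamma> \<beta>" for \<beta> \<gamma> unfolding K_def by (intro prod.cong refl) (auto simp: corr_def)
  have row: "(\<Sum>\<gamma>\<in>S. \<bar>K \<beta> \<gamma>\<bar>) \<le> 5 / 4 / modulus \<beta>" if "\<beta> \<in> S" for \<beta>
  proof -
    have le: "real k * real (card (supp \<beta>)) / w \<le> 1 / 8" using few[OF that] wpos by (simp add: field_simps)
    have "exp (real k * real (card (supp \<beta>)) / w) \<le> exp (1 / 8)" using le by simp
    also have "\<dots> \<le> 5 / 4" using exp_bound_lemma[of "1/8 :: real"] by simp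
    finally have "exp (real k * real (card (supp \<beta>)) / w) / modulus \<beta> \<le> 5 / 4 / modulus \<beta>"
      using modulus_ge_1[of \<beta>] by (intro divide_right_mono) auto
    then show ?thesis unfolding K_def using corr_row_sum[of \<beta> S] S that by force
  qed
  have diag: "K \<beta> \<beta> \<ge> 7 / 8 / modulus \<beta>" if "\<beta> \<in> S" for \<beta>
  proof -
    have "real (card (supp \<beta>)) \<le> real k * real (card (supp \<beta>))"
    proof (cases "k = 0")
      case True
      have "\<beta> p \<le> k" if "p \<in> P" for p using S \<open>\<beta> \<in> S\<close> that by (auto simp: configs_def PiE_iff)
      then have "supp \<beta> = {}" using True unfolding supp_def by force
      then show ?thesis by simp
    next
      case False
      then show ?thesis using mult_right_mono[of 1 "real k" "real (card (supp \<beta>))"] by simp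
    qed
    then have "real (card (supp \<beta>)) / w \<le> 1 / 8" using few[OF that] wpos by (simp add: field_simps)
    then have "(1 - real (card (supp \<beta>)) / w) / modulus \<beta> \<ge> 7 / 8 / modulus \<beta>"
      using modulus_ge_1[of \<beta>] by (intro divide_right_mono) auto
    then show ?thesis unfolding K_def using corr_diagonal[of \<beta>] by linarith
  qed
  have "Q \<le> (\<Sum>\<beta>\<in>S. (b \<beta>)\<^sup>2 * (5 / 4 / modulus \<beta>))"
    unfolding Q_def by (rule quadratic_form_row_sums(1)[OF finS sym row])
  then have Qu: "Q \<le> 5 / 4 * (\<Sum>\<beta>\<in>S. (b \<beta>)\<^sup>2 / modulus \<beta>)" by (simp add: sum_distrib_left algebra_simps)
  have "(\<Sum>\<beta>\<in>S. (b \<beta>)\<^sup>2 * (1 / 2 / modulus \<beta>)) \<le> (\<Sum>\<beta>\<in>S. (b \<beta>)\<^sup>2 * (2 * K \<beta> \<beta> - 5 / 4 / modulus \<beta>))"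
  proof (intro sum_mono mult_left_mono)
    fix \<beta> assume "\<beta> \<in> S"
    then show "1 / 2 / modulus \<beta> \<le> 2 * K \<beta> \<beta> - 5 / 4 / modulus \<beta>"
      using diag[of \<beta>] by (simp add: field_simps)
  qed simp
  also have "\<dots> \<le> Q"
    unfolding Q_def by (rule quadratic_form_row_sums(2)[OF finS sym row])
  finally have Ql: "Q \<ge> 1 / 2 * (\<Sum>\<beta>\<in>S. (b \<beta>)\<^sup>2 / modulus \<beta>)" by (simp add: sum_distrib_left algebra_simps)
  have "(\<Sum>t\<in>{1..N}. (\<Sum>\<beta>\<in>S. b \<beta> * wave \<beta> t)\<^sup>2)
      = (\<Sum>t\<in>{1..N}. \<Sum>\<beta>\<in>S. \<Sum>\<gamma>\<in>S. b \<beta> * b \<gamma> * (wave \<beta> t * wave \<gamma> t))"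
    unfolding power2_eq_square sum_product by (simp add: algebra_simps)
  also have "\<dots> = (\<Sum>\<beta>\<in>S. \<Sum>t\<in>{1..N}. \<Sum>\<gamma>\<in>S. b \<beta> * b \<gamma> * (wave \<beta> t * wave \<gamma> t))" by (rule sum.swap)
  also have "\<dots> = (\<Sum>\<beta>\<in>S. \<Sum>\<gamma>\<in>S. \<Sum>t\<in>{1..N}. b \<beta> * b \<gamma> * (wave \<beta> t * wave \<gamma> t))"
    by (intro sum.cong refl sum.swap)
  also have "\<dots> = (\<Sum>\<beta>\<in>S. \<Sum>\<gamma>\<in>S. b \<beta> * b \<gamma> * (\<Sum>t\<in>{1..N}. wave \<beta> t * wave \<gamma> t))"
    by (simp add: sum_distrib_left)
  finally have exp: "(\<Sum>t\<in>{1..N}. (\<Sum>\<beta>\<in>S. b \<beta> * wave \<beta> t)\<^sup>2)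
      = (\<Sum>\<beta>\<in>S. \<Sum>\<gamma>\<in>S. b \<beta> * b \<gamma> * (\<Sum>t\<in>{1..N}. wave \<beta> t * wave \<gamma> t))" .
  have NQ: "real N * Q = (\<Sum>\<beta>\<in>S. \<Sum>\<gamma>\<in>S. b \<beta> * b \<gamma> * (real N * K \<beta> \<gamma>))"
    unfolding Q_def by (simp add: sum_distrib_left algebra_simps)
  have "\<bar>(\<Sum>t\<in>{1..N}. (\<Sum>\<beta>\<in>S. b \<beta> * wave \<beta> t)\<^sup>2) - real N * Q\<bar>
      = \<bar>\<Sum>\<beta>\<in>S. \<Sum>\<gamma>\<in>S. b \<beta> * b \<gamma> * ((\<Sum>t\<in>{1..N}. wave \<beta> t * wave \<gamma> t) - real N * K \<beta> \<gamma>)\<bar>"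
    unfolding exp NQ by (simp add: right_diff_distrib sum_subtractf)
  also have "\<dots> \<le> (\<Sum>\<beta>\<in>S. \<Sum>\<gamma>\<in>S. 2 * modulus \<beta> * modulus \<gamma>)"
  proof (intro order.trans[OF sum_abs] sum_mono)
    fix \<beta> \<gamma> assume bg: "\<beta> \<in> S" "\<gamma> \<in> S"
    have "\<bar>b \<beta> * b \<gamma>\<bar> \<le> 1" using b[OF bg(1)] b[OF bg(2)] by (simp add: abs_mult mult_le_one)
    then have "\<bar>b \<beta> * b \<gamma>\<bar> * \<bar>(\<Sum>t\<in>{1..N}. wave \<beta> t * wave \<gamma> t) - real N * K \<beta> \<gamma>\<bar>
        \<le> 1 * (2 * modulus \<beta> * modulus \<gamma>)"
      unfolding K_def using bg S by (intro mult_mono wave_correlation) auto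
    then show "\<bar>b \<beta> * b \<gamma> * ((\<Sum>t\<in>{1..N}. wave \<beta> t * wave \<gamma> t) - real N * K \<beta> \<gamma>)\<bar>
        \<le> 2 * modulus \<beta> * modulus \<gamma>" by (simp add: abs_mult)
  qed
  also have "\<dots> = 2 * (\<Sum>\<beta>\<in>S. modulus \<beta>)\<^sup>2"
    unfolding power2_eq_square sum_product by (simp add: sum_distrib_left mult.assoc)
  finally have err: "\<bar>(\<Sum>t\<in>{1..N}. (\<Sum>\<beta>\<in>S. b \<beta> * wave \<beta> t)\<^sup>2) - real N * Q\<bar> \<le> 2 * (\<Sum>\<beta>\<in>S. modulus \<beta>)\<^sup>2" .
  show ?upper using err mult_left_mono[OF Qu, of "real N"] by (simp only: abs_le_iff) linarith
  show ?lower using err mult_left_mono[OF Ql, of "real N"] by (simp only: abs_le_iff) linarith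
qed

definition coef :: "(nat set \<Rightarrow> real) \<Rightarrow> (nat \<Rightarrow> nat) \<Rightarrow> real" where
  "coef \<alpha> \<beta> = (\<Prod>i\<in>{1..k}. \<alpha> (block \<beta> i))"

lemma modulus_eq_real_prod: "modulus \<beta> = real_prod (supp \<beta>)"
  by (simp add: modulus_def real_prod_def)

lemma real_prod_ge_1: "A \<subseteq> P \<Longrightarrow> real_prod A \<ge> 1"
  unfolding real_prod_def by (intro prod_ge_1) (use P_pos in \<open>force simp: Suc_le_eq\<close>)

lemma sum_inverse_squares: "(\<Sum>p\<in>P. 1 / (real p)\<^sup>2) \<le> 2 / w"
proof -
  define m where "m = nat \<lfloor>w\<rfloor>"
  have m: "m \<ge> 3" "real m \<le> w" "w < real m + 1" using w_ge unfolding m_def by linarith+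
  have tel: "(\<Sum>n\<in>{m<..m + j}. 1 / (real n)\<^sup>2) \<le> 1 / real m - 1 / real (m + j)" for j
  proof (induction j)
    case (Suc j)
    have "{m<..m + Suc j} = insert (m + Suc j) {m<..m + j}" by auto
    then have "(\<Sum>n\<in>{m<..m + Suc j}. 1 / (real n)\<^sup>2)
        = 1 / (real (m + Suc j))\<^sup>2 + (\<Sum>n\<in>{m<..m + j}. 1 / (real n)\<^sup>2)" by simp
    moreover have "1 / (real (m + Suc j))\<^sup>2 \<le> 1 / real (m + j) - 1 / real (m + Suc j)"
    proof -
      have a: "real (m + j) > 0" using m by simp
      have "1 / (real (m + Suc j))\<^sup>2 \<le> 1 / (real (m + j) * real (m + Suc j))"
        using a by (intro divide_left_mono) (auto simp: power2_eq_square)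
      also have "\<dots> = 1 / real (m + j) - 1 / real (m + Suc j)"
        using a by (simp add: divide_simps)
      finally show ?thesis .
    qed
    ultimately show ?case using Suc by linarith
  qed simp
  have "P \<subseteq> {m<..m + Max (insert 0 P)}"
  proof
    fix p assume p: "p \<in> P"
    have "p \<le> Max (insert 0 P)" using finite_P p by (intro Max_ge) auto
    moreover have "m < p" using large_P[OF p] m by linarith
    ultimately show "p \<in> {m<..m + Max (insert 0 P)}" by auto
  qed
  then have "(\<Sum>p\<in>P. 1 / (real p)\<^sup>2) \<le> (\<Sum>n\<in>{m<..m + Max (insert 0 P)}. 1 / (real n)\<^sup>2)"
    by (intro sum_mono2) auto
  also have "\<dots> \<le> 1 / real m" using tel[of "Max (insert 0 P)"] by (smt (verit) divide_nonneg_nonneg of_nat_0_le_iff)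
  also have "\<dots> \<le> 2 / w" using m by (simp add: field_simps)
  finally show ?thesis .
qed

text \<open>
  Rankin's trick: a modulus \<open>m \<le> Y\<close> is at most \<open>Y\<^sup>3 / m\<^sup>2\<close>, and the sum of \<open>1 / m\<^sup>2\<close> over all
  configurations is a bounded product.
\<close>

lemma sum_modulus_le:
  assumes "Y \<ge> 0"
  shows "(\<Sum>\<beta> | \<beta> \<in> configs \<and> modulus \<beta> \<le> Y. modulus \<beta>) \<le> exp (2 * real k / w) * Y ^ 3"
proof -
  have "(\<Sum>\<beta> | \<beta> \<in> configs \<and> modulus \<beta> \<le> Y. modulus \<beta>)
      \<le> (\<Sum>\<beta> | \<beta> \<in> configs \<and> modulus \<beta> \<le> Y. Y ^ 3 * (1 / (modulus \<beta>)\<^sup>2))"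
  proof (rule sum_mono)
    fix \<beta> assume "\<beta> \<in> {\<beta>. \<beta> \<in> configs \<and> modulus \<beta> \<le> Y}"
    then have "(modulus \<beta>) ^ 3 \<le> Y ^ 3" using modulus_ge_1[of \<beta>] by (intro power_mono) auto
    then show "modulus \<beta> \<le> Y ^ 3 * (1 / (modulus \<beta>)\<^sup>2)"
      using modulus_ge_1[of \<beta>] by (simp add: field_simps power2_eq_square power3_eq_cube)
  qed
  also have "\<dots> \<le> (\<Sum>\<beta>\<in>configs. Y ^ 3 * (1 / (modulus \<beta>)\<^sup>2))"
    by (intro sum_mono2 finite_configs) (use assms in auto)
  also have "\<dots> = Y ^ 3 * (\<Sum>\<beta>\<in>configs. \<Prod>p\<in>P. if \<beta> p = 0 then 1 else 1 / (real p)\<^sup>2)"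
  proof -
    have "1 / (modulus \<beta>)\<^sup>2 = (\<Prod>p\<in>P. if \<beta> p = 0 then 1 else 1 / (real p)\<^sup>2)" for \<beta>
    proof -
      have "(\<Prod>p\<in>P. if \<beta> p = 0 then 1 else 1 / (real p)\<^sup>2) = (\<Prod>p\<in>supp \<beta>. if \<beta> p = 0 then 1 else 1 / (real p)\<^sup>2)"
        by (rule prod.mono_neutral_right) (auto simp: finite_P supp_def)
      also have "\<dots> = (\<Prod>p\<in>supp \<beta>. 1 / (real p)\<^sup>2)"
        by (intro prod.cong) (auto simp: supp_def)
      finally show ?thesis by (simp add: modulus_def prod_dividef prod_power_distrib)
    qed
    then show ?thesis by (simp add: sum_distrib_left)
  qed
  also have "\<dots> \<le> Y ^ 3 * exp (2 * real k / w)"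
  proof (rule mult_left_mono)
  have "(\<Sum>\<beta>\<in>configs. \<Prod>p\<in>P. if \<beta> p = 0 then 1 else 1 / (real p)\<^sup>2)
      = (\<Prod>p\<in>P. \<Sum>j\<le>k. if j = 0 then 1 else 1 / (real p)\<^sup>2)"
    unfolding configs_def by (rule prod_sum_PiE[symmetric]) (auto simp: finite_P)
  also have "\<dots> \<le> (\<Prod>p\<in>P. exp (real k * (1 / (real p)\<^sup>2)))"
  proof (intro prod_mono conjI sum_nonneg)
    fix p assume "p \<in> P"
    have "(\<Sum>j\<le>k. if j = 0 then 1 else 1 / (real p)\<^sup>2) = 1 + real k * (1 / (real p)\<^sup>2)"
      by (induction k) (auto simp: add_divide_distrib)
    then show "(\<Sum>j\<le>k. if j = 0 then 1 else 1 / (real p)\<^sup>2) \<le> exp (real k * (1 / (real p)\<^sup>2))"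
      by (simp add: exp_ge_add_one_self[of "real k * (1 / (real p)\<^sup>2)", simplified])
  qed auto
  also have "\<dots> = exp (real k * (\<Sum>p\<in>P. 1 / (real p)\<^sup>2))"
    by (simp add: exp_sum finite_P sum_distrib_left)
  also have "\<dots> \<le> exp (2 * real k / w)"
    using mult_left_mono[OF sum_inverse_squares, of "real k"] by (simp add: mult.commute)
  finally show "(\<Sum>\<beta>\<in>configs. \<Prod>p\<in>P. if \<beta> p = 0 then 1 else 1 / (real p)\<^sup>2) \<le> exp (2 * real k / w)" .
  qed (use assms in simp)
  finally show ?thesis by (simp add: mult.commute)
qed

text \<open>
  A configuration is determined by its blocks, so the sum is part of the expanded \<open>k\<close>-fold product.
\<close>

lemma sum_configs_le:
  fixes g :: "nat set \<Rightarrow> real"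
  assumes g: "\<And>A. A \<subseteq> P \<Longrightarrow> g A \<ge> 0"
  shows "(\<Sum>\<beta>\<in>configs. \<Prod>i\<in>{1..k}. g (block \<beta> i)) \<le> (\<Sum>A\<in>Pow P. g A) ^ k"
proof -
  let ?T = "{1..k} \<rightarrow>\<^sub>E Pow P"
  let ?f = "\<lambda>\<beta>. restrict (block \<beta>) {1..k}"
  have "(\<Sum>\<beta>\<in>configs. \<Prod>i\<in>{1..k}. g (block \<beta> i)) = (\<Sum>\<beta>\<in>configs. \<Prod>i\<in>{1..k}. g (?f \<beta> i))"
    by (intro sum.cong prod.cong) auto
  also have "\<dots> = (\<Sum>h\<in>?f ` configs. \<Prod>i\<in>{1..k}. g (h i))"
  proof (rule sum.reindex[symmetric, unfolded o_def])
    show "inj_on ?f configs"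
    proof (rule inj_onI)
      fix \<beta> \<gamma> assume bg: "\<beta> \<in> configs" "\<gamma> \<in> configs" and e: "?f \<beta> = ?f \<gamma>"
      have e: "block \<beta> i = block \<gamma> i" if "i \<in> {1..k}" for i using fun_cong[OF e, of i] that by simp
      show "\<beta> = \<gamma>"
      proof (rule PiE_ext[of _ P "\<lambda>_. {..k}"])
        fix p assume p: "p \<in> P"
        then have "\<beta> p \<le> k" "\<gamma> p \<le> k" using bg by (auto simp: configs_def PiE_iff)
        moreover have "\<beta> p = i \<longleftrightarrow> \<gamma> p = i" if "i \<in> {1..k}" for i using e[OF that] p by (auto simp: block_def)
        ultimately show "\<beta> p = \<gamma> p" by (metis atLeastAtMost_iff less_one not_le)
      qed (use bg in \<open>auto simp: configs_def\<close>)
    qed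
  qed
  also have "\<dots> \<le> (\<Sum>h\<in>?T. \<Prod>i\<in>{1..k}. g (h i))"
  proof (rule sum_mono2)
    show "finite ?T" using finite_P by (intro finite_PiE) auto
    show "?f ` configs \<subseteq> ?T" by (auto simp: block_def)
  qed (auto intro!: prod_nonneg g simp: PiE_iff)
  also have "\<dots> = (\<Prod>i\<in>{1..k}. \<Sum>A\<in>Pow P. g A)"
    by (rule prod_sum_PiE[symmetric]) (auto simp: finite_P)
  finally show ?thesis by simp
qed

text \<open>
  The tuples of sets missing from the sum over configurations are those in which two boxes share a
  prime; a union bound over the two boxes and the prime shows that they contribute little.
\<close>

lemma sum_configs_ge:
  fixes g :: "nat set \<Rightarrow> real"
  assumes g: "\<And>A. A \<subseteq> P \<Longrightarrow> g A \<ge> 0" and g0: "g {} = 1"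
  shows "(\<Sum>A\<in>Pow P. g A) ^ k * (1 - (real k)\<^sup>2 * (\<Sum>p\<in>P. (\<Sum>A | A \<subseteq> P \<and> p \<in> A. g A)\<^sup>2))
    \<le> (\<Sum>\<beta>\<in>configs. \<Prod>i\<in>{1..k}. g (block \<beta> i))"
proof -
  define T where "T = ({1..k} \<rightarrow>\<^sub>E Pow P)"
  define F where "F h = (\<Prod>i\<in>{1..k}. g (h i))" for h :: "nat \<Rightarrow> nat set"
  define G where "G = (\<Sum>A\<in>Pow P. g A)"
  define Gp where "Gp p = (\<Sum>A | A \<subseteq> P \<and> p \<in> A. g A)" for p
  define I where "I = {(i, j). i \<in> {1..k} \<and> j \<in> {1..k} \<and> i \<noteq> j}"
  let ?f = "\<lambda>\<beta>. restrict (block \<beta>) {1..k}"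
  have finT: "finite T" unfolding T_def using finite_P by (intro finite_PiE) auto
  have Fnn: "F h \<ge> 0" if "h \<in> T" for h
    unfolding F_def using that by (intro prod_nonneg g) (auto simp: T_def PiE_iff)
  have Gpnn: "Gp p \<ge> 0" for p unfolding Gp_def by (intro sum_nonneg g) auto
  have G1: "G \<ge> 1"
  proof -
    have "g {} \<le> G" unfolding G_def by (rule member_le_sum) (use finite_P g in auto)
    then show ?thesis using g0 by simp
  qed
  have finI: "finite I" by (rule finite_subset[of _ "{1..k} \<times> {1..k}"]) (auto simp: I_def)
  have cardI: "real (card I) \<le> (real k)\<^sup>2"
  proof -
    have "card I \<le> card ({1..k} \<times> {1..k})" by (intro card_mono) (auto simp: I_def)
    then have "card I \<le> k * k" by simp
    then show ?thesis by (metis of_nat_le_iff of_nat_mult power2_eq_square)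
  qed
  have clash: "(\<Sum>h\<in>T. F h * of_bool (p \<in> h i \<and> p \<in> h j)) \<le> G ^ k * (Gp p)\<^sup>2"
    if ij: "(i, j) \<in> I" for i j p
  proof -
    \<comment> \<open>Boxes \<open>i\<close> and \<open>j\<close> are both forced to contain \<open>p\<close>; the others stay free.\<close>
    define B where "B l = (if l = i \<or> l = j then {A. A \<subseteq> P \<and> p \<in> A} else Pow P)" for l
    have ij': "i \<in> {1..k}" "j \<in> {1..k}" "i \<noteq> j" using ij by (auto simp: I_def)
    have "(\<Sum>h\<in>T. F h * of_bool (p \<in> h i \<and> p \<in> h j)) = (\<Sum>h\<in>Pi\<^sub>E {1..k} B. F h)"
    proof -
      have "(\<Sum>h\<in>T. F h * of_bool (p \<in> h i \<and> p \<in> h j)) = (\<Sum>h\<in>Pi\<^sub>E {1..k} B. F h * of_bool (p \<in> h i \<and> p \<in> h j))"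
      proof (rule sum.mono_neutral_right[OF finT])
        show "Pi\<^sub>E {1..k} B \<subseteq> T" unfolding T_def by (rule PiE_mono) (auto simp: B_def)
        show "\<forall>h\<in>T - Pi\<^sub>E {1..k} B. F h * of_bool (p \<in> h i \<and> p \<in> h j) = 0"
          by (auto simp: T_def B_def PiE_iff split: if_splits)
      qed
      also have "\<dots> = (\<Sum>h\<in>Pi\<^sub>E {1..k} B. F h)"
        by (intro sum.cong refl) (use ij' in \<open>auto simp: PiE_iff B_def split: if_splits\<close>)
      finally show ?thesis by simp
    qed
    also have "\<dots> = (\<Prod>l\<in>{1..k}. \<Sum>A\<in>B l. g A)"
      unfolding F_def by (subst prod_sum_PiE) (auto simp: B_def finite_P)
    also have "\<dots> = (\<Prod>l\<in>{1..k}. if l \<in> {i, j} then Gp p else G)"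
      by (intro prod.cong refl) (auto simp: B_def Gp_def G_def)
    also have "\<dots> = (Gp p)\<^sup>2 * G ^ card ({1..k} - {i, j})"
    proof -
      have "{1..k} \<inter> {l. l \<in> {i, j}} = {i, j}" "{1..k} \<inter> - {l. l \<in> {i, j}} = {1..k} - {i, j}" using ij' by auto
      then show ?thesis using ij' by (simp add: prod.If_cases power2_eq_square)
    qed
    also have "\<dots> \<le> (Gp p)\<^sup>2 * G ^ k"
      using G1 card_mono[of "{1..k}" "{1..k} - {i, j}"] by (intro mult_left_mono power_increasing) auto
    finally show ?thesis by (simp add: mult.commute)
  qed
  have good: "h \<in> ?f ` configs" if h: "h \<in> T" and disj: "\<forall>(i, j)\<in>I. \<forall>p\<in>P. \<not> (p \<in> h i \<and> p \<in> h j)" for h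
  proof -
    have hs: "h i \<subseteq> P" if "i \<in> {1..k}" for i using h that by (auto simp: T_def PiE_iff)
    define \<beta> where "\<beta> = (\<lambda>p\<in>P. if \<exists>i\<in>{1..k}. p \<in> h i then (SOME i. i \<in> {1..k} \<and> p \<in> h i) else 0)"
    have val: "\<beta> p = i" if "p \<in> P" "i \<in> {1..k}" "p \<in> h i" for p i
    proof -
      have "(SOME i. i \<in> {1..k} \<and> p \<in> h i) = i"
        using that disj by (intro some_equality) (auto simp: I_def)
      then show ?thesis using that by (auto simp: \<beta>_def)
    qed
    have val0: "p \<in> h i" if "p \<in> P" "i \<in> {1..k}" "\<beta> p = i" for p i
    proof -
      have "\<exists>j\<in>{1..k}. p \<in> h j"
      proof (rule ccontr)
        assume "\<not> ?thesis"
        then have "\<beta> p = 0" using that(1) by (simp add: \<beta>_def)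
        then show False using that by simp
      qed
      then show ?thesis using val[OF that(1)] that(3) by blast
    qed
    have "\<beta> \<in> configs"
      unfolding configs_def
    proof (rule PiE_I)
      fix p assume p: "p \<in> P"
      show "\<beta> p \<in> {..k}"
      proof (cases "\<exists>i\<in>{1..k}. p \<in> h i")
        case True then show ?thesis using val[OF p] by auto
      next
        case False then show ?thesis using p by (auto simp: \<beta>_def)
      qed
    qed (simp add: \<beta>_def)
    moreover have "h = ?f \<beta>"
    proof
      fix i show "h i = ?f \<beta> i"
      proof (cases "i \<in> {1..k}")
        case True
        have "h i = block \<beta> i" unfolding block_def using val[OF _ True] val0[OF _ True] hs[OF True] by blast
        then show ?thesis using True by simp
      next
        case False
        then have "h i = undefined" using h unfolding T_def by (rule PiE_arb[rotated])
        then show ?thesis using False by auto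
      qed
    qed
    ultimately show ?thesis by blast
  qed
  have "G ^ k = (\<Prod>i\<in>{1..k}. \<Sum>A\<in>Pow P. g A)" by (simp add: G_def)
  also have "\<dots> = (\<Sum>h\<in>T. F h)"
    unfolding T_def F_def by (rule prod_sum_PiE) (auto simp: finite_P)
  also have "\<dots> \<le> (\<Sum>h\<in>T. F h * of_bool (h \<in> ?f ` configs)
      + (\<Sum>(i, j)\<in>I. \<Sum>p\<in>P. F h * of_bool (p \<in> h i \<and> p \<in> h j)))"
  proof (rule sum_mono)
    fix h assume h: "h \<in> T"
    show "F h \<le> F h * of_bool (h \<in> ?f ` configs)
      + (\<Sum>(i, j)\<in>I. \<Sum>p\<in>P. F h * of_bool (p \<in> h i \<and> p \<in> h j))"
    proof (cases "h \<in> ?f ` configs")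
      case True
      then show ?thesis using Fnn[OF h] by (auto intro!: sum_nonneg)
    next
      case False
      then obtain i j p where ijp: "(i, j) \<in> I" "p \<in> P" "p \<in> h i" "p \<in> h j" using good[OF h] by blast
      have "F h \<le> (\<Sum>p\<in>P. F h * of_bool (p \<in> h i \<and> p \<in> h j))"
        using member_le_sum[of p P "\<lambda>p. F h * of_bool (p \<in> h i \<and> p \<in> h j)"] ijp Fnn[OF h] finite_P by auto
      also have "\<dots> \<le> (\<Sum>(i, j)\<in>I. \<Sum>p\<in>P. F h * of_bool (p \<in> h i \<and> p \<in> h j))"
        using member_le_sum[of "(i, j)" I "\<lambda>(i, j). \<Sum>p\<in>P. F h * of_bool (p \<in> h i \<and> p \<in> h j)"]
          ijp finI sum_nonneg[of P "\<lambda>p. F h * of_bool (p \<in> h a \<and> p \<in> h c)" for a c] Fnn[OF h] by auto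
      finally show ?thesis using False by simp
    qed
  qed
  also have "\<dots> = (\<Sum>h\<in>T. F h * of_bool (h \<in> ?f ` configs))
      + (\<Sum>(i, j)\<in>I. \<Sum>p\<in>P. \<Sum>h\<in>T. F h * of_bool (p \<in> h i \<and> p \<in> h j))"
  proof -
    have "(\<Sum>h\<in>T. \<Sum>(i, j)\<in>I. \<Sum>p\<in>P. F h * of_bool (p \<in> h i \<and> p \<in> h j))
      = (\<Sum>(i, j)\<in>I. \<Sum>h\<in>T. \<Sum>p\<in>P. F h * of_bool (p \<in> h i \<and> p \<in> h j))"
      by (subst sum.swap) (simp add: case_prod_beta)
    also have "\<dots> = (\<Sum>(i, j)\<in>I. \<Sum>p\<in>P. \<Sum>h\<in>T. F h * of_bool (p \<in> h i \<and> p \<in> h j))"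
      by (subst sum.swap) (rule refl)
    finally show ?thesis by (simp add: sum.distrib)
  qed
  also have "\<dots> \<le> (\<Sum>h\<in>T. F h * of_bool (h \<in> ?f ` configs)) + (\<Sum>(i, j)\<in>I. \<Sum>p\<in>P. G ^ k * (Gp p)\<^sup>2)"
    by (intro add_left_mono sum_mono) (auto intro!: sum_mono clash)
  also have "\<dots> \<le> (\<Sum>h\<in>T. F h * of_bool (h \<in> ?f ` configs)) + (real k)\<^sup>2 * (\<Sum>p\<in>P. G ^ k * (Gp p)\<^sup>2)"
    using cardI G1 by (auto intro!: mult_right_mono sum_nonneg)
  finally have Gk: "G ^ k \<le> (\<Sum>h\<in>T. F h * of_bool (h \<in> ?f ` configs))
      + (real k)\<^sup>2 * (\<Sum>p\<in>P. G ^ k * (Gp p)\<^sup>2)" .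
  have sub: "?f ` configs \<subseteq> T" by (auto simp: block_def T_def)
  have "(\<Sum>h\<in>T. F h * of_bool (h \<in> ?f ` configs)) = (\<Sum>h\<in>?f ` configs. F h * of_bool (h \<in> ?f ` configs))"
    using sub by (intro sum.mono_neutral_right finT) auto
  also have "\<dots> = (\<Sum>h\<in>?f ` configs. F h)" by (intro sum.cong refl) simp
  also have "\<dots> \<le> (\<Sum>\<beta>\<in>configs. F (?f \<beta>))"
    by (rule sum_image_le[unfolded o_def, OF finite_configs]) (use sub Fnn in blast)
  also have "\<dots> = (\<Sum>\<beta>\<in>configs. \<Prod>i\<in>{1..k}. g (block \<beta> i))"
    unfolding F_def by (intro sum.cong prod.cong) auto
  finally have "G ^ k \<le> (\<Sum>\<beta>\<in>configs. \<Prod>i\<in>{1..k}. g (block \<beta> i))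
      + (real k)\<^sup>2 * (\<Sum>p\<in>P. G ^ k * (Gp p)\<^sup>2)" using Gk by linarith
  moreover have "(\<Sum>p\<in>P. G ^ k * (Gp p)\<^sup>2) = G ^ k * (\<Sum>p\<in>P. (Gp p)\<^sup>2)" by (simp only: sum_distrib_left)
  ultimately have "G ^ k * (1 - (real k)\<^sup>2 * (\<Sum>p\<in>P. (Gp p)\<^sup>2))
      \<le> (\<Sum>\<beta>\<in>configs. \<Prod>i\<in>{1..k}. g (block \<beta> i))" by (simp add: right_diff_distrib mult.left_commute)
  then show ?thesis by (simp only: G_def Gp_def)
qed

text \<open>
  The inverse of removing box \<open>i\<close> from a configuration: the primes of \<open>A\<close> are handed to box \<open>i\<close>.
\<close>

definition glue :: "(nat \<Rightarrow> nat) \<Rightarrow> nat set \<Rightarrow> nat \<Rightarrow> nat \<Rightarrow> nat" where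
  "glue \<beta> A i = (\<lambda>p. if p \<in> A then i else \<beta> p)"

text \<open>
  What remains of the sum over box \<open>i\<close> after a wave is evaluated where that box is uncovered: every
  admissible set \<open>A\<close> then contributes its coefficient divided by its product.  The coefficients will be
  chosen so that the full sum vanishes; then only the effect of truncating at \<open>Y\<close> and of
  coprimality with the other boxes is left.
\<close>

definition defect :: "(nat set \<Rightarrow> real) \<Rightarrow> real \<Rightarrow> (nat \<Rightarrow> nat) \<Rightarrow> real" where
  "defect \<alpha> Y \<beta> = (\<Sum>A | A \<subseteq> P - supp \<beta> \<and> real_prod A * modulus \<beta> \<le> Y. \<alpha> A / real_prod A)"

lemma glue_configs: "\<beta> \<in> configs \<Longrightarrow> i \<in> {1..k} \<Longrightarrow> A \<subseteq> P \<Longrightarrow> glue \<beta> A i \<in> configs"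
  by (auto simp: configs_def PiE_iff glue_def extensional_def)

lemma supp_glue: "i \<in> {1..k} \<Longrightarrow> A \<subseteq> P \<Longrightarrow> supp (glue \<beta> A i) = supp \<beta> \<union> A"
  by (auto simp: supp_def glue_def)

lemma modulus_glue:
  assumes "i \<in> {1..k}" "A \<subseteq> P - supp \<beta>"
  shows "modulus (glue \<beta> A i) = real_prod A * modulus \<beta>"
proof -
  have "finite A" using assms(2) finite_P finite_subset by blast
  then have "real_prod (supp \<beta> \<union> A) = real_prod (supp \<beta>) * real_prod A"
    unfolding real_prod_def using assms(2) by (intro prod.union_disjoint) auto
  then show ?thesis using assms by (simp add: modulus_eq_real_prod supp_glue Diff_subset_conv subset_iff)
qed

lemma block_glue:
  assumes "i \<in> {1..k}" "A \<subseteq> P - supp \<beta>"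
  shows "block \<beta> i = {} \<Longrightarrow> block (glue \<beta> A i) i = A"
    and "j \<in> {1..k} \<Longrightarrow> j \<noteq> i \<Longrightarrow> block (glue \<beta> A i) j = block \<beta> j"
  using assms by (auto simp: block_def glue_def supp_def)

lemma wave_glue:
  assumes i: "i \<in> {1..k}" and A: "A \<subseteq> P - supp \<beta>"
    and unc: "\<And>p. p \<in> P \<Longrightarrow> t mod p \<noteq> r p i"
  shows "wave (glue \<beta> A i) t = wave \<beta> t / real_prod A"
proof -
  have "wave (glue \<beta> A i) t = (\<Prod>p\<in>P. local_factor p (\<beta> p) t * (if p \<in> A then 1 / real p else 1))"
    unfolding wave_def using A i unc by (intro prod.cong refl) (auto simp: glue_def local_factor_def supp_def)
  also have "\<dots> = wave \<beta> t * (\<Prod>p\<in>P. if p \<in> A then 1 / real p else 1)"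
    by (simp only: prod.distrib wave_def)
  also have "(\<Prod>p\<in>P. if p \<in> A then 1 / real p else 1) = (\<Prod>p\<in>P \<inter> A. 1 / real p)"
    by (rule prod.inter_restrict[OF finite_P, symmetric])
  also have "P \<inter> A = A" using A by blast
  finally show ?thesis by (simp add: real_prod_def prod_dividef)
qed

lemma coef_glue:
  assumes i: "i \<in> {1..k}" and A: "A \<subseteq> P - supp \<beta>" and b: "block \<beta> i = {}" and a0: "\<alpha> {} = 1"
  shows "coef \<alpha> (glue \<beta> A i) = coef \<alpha> \<beta> * \<alpha> A"
proof -
  have rem: "(\<Prod>j\<in>{1..k}. f j) = f i * (\<Prod>j\<in>{1..k} - {i}. f j)" for f :: "nat \<Rightarrow> real"
    by (rule prod.remove) (use i in auto)
  have "(\<Prod>j\<in>{1..k} - {i}. \<alpha> (block (glue \<beta> A i) j)) = (\<Prod>j\<in>{1..k} - {i}. \<alpha> (block \<beta> j))"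
    using block_glue(2)[OF i A] by (intro prod.cong refl) auto
  then show ?thesis
    unfolding coef_def rem[of "\<lambda>j. \<alpha> (block (glue \<beta> A i) j)"] rem[of "\<lambda>j. \<alpha> (block \<beta> j)"]
    by (simp add: block_glue(1)[OF i A b] b a0)
qed

text \<open>
  Where box \<open>i\<close> is uncovered, all its local factors are the constants \<open>1/p\<close>.  Grouping the configurations by
  their part outside box \<open>i\<close> therefore eliminates that box, and no indicator of the event is left.
\<close>

lemma wave_sum_uncovered:
  assumes i: "i \<in> {1..k}" and unc: "\<And>p. p \<in> P \<Longrightarrow> t mod p \<noteq> r p i" and a0: "\<alpha> {} = 1"
  shows "(\<Sum>\<beta> | \<beta> \<in> configs \<and> modulus \<beta> \<le> Y. coef \<alpha> \<beta> * wave \<beta> t)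
    = (\<Sum>\<beta> | \<beta> \<in> configs \<and> modulus \<beta> \<le> Y \<and> block \<beta> i = {}. coef \<alpha> \<beta> * defect \<alpha> Y \<beta> * wave \<beta> t)"
    (is "?L = ?R")
proof -
  define B where "B = {\<beta>. \<beta> \<in> configs \<and> modulus \<beta> \<le> Y \<and> block \<beta> i = {}}"
  define T where "T \<beta> = {A. A \<subseteq> P - supp \<beta> \<and> real_prod A * modulus \<beta> \<le> Y}" for \<beta>
  have finB: "finite B" unfolding B_def using finite_configs by simp
  have finT: "finite (T \<beta>)" for \<beta>
    unfolding T_def by (rule finite_subset[of _ "Pow P"]) (auto simp: finite_P)
  have glue_wave: "coef \<alpha> \<beta> * wave \<beta> t * (\<alpha> A / real_prod A) = coef \<alpha> (glue \<beta> A i) * wave (glue \<beta> A i) t"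
    if "\<beta> \<in> B" "A \<in> T \<beta>" for \<beta> A
  proof -
    have A: "A \<subseteq> P - supp \<beta>" and b: "block \<beta> i = {}" using that by (auto simp: B_def T_def)
    show ?thesis using coef_glue[where \<alpha> = \<alpha>, OF i A b a0] wave_glue[OF i A unc] by simp
  qed
  have "?R = (\<Sum>\<beta>\<in>B. \<Sum>A\<in>T \<beta>. coef \<alpha> (glue \<beta> A i) * wave (glue \<beta> A i) t)"
    unfolding B_def[symmetric]
  proof (rule sum.cong[OF refl])
    fix \<beta> assume "\<beta> \<in> B"
    then have "(\<Sum>A\<in>T \<beta>. coef \<alpha> (glue \<beta> A i) * wave (glue \<beta> A i) t)
        = (\<Sum>A\<in>T \<beta>. coef \<alpha> \<beta> * wave \<beta> t * (\<alpha> A / real_prod A))"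
      using glue_wave by (intro sum.cong refl) auto
    also have "\<dots> = coef \<alpha> \<beta> * wave \<beta> t * (\<Sum>A\<in>T \<beta>. \<alpha> A / real_prod A)" by (simp only: sum_distrib_left)
    finally show "coef \<alpha> \<beta> * defect \<alpha> Y \<beta> * wave \<beta> t
        = (\<Sum>A\<in>T \<beta>. coef \<alpha> (glue \<beta> A i) * wave (glue \<beta> A i) t)"
      by (simp add: defect_def T_def)
  qed
  also have "\<dots> = (\<Sum>(\<beta>, A)\<in>Sigma B T. coef \<alpha> (glue \<beta> A i) * wave (glue \<beta> A i) t)"
    using finB finT by (subst sum.Sigma) auto
  also have "\<dots> = ?L"
  proof (rule sum.reindex_bij_witness[where j = "\<lambda>(\<beta>, A). glue \<beta> A i" and i = "\<lambda>\<beta>. (glue \<beta> (block \<beta> i) 0, block \<beta> i)"])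
    fix x assume "x \<in> Sigma B T"
    then obtain \<beta> A where x: "x = (\<beta>, A)" "\<beta> \<in> B" "A \<in> T \<beta>" by auto
    then have A: "A \<subseteq> P - supp \<beta>" and b: "block \<beta> i = {}" and c: "\<beta> \<in> configs" by (auto simp: B_def T_def)
    have gb: "block (glue \<beta> A i) i = A" by (rule block_glue(1)[OF i A b])
    have "glue (glue \<beta> A i) A 0 = \<beta>"
      using A by (auto simp: glue_def fun_eq_iff supp_def)
    then show "(glue (case x of (\<beta>, A) \<Rightarrow> glue \<beta> A i) (block (case x of (\<beta>, A) \<Rightarrow> glue \<beta> A i) i) 0,
        block (case x of (\<beta>, A) \<Rightarrow> glue \<beta> A i) i) = x"
      using x gb by simp
    show "(case x of (\<beta>, A) \<Rightarrow> glue \<beta> A i) \<in> {\<beta>. \<beta> \<in> configs \<and> modulus \<beta> \<le> Y}"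
      using x A glue_configs[OF c i, of A] modulus_glue[OF i A] by (auto simp: T_def)
    show "coef \<alpha> (case x of (\<beta>, A) \<Rightarrow> glue \<beta> A i) * wave (case x of (\<beta>, A) \<Rightarrow> glue \<beta> A i) t
       = (case x of (\<beta>, A) \<Rightarrow> coef \<alpha> (glue \<beta> A i) * wave (glue \<beta> A i) t)"
      using x by simp
  next
    fix \<gamma> assume g: "\<gamma> \<in> {\<beta>. \<beta> \<in> configs \<and> modulus \<beta> \<le> Y}"
    define \<beta> where "\<beta> = glue \<gamma> (block \<gamma> i) 0"
    define A where "A = block \<gamma> i"
    have eq: "glue \<beta> A i = \<gamma>" by (auto simp: \<beta>_def A_def glue_def block_def fun_eq_iff)
    have c: "\<beta> \<in> configs" using g by (auto simp: \<beta>_def configs_def PiE_iff glue_def block_def extensional_def)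
    have A: "A \<subseteq> P - supp \<beta>" by (auto simp: A_def \<beta>_def block_def supp_def glue_def)
    have b: "block \<beta> i = {}" using i by (auto simp: \<beta>_def block_def glue_def)
    have m: "real_prod A * modulus \<beta> \<le> Y" using modulus_glue[OF i A] eq g by simp
    have "modulus \<beta> \<le> real_prod A * modulus \<beta>"
      using real_prod_ge_1[of A] A modulus_ge_1[of \<beta>] by (intro mult_le_cancel_right1[THEN iffD2]) auto
    then have "\<beta> \<in> B" "A \<in> T \<beta>" using c A b m by (auto simp: B_def T_def)
    then show "(glue \<gamma> (block \<gamma> i) 0, block \<gamma> i) \<in> Sigma B T" by (simp add: \<beta>_def A_def)
    show "(case (glue \<gamma> (block \<gamma> i) 0, block \<gamma> i) of (\<beta>, A) \<Rightarrow> glue \<beta> A i) = \<gamma>"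
      using eq by (simp add: \<beta>_def A_def)
  qed
  finally show ?thesis by simp
qed

text \<open>
  The sets of primes whose products are the numbers \<open>d\<close> with \<open>1 < d \<le> Z\<close> over which a single box ranges.
\<close>

definition divisor_sets :: "real \<Rightarrow> nat set set" where
  "divisor_sets Z = {A. A \<subseteq> P \<and> A \<noteq> {} \<and> real_prod A \<le> Z}"

lemma finite_divisor_sets: "finite (divisor_sets Z)"
  unfolding divisor_sets_def by (rule finite_subset[of _ "Pow P"]) (auto simp: finite_P)

lemma real_prod_gt_w: "A \<subseteq> P \<Longrightarrow> A \<noteq> {} \<Longrightarrow> real_prod A > w"
proof -
  assume A: "A \<subseteq> P" "A \<noteq> {}"
  then obtain p where p: "p \<in> A" by blast
  have fA: "finite A" using A finite_P finite_subset by blast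
  have "real_prod A = real p * real_prod (A - {p})" unfolding real_prod_def using p fA by (intro prod.remove) auto
  also have "\<dots> \<ge> real p * 1" using real_prod_ge_1[of "A - {p}"] A by (intro mult_left_mono) auto
  finally show "real_prod A > w" using large_P[of p] p A by auto
qed

lemma sum_divisor_sets_containing_le:
  assumes p: "p \<in> P" and Z: "Z \<ge> 1"
  shows "(\<Sum>A | A \<in> divisor_sets Z \<and> p \<in> A. 1 / real_prod A) \<le> (1 + ln Z) / real p"
proof -
  let ?S = "{A. A \<in> divisor_sets Z \<and> p \<in> A}" and ?T = "{A. A \<subseteq> P \<and> real_prod A \<le> Z}"
  have pp: "real p \<ge> 1" using P_pos[OF p] by simp
  have split: "real_prod A = real p * real_prod (A - {p})" if "A \<in> ?S" for A
  proof -
    have "finite A" using that finite_P finite_subset by (auto simp: divisor_sets_def)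
    then show ?thesis unfolding real_prod_def using that by (intro prod.remove) auto
  qed
  have inj: "inj_on (\<lambda>A. A - {p}) ?S" by (rule inj_onI) blast
  have "(\<Sum>A\<in>?S. 1 / real_prod A) = (\<Sum>A\<in>?S. 1 / real_prod (A - {p}) / real p)"
    by (intro sum.cong refl) (simp add: split)
  also have "\<dots> = (\<Sum>A\<in>?S. 1 / real_prod (A - {p})) / real p" by (simp add: sum_divide_distrib)
  also have "(\<Sum>A\<in>?S. 1 / real_prod (A - {p})) = (\<Sum>A\<in>(\<lambda>A. A - {p}) ` ?S. 1 / real_prod A)"
    by (simp add: sum.reindex[OF inj])
  also have "\<dots> \<le> (\<Sum>A\<in>?T. 1 / real_prod A)"
  proof (rule sum_mono2)
    show "finite ?T" by (rule finite_subset[of _ "Pow P"]) (auto simp: finite_P)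
    show "(\<lambda>A. A - {p}) ` ?S \<subseteq> ?T"
    proof (intro image_subsetI)
      fix A assume A: "A \<in> ?S"
      then have sub: "A - {p} \<subseteq> P" by (auto simp: divisor_sets_def)
      have "1 * real_prod (A - {p}) \<le> real p * real_prod (A - {p})"
        using pp real_prod_ge_1[OF sub] by (intro mult_right_mono) auto
      then show "A - {p} \<in> ?T" using A split[OF A] sub by (auto simp: divisor_sets_def)
    qed
    show "0 \<le> 1 / real_prod A" if "A \<in> ?T - (\<lambda>A. A - {p}) ` ?S" for A using that real_prod_ge_1[of A] by auto
  qed
  also have "\<dots> \<le> 1 + ln Z" using finite_P prime_P Z by (rule sum_recip_prod_primes_le)
  finally show ?thesis using pp by (simp add: divide_right_mono)
qed

lemma modulus_eq_prod_blocks: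
  assumes "\<beta> \<in> configs"
  shows "modulus \<beta> = (\<Prod>i\<in>{1..k}. real_prod (block \<beta> i))"
proof -
  have "\<beta> p \<le> k" if "p \<in> P" for p using assms that by (auto simp: configs_def PiE_iff)
  then have "supp \<beta> = (\<Union>i\<in>{1..k}. block \<beta> i)" by (auto simp: supp_def block_def)
  then have "modulus \<beta> = (\<Prod>p\<in>(\<Union>i\<in>{1..k}. block \<beta> i). real p)" by (simp add: modulus_def)
  also have "\<dots> = (\<Prod>i\<in>{1..k}. \<Prod>p\<in>block \<beta> i. real p)"
    by (rule prod.UNION_disjoint) (auto simp: block_def finite_P)
  finally show ?thesis by (simp add: real_prod_def)
qed

lemma card_supp_le_ln_modulus: "real (card (supp \<beta>)) \<le> ln (modulus \<beta>)"
proof -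
  have "ln (modulus \<beta>) = (\<Sum>p\<in>supp \<beta>. ln (real p))"
    unfolding modulus_def using P_pos supp_subset by (intro ln_prod) auto
  moreover have "(\<Sum>p\<in>supp \<beta>. 1) \<le> (\<Sum>p\<in>supp \<beta>. ln (real p))"
  proof (rule sum_mono)
    fix p assume "p \<in> supp \<beta>"
    then have p: "p \<in> P" using supp_subset by blast
    have "exp 1 \<le> real p" using large_P[OF p] w_ge exp_le by linarith
    then show "1 \<le> ln (real p)" using P_pos[OF p] by (simp add: ln_ge_iff)
  qed
  ultimately show ?thesis by simp
qed

end

section \<open>The second moment argument\<close>

text \<open>
  The level \<open>Z\<close> bounds the divisors used by one box, \<open>Y\<close> bounds the modulus of a whole configuration, and
  \<open>C\<close> normalises the weights \<open>C / ln d\<close>.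
\<close>

locale weighted_residue_system = residue_system +
  fixes Z C Y :: real
  assumes Z_gt: "Z > 1" and C_nonneg: "C \<ge> 0" and C_le: "C \<le> ln w" and Y_ge: "Y \<ge> Z"
    and weights_sum: "(\<Sum>A\<in>divisor_sets Z. C / (real_prod A * ln (real_prod A))) = 1"
begin

text \<open>
  The energy-minimising coefficients of a single box.
\<close>

definition alpha :: "nat set \<Rightarrow> real" where
  "alpha A = (if A = {} then 1 else if real_prod A \<le> Z then - (C / ln (real_prod A)) else 0)"

definition mass :: "nat set \<Rightarrow> real" where
  "mass A = (alpha A)\<^sup>2 / real_prod A"

definition total_mass :: real where
  "total_mass = (\<Sum>A\<in>Pow P. mass A)"

lemma alpha_empty [simp]: "alpha {} = 1"
  by (simp add: alpha_def)

lemma ln_real_prod_ge: "A \<subseteq> P \<Longrightarrow> A \<noteq> {} \<Longrightarrow> ln (real_prod A) \<ge> ln w"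
  using real_prod_gt_w[of A] w_ge by simp

lemma ln_w_ge: "ln w \<ge> 1"
proof -
  have "exp 1 \<le> w" using exp_le w_ge by linarith
  then show ?thesis using w_ge by (simp add: ln_ge_iff)
qed

lemma weight_bounds:
  assumes "A \<subseteq> P" "A \<noteq> {}"
  shows "0 \<le> C / ln (real_prod A)" "C / ln (real_prod A) \<le> 1"
  using ln_real_prod_ge[OF assms] ln_w_ge C_nonneg C_le by (auto simp: field_simps)

lemma abs_alpha_le: "A \<subseteq> P \<Longrightarrow> \<bar>alpha A\<bar> \<le> 1"
  using weight_bounds[of A] by (auto simp: alpha_def)

lemma mass_nonneg: "A \<subseteq> P \<Longrightarrow> mass A \<ge> 0"
  using real_prod_ge_1[of A] by (simp add: mass_def)

lemma block_subset: "block \<beta> i \<subseteq> P"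
  by (auto simp: block_def)

lemma abs_coef_le: "\<bar>coef alpha \<beta>\<bar> \<le> 1"
  unfolding coef_def abs_prod by (intro prod_le_1) (simp add: abs_alpha_le block_subset)

lemma defect_eq:
  assumes "modulus \<beta> \<le> Y"
  shows "defect alpha Y \<beta>
    = (\<Sum>A\<in>divisor_sets Z - {A. A \<subseteq> P - supp \<beta> \<and> real_prod A * modulus \<beta> \<le> Y}. C / (real_prod A * ln (real_prod A)))"
proof -
  define S where "S = {A. A \<subseteq> P - supp \<beta> \<and> real_prod A * modulus \<beta> \<le> Y}"
  have finS: "finite S" unfolding S_def by (rule finite_subset[of _ "Pow P"]) (auto simp: finite_P)
  have e: "{} \<in> S" using assms by (simp add: S_def real_prod_def)
  have "defect alpha Y \<beta> = (\<Sum>A\<in>S. alpha A / real_prod A)" by (simp add: defect_def S_def)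
  also have "\<dots> = 1 + (\<Sum>A\<in>S - {{}}. alpha A / real_prod A)"
    using finS e by (simp add: sum.remove real_prod_def)
  also have "(\<Sum>A\<in>S - {{}}. alpha A / real_prod A) = (\<Sum>A\<in>divisor_sets Z \<inter> S. alpha A / real_prod A)"
    by (rule sum.mono_neutral_right) (use finS in \<open>auto simp: divisor_sets_def S_def alpha_def\<close>)
  also have "\<dots> = - (\<Sum>A\<in>divisor_sets Z \<inter> S. C / (real_prod A * ln (real_prod A)))"
    unfolding sum_negf[symmetric] by (intro sum.cong refl) (auto simp: alpha_def divisor_sets_def field_simps)
  also have "(\<Sum>A\<in>divisor_sets Z \<inter> S. C / (real_prod A * ln (real_prod A)))
      = 1 - (\<Sum>A\<in>divisor_sets Z - S. C / (real_prod A * ln (real_prod A)))"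
  proof -
    have "(\<Sum>A\<in>divisor_sets Z. C / (real_prod A * ln (real_prod A)))
      = (\<Sum>A\<in>divisor_sets Z \<inter> S. C / (real_prod A * ln (real_prod A))) + (\<Sum>A\<in>divisor_sets Z - S. C / (real_prod A * ln (real_prod A)))"
      by (rule sum.Int_Diff[OF finite_divisor_sets])
    then show ?thesis using weights_sum by simp
  qed
  finally show ?thesis by (simp add: S_def)
qed

lemma weight_quot_bounds:
  assumes "A \<in> divisor_sets Z"
  shows "0 \<le> C / (real_prod A * ln (real_prod A))" "C / (real_prod A * ln (real_prod A)) \<le> 1 / real_prod A"
proof -
  have A: "A \<subseteq> P" "A \<noteq> {}" using assms by (auto simp: divisor_sets_def)
  have eq: "C / (real_prod A * ln (real_prod A)) = C / ln (real_prod A) * (1 / real_prod A)" by simp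
  show "0 \<le> C / (real_prod A * ln (real_prod A))" "C / (real_prod A * ln (real_prod A)) \<le> 1 / real_prod A"
    unfolding eq using weight_bounds[OF A] real_prod_ge_1[OF A(1)]
    by (auto intro!: mult_nonneg_nonneg mult_left_le_one_le simp del: times_divide_eq_right times_divide_eq_left)
qed

lemma defect_bounds:
  assumes "modulus \<beta> \<le> Y"
  shows "0 \<le> defect alpha Y \<beta>" "defect alpha Y \<beta> \<le> 1"
proof -
  show "0 \<le> defect alpha Y \<beta>"
    unfolding defect_eq[OF assms] by (intro sum_nonneg) (use weight_quot_bounds in auto)
  show "defect alpha Y \<beta> \<le> 1"
    unfolding defect_eq[OF assms] weights_sum[symmetric]
    by (intro sum_mono2 finite_divisor_sets) (use weight_quot_bounds in auto)
qed

text \<open>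
  When \<open>modulus \<beta> * Z \<le> Y\<close>, the cut at \<open>Y\<close> removes no divisor \<open>d \<le> Z\<close>.  Only the sets that share a prime
  with another box are missing from the normalised sum, and a given prime lies in few of them.
\<close>

lemma defect_small:
  assumes small: "modulus \<beta> * Z \<le> Y"
  shows "defect alpha Y \<beta> \<le> real (card (supp \<beta>)) * (1 + ln Z) / w"
proof -
  let ?S = "{A. A \<subseteq> P - supp \<beta> \<and> real_prod A * modulus \<beta> \<le> Y}"
  have "modulus \<beta> * 1 \<le> modulus \<beta> * Z" using modulus_ge_1[of \<beta>] Z_gt by (intro mult_left_mono) auto
  then have le: "modulus \<beta> \<le> Y" using small by simp
  have "(\<Sum>A\<in>divisor_sets Z - ?S. C / (real_prod A * ln (real_prod A))) \<le> (\<Sum>A\<in>divisor_sets Z - ?S. \<Sum>p\<in>supp \<beta>. if p \<in> A then 1 / real_prod A else 0)"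
  proof (rule sum_mono)
    fix A assume A: "A \<in> divisor_sets Z - ?S"
    have "real_prod A * modulus \<beta> \<le> Z * modulus \<beta>"
      using A modulus_ge_1[of \<beta>] by (intro mult_right_mono) (auto simp: divisor_sets_def)
    then have "real_prod A * modulus \<beta> \<le> Y" using small by (simp add: mult.commute)
    then obtain p where p: "p \<in> A" "p \<in> supp \<beta>" using A by (auto simp: divisor_sets_def)
    have "C / (real_prod A * ln (real_prod A)) \<le> 1 / real_prod A" using A weight_quot_bounds(2)[of A] by auto
    also have "\<dots> = (if p \<in> A then 1 / real_prod A else 0)" using p by simp
    also have "\<dots> \<le> (\<Sum>p\<in>supp \<beta>. if p \<in> A then 1 / real_prod A else 0)"
      using p A real_prod_ge_1[of A] by (intro member_le_sum) (auto simp: divisor_sets_def)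
    finally show "C / (real_prod A * ln (real_prod A)) \<le> (\<Sum>p\<in>supp \<beta>. if p \<in> A then 1 / real_prod A else 0)" .
  qed
  also have "\<dots> = (\<Sum>p\<in>supp \<beta>. \<Sum>A\<in>divisor_sets Z - ?S. if p \<in> A then 1 / real_prod A else 0)" by (rule sum.swap)
  also have "\<dots> \<le> (\<Sum>p\<in>supp \<beta>. (1 + ln Z) / w)"
  proof (rule sum_mono)
    fix p assume "p \<in> supp \<beta>"
    then have p: "p \<in> P" using supp_subset by blast
    have "(\<Sum>A\<in>divisor_sets Z - ?S. if p \<in> A then 1 / real_prod A else 0) \<le> (\<Sum>A\<in>divisor_sets Z. if p \<in> A then 1 / real_prod A else 0)"
      by (intro sum_mono2 finite_divisor_sets) (auto simp: divisor_sets_def intro: order.trans[OF zero_le_one real_prod_ge_1])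
    also have "\<dots> = (\<Sum>A | A \<in> divisor_sets Z \<and> p \<in> A. 1 / real_prod A)"
      by (rule sum.inter_filter[OF finite_divisor_sets, symmetric])
    also have "\<dots> \<le> (1 + ln Z) / real p" using p Z_gt by (intro sum_divisor_sets_containing_le) auto
    also have "\<dots> \<le> (1 + ln Z) / w"
      using large_P[OF p] w_ge Z_gt by (intro divide_left_mono) auto
    finally show "(\<Sum>A\<in>divisor_sets Z - ?S. if p \<in> A then 1 / real_prod A else 0) \<le> (1 + ln Z) / w" .
  qed
  finally show ?thesis unfolding defect_eq[OF le] by simp
qed

lemma coef_square_over_modulus:
  assumes "\<beta> \<in> configs"
  shows "(coef alpha \<beta>)\<^sup>2 / modulus \<beta> = (\<Prod>i\<in>{1..k}. mass (block \<beta> i))"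
  unfolding modulus_eq_prod_blocks[OF assms] coef_def mass_def
  by (simp add: prod_power_distrib prod_dividef)

lemma total_mass_ge_1: "total_mass \<ge> 1"
proof -
  have "mass {} \<le> total_mass" unfolding total_mass_def
    by (rule member_le_sum) (use finite_P mass_nonneg in auto)
  then show ?thesis by (simp add: mass_def real_prod_def)
qed

lemma norm_upper: "(\<Sum>\<beta>\<in>configs. (coef alpha \<beta>)\<^sup>2 / modulus \<beta>) \<le> total_mass ^ k"
proof -
  have "(\<Sum>\<beta>\<in>configs. (coef alpha \<beta>)\<^sup>2 / modulus \<beta>) = (\<Sum>\<beta>\<in>configs. \<Prod>i\<in>{1..k}. mass (block \<beta> i))"
    by (intro sum.cong refl coef_square_over_modulus)
  also have "\<dots> \<le> total_mass ^ k" unfolding total_mass_def by (rule sum_configs_le[OF mass_nonneg])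
  finally show ?thesis .
qed

lemma norm_lower:
  assumes small: "(real k)\<^sup>2 * (1 + ln Z)\<^sup>2 * (2 / w) \<le> 1 / 4"
  shows "(\<Sum>\<beta>\<in>configs. (coef alpha \<beta>)\<^sup>2 / modulus \<beta>) \<ge> 3 / 4 * total_mass ^ k"
proof -
  have Gp: "(\<Sum>A | A \<subseteq> P \<and> p \<in> A. mass A) \<le> (1 + ln Z) / real p" if p: "p \<in> P" for p
  proof -
    have "(\<Sum>A | A \<subseteq> P \<and> p \<in> A. mass A) = (\<Sum>A | A \<in> divisor_sets Z \<and> p \<in> A. mass A)"
    proof (rule sum.mono_neutral_right)
      show "finite {A. A \<subseteq> P \<and> p \<in> A}" by (rule finite_subset[of _ "Pow P"]) (auto simp: finite_P)
    qed (auto simp: divisor_sets_def mass_def alpha_def)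
    also have "\<dots> \<le> (\<Sum>A | A \<in> divisor_sets Z \<and> p \<in> A. 1 / real_prod A)"
    proof (rule sum_mono)
      fix A assume "A \<in> {A. A \<in> divisor_sets Z \<and> p \<in> A}"
      then have A: "A \<subseteq> P" by (auto simp: divisor_sets_def)
      have "(alpha A)\<^sup>2 \<le> 1" using abs_alpha_le[OF A] by (simp add: abs_square_le_1)
      then show "mass A \<le> 1 / real_prod A" unfolding mass_def using real_prod_ge_1[OF A] by (intro divide_right_mono) auto
    qed
    also have "\<dots> \<le> (1 + ln Z) / real p" using p Z_gt by (intro sum_divisor_sets_containing_le) auto
    finally show ?thesis .
  qed
  have "(\<Sum>p\<in>P. (\<Sum>A | A \<subseteq> P \<and> p \<in> A. mass A)\<^sup>2) \<le> (\<Sum>p\<in>P. ((1 + ln Z) / real p)\<^sup>2)"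
    by (intro sum_mono power_mono Gp sum_nonneg mass_nonneg) auto
  also have "\<dots> = (1 + ln Z)\<^sup>2 * (\<Sum>p\<in>P. 1 / (real p)\<^sup>2)"
    by (simp add: power_divide sum_distrib_left)
  also have "\<dots> \<le> (1 + ln Z)\<^sup>2 * (2 / w)" by (intro mult_left_mono sum_inverse_squares) auto
  finally have "(real k)\<^sup>2 * (\<Sum>p\<in>P. (\<Sum>A | A \<subseteq> P \<and> p \<in> A. mass A)\<^sup>2) \<le> (real k)\<^sup>2 * ((1 + ln Z)\<^sup>2 * (2 / w))"
    by (intro mult_left_mono) auto
  then have "3 / 4 \<le> 1 - (real k)\<^sup>2 * (\<Sum>p\<in>P. (\<Sum>A | A \<subseteq> P \<and> p \<in> A. mass A)\<^sup>2)"
    using small by (simp only: mult.assoc)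
  then have "3 / 4 * total_mass ^ k \<le> total_mass ^ k * (1 - (real k)\<^sup>2 * (\<Sum>p\<in>P. (\<Sum>A | A \<subseteq> P \<and> p \<in> A. mass A)\<^sup>2))"
    using total_mass_ge_1 by (subst mult.commute) (auto intro!: mult_left_mono)
  also have "\<dots> \<le> (\<Sum>\<beta>\<in>configs. \<Prod>i\<in>{1..k}. mass (block \<beta> i))"
    unfolding total_mass_def by (rule sum_configs_ge[OF mass_nonneg]) (auto simp: mass_def real_prod_def)
  also have "\<dots> = (\<Sum>\<beta>\<in>configs. (coef alpha \<beta>)\<^sup>2 / modulus \<beta>)"
    by (intro sum.cong refl coef_square_over_modulus[symmetric])
  finally show ?thesis .
qed

text \<open>
  Chernoff bound with exponent \<open>s = 1 / ln Z\<close>.  On the divisors at most \<open>Z\<close> one has \<open>d\<^sup>s \<le> 1 + 2 s ln d\<close>, so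
  the exponential moment of one box is controlled by its energy, which equals \<open>C\<close>.
\<close>

lemma norm_tail:
  assumes V: "V > 0"
  shows "(\<Sum>\<beta> | \<beta> \<in> configs \<and> V < modulus \<beta>. (coef alpha \<beta>)\<^sup>2 / modulus \<beta>)
    \<le> total_mass ^ k * exp ((2 * C * real k - ln V) / ln Z)"
proof -
  define s where "s = 1 / ln Z"
  have s: "s > 0" using Z_gt by (simp add: s_def)
  have "(\<Sum>\<beta> | \<beta> \<in> configs \<and> V < modulus \<beta>. (coef alpha \<beta>)\<^sup>2 / modulus \<beta>)
      \<le> (\<Sum>\<beta> | \<beta> \<in> configs \<and> V < modulus \<beta>. (coef alpha \<beta>)\<^sup>2 / modulus \<beta> * (modulus \<beta> / V) powr s)"
  proof (rule sum_mono)
    fix \<beta> assume "\<beta> \<in> {\<beta>. \<beta> \<in> configs \<and> V < modulus \<beta>}"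
    then have "1 \<le> (modulus \<beta> / V) powr s" using V s by (intro ge_one_powr_ge_zero) auto
    then show "(coef alpha \<beta>)\<^sup>2 / modulus \<beta> \<le> (coef alpha \<beta>)\<^sup>2 / modulus \<beta> * (modulus \<beta> / V) powr s"
      using mult_left_mono[of 1 "(modulus \<beta> / V) powr s" "(coef alpha \<beta>)\<^sup>2 / modulus \<beta>"] modulus_ge_1[of \<beta>] by simp
  qed
  also have "\<dots> \<le> (\<Sum>\<beta>\<in>configs. (coef alpha \<beta>)\<^sup>2 / modulus \<beta> * (modulus \<beta> / V) powr s)"
    by (intro sum_mono2 finite_configs) (auto intro!: mult_nonneg_nonneg divide_nonneg_nonneg order.trans[OF zero_le_one modulus_ge_1])
  also have "\<dots> = (\<Sum>\<beta>\<in>configs. (\<Prod>i\<in>{1..k}. mass (block \<beta> i) * real_prod (block \<beta> i) powr s) / V powr s)"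
  proof (rule sum.cong[OF refl])
    fix \<beta> assume b: "\<beta> \<in> configs"
    have "modulus \<beta> powr s = (\<Prod>i\<in>{1..k}. real_prod (block \<beta> i) powr s)"
      unfolding modulus_eq_prod_blocks[OF b]
      by (rule prod_powr_distrib)
    then show "(coef alpha \<beta>)\<^sup>2 / modulus \<beta> * (modulus \<beta> / V) powr s
        = (\<Prod>i\<in>{1..k}. mass (block \<beta> i) * real_prod (block \<beta> i) powr s) / V powr s"
      using V modulus_ge_1[of \<beta>] by (simp add: coef_square_over_modulus[OF b] prod.distrib powr_divide)
  qed
  also have "\<dots> = (\<Sum>\<beta>\<in>configs. (\<Prod>i\<in>{1..k}. mass (block \<beta> i) * real_prod (block \<beta> i) powr s)) / V powr s"
    by (simp add: sum_divide_distrib)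
  also have "\<dots> \<le> (\<Sum>A\<in>Pow P. mass A * real_prod A powr s) ^ k / V powr s"
    using mass_nonneg by (intro divide_right_mono sum_configs_le) auto
  also have "\<dots> \<le> (total_mass * exp (2 * s * C)) ^ k / V powr s"
  proof (intro divide_right_mono power_mono)
    have "mass A * real_prod A powr s \<le> mass A + 2 * s * C * (if A \<in> divisor_sets Z then C / (real_prod A * ln (real_prod A)) else 0)"
      if A: "A \<in> Pow P" for A
    proof (cases "A \<in> divisor_sets Z")
      case True
      then have A: "A \<subseteq> P" "A \<noteq> {}" "real_prod A \<le> Z" by (auto simp: divisor_sets_def)
      define u where "u = s * ln (real_prod A)"
      have lnp: "ln (real_prod A) > 0" using ln_real_prod_ge[OF A(1,2)] ln_w_ge by linarith
      have prp: "real_prod A > 0" using real_prod_ge_1[OF A(1)] by linarith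
      have u: "0 \<le> u" "u \<le> 1"
        using lnp s A(3) prp Z_gt by (auto simp: u_def s_def field_simps)
      have "real_prod A powr s = exp u" using prp by (simp add: powr_def u_def)
      also have "\<dots> \<le> 1 + u + u\<^sup>2" using u by (rule exp_bound)
      also have "u\<^sup>2 \<le> u" using u by (simp add: power2_eq_square mult_left_le_one_le)
      finally have "real_prod A powr s \<le> 1 + 2 * u" by simp
      then have "mass A * real_prod A powr s \<le> mass A * (1 + 2 * u)"
        using mass_nonneg[OF A(1)] by (rule mult_left_mono)
      also have "\<dots> = mass A + 2 * s * C * (C / (real_prod A * ln (real_prod A)))"
        using A(2,3) lnp prp by (simp add: mass_def alpha_def u_def power2_eq_square field_simps)
      finally show ?thesis using True by simp
    next
      case False
      then show ?thesis using A by (auto simp: divisor_sets_def mass_def alpha_def real_prod_def)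
    qed
    then have "(\<Sum>A\<in>Pow P. mass A * real_prod A powr s)
        \<le> (\<Sum>A\<in>Pow P. mass A + 2 * s * C * (if A \<in> divisor_sets Z then C / (real_prod A * ln (real_prod A)) else 0))"
      by (rule sum_mono)
    also have "\<dots> = total_mass + 2 * s * C * (\<Sum>A\<in>Pow P. if A \<in> divisor_sets Z then C / (real_prod A * ln (real_prod A)) else 0)"
      by (simp only: sum.distrib total_mass_def sum_distrib_left)
    also have "(\<Sum>A\<in>Pow P. if A \<in> divisor_sets Z then C / (real_prod A * ln (real_prod A)) else 0) = 1"
    proof -
      have "Pow P \<inter> divisor_sets Z = divisor_sets Z" by (auto simp: divisor_sets_def)
      then show ?thesis using weights_sum sum.inter_restrict[of "Pow P" "\<lambda>A. C / (real_prod A * ln (real_prod A))" "divisor_sets Z"] finite_P by simp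
    qed
    also have "total_mass + 2 * s * C * 1 \<le> total_mass * (1 + 2 * s * C)"
    proof -
      have "1 * (2 * s * C) \<le> total_mass * (2 * s * C)"
        using total_mass_ge_1 s C_nonneg by (intro mult_right_mono) auto
      then show ?thesis by (simp add: distrib_left)
    qed
    also have "\<dots> \<le> total_mass * exp (2 * s * C)"
      using total_mass_ge_1 exp_ge_add_one_self[of "2 * s * C"] by (intro mult_left_mono) auto
    finally show "(\<Sum>A\<in>Pow P. mass A * real_prod A powr s) \<le> total_mass * exp (2 * s * C)" .
    show "0 \<le> (\<Sum>A\<in>Pow P. mass A * real_prod A powr s)" using mass_nonneg by (intro sum_nonneg) auto
  qed simp
  also have "\<dots> = total_mass ^ k * exp ((2 * C * real k - ln V) / ln Z)"
  proof -
    have "exp (2 * s * C) ^ k = exp (2 * C * real k / ln Z)"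
      by (simp add: s_def mult.commute flip: exp_of_nat_mult)
    moreover have "V powr s = exp (ln V / ln Z)" using V by (simp add: powr_def s_def)
    ultimately show ?thesis by (simp add: power_mult_distrib exp_diff diff_divide_distrib)
  qed
  finally show ?thesis .
qed

text \<open>
  Otherwise \<open>F\<close> agrees at each \<open>t\<close> with some \<open>G\<^sub>i\<close>, so the sum of \<open>F\<^sup>2\<close> is at most the sum of all \<open>G\<^sub>i\<^sup>2\<close>.
  Relative to \<open>total_mass ^ k\<close>, the squared norm of \<open>F\<close> is at least \<open>1/2\<close> while those of the \<open>G\<^sub>i\<close> add up to at
  most \<open>1/20\<close>; this gap survives the constants of \<open>wave_energy_bounds\<close> and the incomplete periods.
\<close>

theorem exists_fully_covered:
  assumes k: "k \<ge> 1"
    and few: "real k * ln Y \<le> w / 8"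
    and disj: "(real k)\<^sup>2 * (1 + ln Z)\<^sup>2 * (2 / w) \<le> 1 / 4"
    and tail: "real k * (exp ((2 * C * real k - ln (Y / Z)) / ln Z) + (ln Y * (1 + ln Z) / w)\<^sup>2) \<le> 1 / 20"
    and N: "144 * (real k + 1) * Y ^ 6 < real N"
  shows "\<exists>t\<in>{1..N}. \<forall>i\<in>{1..k}. \<exists>p\<in>P. t mod p = r p i"
proof (rule ccontr)
  assume "\<not> ?thesis"
  then have unc: "\<exists>i\<in>{1..k}. \<forall>p\<in>P. t mod p \<noteq> r p i" if "t \<in> {1..N}" for t using that by blast
  define S where "S = {\<beta>. \<beta> \<in> configs \<and> modulus \<beta> \<le> Y}"
  define Si where "Si i = {\<beta>. \<beta> \<in> configs \<and> modulus \<beta> \<le> Y \<and> block \<beta> i = {}}" for i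
  define F where "F t = (\<Sum>\<beta>\<in>S. coef alpha \<beta> * wave \<beta> t)" for t
  define G where "G i t = (\<Sum>\<beta>\<in>Si i. coef alpha \<beta> * defect alpha Y \<beta> * wave \<beta> t)" for i t
  define E where "E = 2 * (\<Sum>\<beta>\<in>S. modulus \<beta>)\<^sup>2"
  define M where "M = total_mass ^ k"
  \<comment> \<open>The relative mass above \<open>Y / Z\<close>, and the largest defect below \<open>Y / Z\<close>.\<close>
  define \<tau> where "\<tau> = exp ((2 * C * real k - ln (Y / Z)) / ln Z)"
  define \<epsilon> where "\<epsilon> = ln Y * (1 + ln Z) / w"
  have Y: "Y > 1" using Y_ge Z_gt by linarith
  have M1: "M \<ge> 1" unfolding M_def using total_mass_ge_1 by (rule one_le_power)
  have \<tau>0: "\<tau> > 0" by (simp add: \<tau>_def)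
  have sub: "S \<subseteq> configs" "\<And>i. Si i \<subseteq> S" by (auto simp: S_def Si_def)
  have finS: "finite S" using sub finite_configs finite_subset by blast
  have card_le: "real (card (supp \<beta>)) \<le> ln Y" if "\<beta> \<in> S" for \<beta>
  proof -
    have "ln (modulus \<beta>) \<le> ln Y" using that modulus_ge_1[of \<beta>] by (intro ln_mono) (auto simp: S_def)
    then show ?thesis using card_supp_le_ln_modulus[of \<beta>] by linarith
  qed
  have fewS: "real k * real (card (supp \<beta>)) \<le> w / 8" if "\<beta> \<in> S" for \<beta>
    using mult_left_mono[OF card_le[OF that], of "real k"] few by simp
  have "F t ^ 2 \<le> (\<Sum>i\<in>{1..k}. (G i t)\<^sup>2)" if t: "t \<in> {1..N}" for t
  proof -
    obtain i where i: "i \<in> {1..k}" "\<And>p. p \<in> P \<Longrightarrow> t mod p \<noteq> r p i" using unc[OF t] by blast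
    have "F t = G i t" unfolding F_def G_def S_def Si_def by (rule wave_sum_uncovered[OF i]) simp_all
    then have "(F t)\<^sup>2 = (G i t)\<^sup>2" by simp
    also have "\<dots> \<le> (\<Sum>i\<in>{1..k}. (G i t)\<^sup>2)" using i(1) by (intro member_le_sum) auto
    finally show ?thesis .
  qed
  then have "(\<Sum>t\<in>{1..N}. (F t)\<^sup>2) \<le> (\<Sum>t\<in>{1..N}. \<Sum>i\<in>{1..k}. (G i t)\<^sup>2)" by (intro sum_mono) auto
  also have "\<dots> = (\<Sum>i\<in>{1..k}. \<Sum>t\<in>{1..N}. (G i t)\<^sup>2)" by (rule sum.swap)
  also have "\<dots> \<le> (\<Sum>i\<in>{1..k}. real N * (5 / 4 * (M * (\<tau> + \<epsilon>\<^sup>2))) + E)"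
  proof (rule sum_mono)
    fix i assume i: "i \<in> {1..k}"
    have finSi: "finite (Si i)" using finite_subset[OF sub(2) finS] .
    have "(\<Sum>t\<in>{1..N}. (G i t)\<^sup>2)
        \<le> real N * (5 / 4 * (\<Sum>\<beta>\<in>Si i. (coef alpha \<beta> * defect alpha Y \<beta>)\<^sup>2 / modulus \<beta>)) + 2 * (\<Sum>\<beta>\<in>Si i. modulus \<beta>)\<^sup>2"
      unfolding G_def
    proof (rule wave_energy_bounds(1))
      show "Si i \<subseteq> configs" using sub by blast
      fix \<beta> assume b: "\<beta> \<in> Si i"
      show "real k * real (card (supp \<beta>)) \<le> w / 8" using fewS b sub(2) by blast
      have "\<bar>defect alpha Y \<beta>\<bar> \<le> 1" using defect_bounds[of \<beta>] b by (auto simp: Si_def)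
      then show "\<bar>coef alpha \<beta> * defect alpha Y \<beta>\<bar> \<le> 1" using abs_coef_le[of \<beta>] by (simp add: abs_mult mult_le_one)
    qed
    also have "\<dots> \<le> real N * (5 / 4 * (M * (\<tau> + \<epsilon>\<^sup>2))) + E"
    proof (rule add_mono)
      have "(\<Sum>\<beta>\<in>Si i. (coef alpha \<beta> * defect alpha Y \<beta>)\<^sup>2 / modulus \<beta>)
          \<le> (\<Sum>\<beta>\<in>Si i. (coef alpha \<beta>)\<^sup>2 / modulus \<beta> * of_bool (Y / Z < modulus \<beta>)
                + \<epsilon>\<^sup>2 * ((coef alpha \<beta>)\<^sup>2 / modulus \<beta>))"
      proof (rule sum_mono)
        fix \<beta> assume b: "\<beta> \<in> Si i"
        define c where "c = (coef alpha \<beta>)\<^sup>2 / modulus \<beta>"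
        have c: "c \<ge> 0" unfolding c_def using modulus_ge_1[of \<beta>] by simp
        have d: "0 \<le> defect alpha Y \<beta>" "defect alpha Y \<beta> \<le> 1" using defect_bounds[of \<beta>] b by (auto simp: Si_def)
        have "(defect alpha Y \<beta>)\<^sup>2 \<le> of_bool (Y / Z < modulus \<beta>) + \<epsilon>\<^sup>2"
        proof (cases "Y / Z < modulus \<beta>")
          case True
          then show ?thesis using d power_le_one[of "defect alpha Y \<beta>" 2] by (simp add: add_increasing2)
        next
          case False
          then have "modulus \<beta> * Z \<le> Y" using Z_gt by (simp add: field_simps)
          then have "defect alpha Y \<beta> \<le> real (card (supp \<beta>)) * (1 + ln Z) / w" by (rule defect_small)
          also have "\<dots> \<le> \<epsilon>" unfolding \<epsilon>_def
            using card_le[of \<beta>] b sub(2) Z_gt w_ge by (intro divide_right_mono mult_right_mono) auto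
          finally have "(defect alpha Y \<beta>)\<^sup>2 \<le> \<epsilon>\<^sup>2" using d by (intro power_mono) auto
          then show ?thesis by simp
        qed
        then have "c * (defect alpha Y \<beta>)\<^sup>2 \<le> c * (of_bool (Y / Z < modulus \<beta>) + \<epsilon>\<^sup>2)"
          using c by (rule mult_left_mono)
        moreover have "(coef alpha \<beta> * defect alpha Y \<beta>)\<^sup>2 / modulus \<beta> = c * (defect alpha Y \<beta>)\<^sup>2"
          by (simp add: c_def power_mult_distrib)
        ultimately show "(coef alpha \<beta> * defect alpha Y \<beta>)\<^sup>2 / modulus \<beta>
          \<le> (coef alpha \<beta>)\<^sup>2 / modulus \<beta> * of_bool (Y / Z < modulus \<beta>) + \<epsilon>\<^sup>2 * ((coef alpha \<beta>)\<^sup>2 / modulus \<beta>)"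
          unfolding c_def[symmetric] by (simp only: distrib_left mult.commute[of "\<epsilon>\<^sup>2" c])
      qed
      also have "\<dots> \<le> (\<Sum>\<beta>\<in>configs. (coef alpha \<beta>)\<^sup>2 / modulus \<beta> * of_bool (Y / Z < modulus \<beta>)
                + \<epsilon>\<^sup>2 * ((coef alpha \<beta>)\<^sup>2 / modulus \<beta>))"
        using sub by (intro sum_mono2 finite_configs)
          (auto intro!: add_nonneg_nonneg mult_nonneg_nonneg divide_nonneg_nonneg order.trans[OF zero_le_one modulus_ge_1])
      also have "\<dots> = (\<Sum>\<beta> | \<beta> \<in> configs \<and> Y / Z < modulus \<beta>. (coef alpha \<beta>)\<^sup>2 / modulus \<beta>)
          + \<epsilon>\<^sup>2 * (\<Sum>\<beta>\<in>configs. (coef alpha \<beta>)\<^sup>2 / modulus \<beta>)"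
      proof -
        have "(\<Sum>\<beta>\<in>configs. (coef alpha \<beta>)\<^sup>2 / modulus \<beta> * of_bool (Y / Z < modulus \<beta>))
            = (\<Sum>\<beta> | \<beta> \<in> configs \<and> Y / Z < modulus \<beta>. (coef alpha \<beta>)\<^sup>2 / modulus \<beta>)"
          using sum.inter_filter[OF finite_configs, of "\<lambda>\<beta>. (coef alpha \<beta>)\<^sup>2 / modulus \<beta>" "\<lambda>\<beta>. Y / Z < modulus \<beta>"]
          by (simp add: of_bool_def if_distrib cong: if_cong)
        then show ?thesis by (simp only: sum.distrib sum_distrib_left)
      qed
      also have "\<dots> \<le> M * \<tau> + \<epsilon>\<^sup>2 * M"
        unfolding M_def \<tau>_def using Y Z_gt by (intro add_mono mult_left_mono norm_tail norm_upper) auto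
      finally have "(\<Sum>\<beta>\<in>Si i. (coef alpha \<beta> * defect alpha Y \<beta>)\<^sup>2 / modulus \<beta>) \<le> M * (\<tau> + \<epsilon>\<^sup>2)"
        by (simp add: algebra_simps)
      then show "real N * (5 / 4 * (\<Sum>\<beta>\<in>Si i. (coef alpha \<beta> * defect alpha Y \<beta>)\<^sup>2 / modulus \<beta>))
          \<le> real N * (5 / 4 * (M * (\<tau> + \<epsilon>\<^sup>2)))" by (intro mult_left_mono) auto
      have "(\<Sum>\<beta>\<in>Si i. modulus \<beta>) \<le> (\<Sum>\<beta>\<in>S. modulus \<beta>)"
        by (intro sum_mono2 finS sub) (auto intro: order.trans[OF zero_le_one modulus_ge_1])
      then show "2 * (\<Sum>\<beta>\<in>Si i. modulus \<beta>)\<^sup>2 \<le> E"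
        unfolding E_def by (intro mult_left_mono power_mono sum_nonneg) (auto intro: order.trans[OF zero_le_one modulus_ge_1])
    qed
    finally show "(\<Sum>t\<in>{1..N}. (G i t)\<^sup>2) \<le> real N * (5 / 4 * (M * (\<tau> + \<epsilon>\<^sup>2))) + E" .
  qed
  finally have up: "(\<Sum>t\<in>{1..N}. (F t)\<^sup>2) \<le> real k * (real N * (5 / 4 * (M * (\<tau> + \<epsilon>\<^sup>2))) + E)" by simp
  have "(\<Sum>\<beta>\<in>S. (coef alpha \<beta>)\<^sup>2 / modulus \<beta>) \<ge> M / 2"
  proof -
    have "(\<Sum>\<beta>\<in>configs. (coef alpha \<beta>)\<^sup>2 / modulus \<beta>) = (\<Sum>\<beta>\<in>S. (coef alpha \<beta>)\<^sup>2 / modulus \<beta>)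
        + (\<Sum>\<beta> | \<beta> \<in> configs \<and> Y < modulus \<beta>. (coef alpha \<beta>)\<^sup>2 / modulus \<beta>)"
    proof -
      have "configs = S \<union> {\<beta>. \<beta> \<in> configs \<and> Y < modulus \<beta>}" by (auto simp: S_def)
      moreover have "S \<inter> {\<beta>. \<beta> \<in> configs \<and> Y < modulus \<beta>} = {}" by (auto simp: S_def)
      ultimately show ?thesis using finS finite_configs by (metis (no_types, lifting) finite_Un sum.union_disjoint)
    qed
    moreover have "(\<Sum>\<beta> | \<beta> \<in> configs \<and> Y < modulus \<beta>. (coef alpha \<beta>)\<^sup>2 / modulus \<beta>) \<le> M * (1 / 4)"
    proof -
      have "(\<Sum>\<beta> | \<beta> \<in> configs \<and> Y < modulus \<beta>. (coef alpha \<beta>)\<^sup>2 / modulus \<beta>)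
          \<le> (\<Sum>\<beta> | \<beta> \<in> configs \<and> Y / Z < modulus \<beta>. (coef alpha \<beta>)\<^sup>2 / modulus \<beta>)"
      proof (rule sum_mono2)
        have "Y / Z \<le> Y" using Y Z_gt by (simp add: field_simps)
        then show "{\<beta>. \<beta> \<in> configs \<and> Y < modulus \<beta>} \<subseteq> {\<beta>. \<beta> \<in> configs \<and> Y / Z < modulus \<beta>}" by auto
        show "finite {\<beta>. \<beta> \<in> configs \<and> Y / Z < modulus \<beta>}" using finite_configs by simp
      qed (auto intro!: divide_nonneg_nonneg order.trans[OF zero_le_one modulus_ge_1])
      also have "\<dots> \<le> M * \<tau>" unfolding M_def \<tau>_def using Y Z_gt by (intro norm_tail) auto
      also have "\<dots> \<le> M * (1 / 4)"
      proof (rule mult_left_mono)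
        have "1 * (\<tau> + \<epsilon>\<^sup>2) \<le> real k * (\<tau> + \<epsilon>\<^sup>2)" using k \<tau>0 by (intro mult_right_mono) auto
        then have "\<tau> + \<epsilon>\<^sup>2 \<le> 1 / 20" using tail unfolding \<tau>_def \<epsilon>_def by simp
        then show "\<tau> \<le> 1 / 4" using zero_le_power2[of \<epsilon>] by linarith
      qed (use M1 in simp)
      finally show ?thesis .
    qed
    moreover have "(\<Sum>\<beta>\<in>configs. (coef alpha \<beta>)\<^sup>2 / modulus \<beta>) \<ge> 3 / 4 * M"
      unfolding M_def by (rule norm_lower[OF disj])
    ultimately show ?thesis by linarith
  qed
  then have "real N * (1 / 2 * (M / 2)) - E \<le> real N * (1 / 2 * (\<Sum>\<beta>\<in>S. (coef alpha \<beta>)\<^sup>2 / modulus \<beta>)) - E"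
    by (intro diff_right_mono mult_left_mono) auto
  also have "\<dots> \<le> (\<Sum>t\<in>{1..N}. (F t)\<^sup>2)"
    unfolding F_def E_def by (rule wave_energy_bounds(2)[OF sub(1) fewS abs_coef_le])
  also note up
  finally have main: "real N * M / 4 \<le> real k * (real N * (5 / 4 * (M * (\<tau> + \<epsilon>\<^sup>2)))) + (real k + 1) * E"
    by (simp add: algebra_simps)
  have "real k * (real N * (5 / 4 * (M * (\<tau> + \<epsilon>\<^sup>2)))) = real N * M * (5 / 4) * (real k * (\<tau> + \<epsilon>\<^sup>2))" by simp
  also have "\<dots> \<le> real N * M * (5 / 4) * (1 / 20)"
    using tail M1 unfolding \<tau>_def \<epsilon>_def by (intro mult_left_mono) auto
  finally have first: "real k * (real N * (5 / 4 * (M * (\<tau> + \<epsilon>\<^sup>2)))) \<le> real N * M / 16" by (simp add: mult.commute[of M])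
  moreover have "0 \<le> real N * M" using M1 by simp
  ultimately have "real N * M / 8 \<le> (real k + 1) * E" using main by linarith
  moreover have "real N * 1 \<le> real N * M" using M1 by (intro mult_left_mono) auto
  ultimately have "real N \<le> 8 * ((real k + 1) * E)" by linarith
  moreover have "E \<le> 18 * Y ^ 6"
  proof -
    have "2 * real k / w \<le> 1"
    proof -
      have "1 \<le> (1 + ln Z)\<^sup>2" using Z_gt by (intro one_le_power) auto
      moreover have "real k \<le> (real k)\<^sup>2" using k by (simp add: power2_eq_square)
      ultimately have "real k * 1 \<le> (real k)\<^sup>2 * (1 + ln Z)\<^sup>2" by (intro mult_mono) auto
      then have "real k * (2 / w) \<le> (real k)\<^sup>2 * (1 + ln Z)\<^sup>2 * (2 / w)" using w_ge by (intro mult_right_mono) auto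
      then show ?thesis using disj by (simp add: mult.commute)
    qed
    then have "exp (2 * real k / w) \<le> 3" using exp_le exp_le_cancel_iff[of "2 * real k / w" 1] by linarith
    then have "exp (2 * real k / w) * Y ^ 3 \<le> 3 * Y ^ 3" using Y by (intro mult_right_mono) auto
    then have "(\<Sum>\<beta>\<in>S. modulus \<beta>) \<le> 3 * Y ^ 3" using sum_modulus_le[of Y] Y unfolding S_def by linarith
    then have "(\<Sum>\<beta>\<in>S. modulus \<beta>)\<^sup>2 \<le> (3 * Y ^ 3)\<^sup>2"
      by (intro power_mono sum_nonneg) (auto intro: order.trans[OF zero_le_one modulus_ge_1])
    then show ?thesis unfolding E_def by (simp add: power_mult_distrib flip: power_mult)
  qed
  then have "(real k + 1) * E \<le> (real k + 1) * (18 * Y ^ 6)" by (intro mult_left_mono) auto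
  ultimately have "real N \<le> 144 * (real k + 1) * Y ^ 6" by linarith
  then show False using N by linarith
qed

end

section \<open>Integers without small prime factors\<close>

lemma prod_primes_dvd:
  fixes A :: "nat set"
  assumes "finite A" "\<And>p. p \<in> A \<Longrightarrow> prime p" "\<And>p. p \<in> A \<Longrightarrow> p dvd n"
  shows "\<Prod>A dvd n"
  using assms
proof (induction A rule: finite_induct)
  case (insert q A)
  have "coprime q (\<Prod>A)"
    using insert by (intro prod_coprime_right primes_coprime) auto
  then show ?case using insert by (simp add: divides_mult)
qed simp

text \<open>
  Chebyshev's argument: the primes between \<open>n\<close> and \<open>2n\<close> all divide the central binomial coefficient.
\<close>

lemma sum_ln_primes_dyadic:
  fixes n :: nat
  assumes "n > 0"
  shows "(\<Sum>p | prime p \<and> n < p \<and> p \<le> 2 * n. ln (real p) / real p) \<le> 2"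
proof -
  let ?A = "{p. prime p \<and> n < p \<and> p \<le> 2 * n}"
  have fin: "finite ?A" by (rule finite_subset[of _ "{..2 * n}"]) auto
  have pos: "(2 * n) choose n > 0" by (simp add: zero_less_binomial_iff)
  have "\<Prod>?A dvd (2 * n) choose n"
  proof (rule prod_primes_dvd[OF fin])
    fix p assume p: "p \<in> ?A"
    then have "p dvd fact (2 * n)" using prime_dvd_fact_iff[of p "2 * n"] by auto
    also have "fact (2 * n) = fact n * fact n * ((2 * n) choose n)"
      using binomial_fact_lemma[of n "2 * n"] by (simp add: mult_2)
    finally have "p dvd fact n * fact n * ((2 * n) choose n)" .
    moreover have "\<not> p dvd fact n" using p prime_dvd_fact_iff[of p n] by auto
    ultimately show "p dvd (2 * n) choose n" using p by (auto simp: prime_dvd_mult_iff)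
  qed auto
  then have "\<Prod>?A \<le> (2 * n) choose n" using pos by (rule dvd_imp_le)
  also have "\<dots> \<le> 2 ^ (2 * n)"
    using member_le_sum[of n "{..2 * n}" "\<lambda>k. (2 * n) choose k"] by (simp add: choose_row_sum)
  finally have "real (\<Prod>?A) \<le> 2 ^ (2 * n)" by (metis of_nat_le_iff of_nat_numeral of_nat_power)
  moreover have "real (\<Prod>?A) > 0" using fin by (auto intro!: prod_pos simp: prime_gt_0_nat)
  ultimately have "ln (real (\<Prod>?A)) \<le> ln (2 ^ (2 * n))" by (intro ln_mono) auto
  also have "ln ((2::real) ^ (2 * n)) = real (2 * n) * ln 2" by (rule ln_realpow)
  also have "\<dots> \<le> 2 * real n" using ln_2_less_1 assms by simp
  also have "ln (real (\<Prod>?A)) = (\<Sum>p\<in>?A. ln (real p))"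
    unfolding of_nat_prod by (rule ln_prod) (auto simp: fin prime_gt_0_nat)
  finally have theta: "(\<Sum>p\<in>?A. ln (real p)) \<le> 2 * real n" .
  have "(\<Sum>p\<in>?A. ln (real p) / real p) \<le> (\<Sum>p\<in>?A. ln (real p) / real n)"
    using assms by (intro sum_mono divide_left_mono) (auto intro!: ln_ge_zero)
  also have "\<dots> = (\<Sum>p\<in>?A. ln (real p)) / real n" by (simp add: sum_divide_distrib)
  also have "\<dots> \<le> 2" using theta assms by (simp add: field_simps)
  finally show ?thesis .
qed

lemma sum_ln_primes_le:
  assumes W: "W \<ge> 2"
  shows "(\<Sum>p | prime p \<and> real p \<le> W. ln (real p) / real p) \<le> 6 * ln W"
proof -
  have dy: "(\<Sum>p | prime p \<and> p \<le> 2 ^ j. ln (real p) / real p) \<le> 2 * real j" for j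
  proof (induction j)
    case 0
    have "{p. prime p \<and> p \<le> 2 ^ 0} = ({} :: nat set)" by (auto dest: prime_ge_2_nat)
    then show ?case by (simp only: sum.empty)
  next
    case (Suc j)
    let ?A = "{p. prime p \<and> p \<le> (2::nat) ^ j}" and ?B = "{p. prime p \<and> 2 ^ j < p \<and> p \<le> 2 * (2::nat) ^ j}"
    have "{p. prime p \<and> p \<le> (2::nat) ^ Suc j} = ?A \<union> ?B" by auto
    moreover have "(\<Sum>p\<in>?A \<union> ?B. ln (real p) / real p)
        = (\<Sum>p\<in>?A. ln (real p) / real p) + (\<Sum>p\<in>?B. ln (real p) / real p)"
    proof (rule sum.union_disjoint)
      show "finite ?A" by (rule finite_subset[of _ "{..2 ^ j}"]) auto
      show "finite ?B" by (rule finite_subset[of _ "{..2 * 2 ^ j}"]) auto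
    qed auto
    ultimately show ?case using Suc sum_ln_primes_dyadic[of "2 ^ j"] by simp
  qed
  define j where "j = nat \<lceil>log 2 W\<rceil>"
  have l1: "log 2 W \<ge> 1" using W by simp
  have j: "log 2 W \<le> real j" "real j \<le> log 2 W + 1" using l1 unfolding j_def by linarith+
  have "W = 2 powr (log 2 W)" using W by simp
  also have "\<dots> \<le> 2 powr real j" using j by (intro powr_mono) auto
  also have "\<dots> = real (2 ^ j)" by (simp add: powr_realpow)
  finally have Wj: "W \<le> real (2 ^ j)" .
  have "(\<Sum>p | prime p \<and> real p \<le> W. ln (real p) / real p) \<le> (\<Sum>p | prime p \<and> p \<le> 2 ^ j. ln (real p) / real p)"
  proof (rule sum_mono2)
    show "finite {p. prime p \<and> p \<le> (2::nat) ^ j}" by (rule finite_subset[of _ "{..2 ^ j}"]) auto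
    show "{p. prime p \<and> real p \<le> W} \<subseteq> {p. prime p \<and> p \<le> 2 ^ j}"
    proof safe
      fix p :: nat assume "real p \<le> W"
      then have "real p \<le> real (2 ^ j)" using Wj by linarith
      then show "p \<le> 2 ^ j" by (simp only: of_nat_le_iff)
    qed
  qed (auto intro!: divide_nonneg_nonneg ln_ge_zero simp: Suc_le_eq prime_gt_0_nat)
  also have "\<dots> \<le> 2 * real j" by (rule dy)
  also have "\<dots> \<le> 4 * log 2 W" using j l1 by linarith
  also have "\<dots> = 4 * (ln W / ln 2)" by (simp add: log_def)
  also have "\<dots> \<le> 6 * ln W"
  proof -
    have "(2 / 3 :: real) \<le> ln 2" using ln2_ge_two_thirds by simp
    then have "ln W / ln 2 \<le> ln W / (2 / 3)" using W by (intro divide_left_mono) auto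
    then show ?thesis by simp
  qed
  finally show ?thesis .
qed

lemma sum_powr_le:
  assumes s: "s > 0"
  shows "(\<Sum>n\<in>{1..m}. real n powr (- 1 - s)) \<le> 1 + 1 / s"
proof -
  have "(\<Sum>n\<in>{1..Suc m}. real n powr (- 1 - s)) \<le> 1 + 1 / s * (1 - real (Suc m) powr (- s))" for m
  proof (induction m)
    case (Suc m)
    \<comment> \<open>Each term is bounded by the telescoping difference \<open>((a - 1) powr - s - a powr - s) / s\<close>.\<close>
    define a where "a = real (Suc (Suc m))"
    have a: "a \<ge> 2" by (simp add: a_def)
    have "a powr (- s) * (1 + s / a) \<le> (a - 1) powr (- s)"
    proof -
      have "ln ((a - 1) / a) \<le> (a - 1) / a - 1" using a by (intro ln_le_minus_one) auto
      also have "\<dots> = - (1 / a)" using a by (simp add: field_simps)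
      finally have l: "ln (a - 1) + 1 / a \<le> ln a" using a by (simp add: ln_div)
      have "1 + s / a \<le> exp (s / a)" by (rule exp_ge_add_one_self)
      then have "a powr (- s) * (1 + s / a) \<le> exp (- s * ln a) * exp (s / a)"
        using a by (simp add: powr_def)
      also have "\<dots> = exp (- s * (ln a - 1 / a))" by (simp add: algebra_simps flip: exp_add)
      also have "\<dots> \<le> exp (- s * ln (a - 1))" using l s by (auto simp: mult_left_mono)
      also have "\<dots> = (a - 1) powr (- s)" using a by (simp add: powr_def)
      finally show ?thesis .
    qed
    moreover have "a powr (- s) * (1 + s / a) = a powr (- s) + s * a powr (- 1 - s)"
    proof -
      have "a powr (- 1 - s) = a powr (- s) / a"
        using a powr_add[of a "- 1" "- s"] by (simp add: powr_minus_divide)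
      then show ?thesis by (simp add: algebra_simps)
    qed
    ultimately have "a powr (- 1 - s) \<le> 1 / s * ((a - 1) powr (- s) - a powr (- s))"
      using s by (simp add: field_simps)
    moreover have "(\<Sum>n\<in>{1..Suc (Suc m)}. real n powr (- 1 - s))
        = (\<Sum>n\<in>{1..Suc m}. real n powr (- 1 - s)) + a powr (- 1 - s)" by (simp add: a_def)
    moreover have "(\<Sum>n\<in>{1..Suc m}. real n powr (- 1 - s)) \<le> 1 + 1 / s * (1 - (a - 1) powr (- s))"
    proof -
      have r: "real (Suc m) = a - 1" by (simp add: a_def)
      show ?thesis using Suc by (simp only: r)
    qed
    moreover have "1 / s * ((a - 1) powr (- s) - a powr (- s))
        = 1 / s * (1 - a powr (- s)) - 1 / s * (1 - (a - 1) powr (- s))"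
      by (simp add: right_diff_distrib)
    ultimately show ?case unfolding a_def[symmetric] by linarith
  qed simp
  moreover have "1 + 1 / s * (1 - real (Suc m) powr (- s)) \<le> 1 + 1 / s" for m
    using s mult_left_mono[of "1 - real (Suc m) powr (- s)" 1 "1 / s"] by simp
  ultimately have le: "(\<Sum>n\<in>{1..Suc m}. real n powr (- 1 - s)) \<le> 1 + 1 / s" for m by (meson order.trans)
  show ?thesis
  proof (cases m)
    case 0 then show ?thesis using s by simp
  next
    case (Suc m') then show ?thesis using le[of m'] by simp
  qed
qed

text \<open>
  Comparison with the zeta function at \<open>1 + s\<close> for \<open>s = 1 / ln W\<close>: replacing \<open>1/p\<close> by
  \<open>p\<^sup>-\<^sup>1\<^sup>-\<^sup>s\<close> changes the product by a bounded factor, since the sum of \<open>ln p / p\<close> is \<open>O(ln W)\<close>, and the new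
  product is at most \<open>1 + 1/s\<close>.
\<close>

lemma mertens_product_upper:
  assumes W: "W \<ge> 3"
  shows "(\<Prod>p | prime p \<and> real p \<le> W. 1 + 1 / real p) \<le> 2 * exp 6 * ln W"
proof -
  let ?P = "{p :: nat. prime p \<and> real p \<le> W}"
  have fin: "finite ?P" by (rule finite_subset[of _ "{..nat \<lfloor>W\<rfloor>}"]) (auto simp: le_nat_iff le_floor_iff)
  define s where "s = 1 / ln W"
  have lnW: "ln W \<ge> 1"
  proof -
    have "exp 1 \<le> W" using exp_le W by linarith
    then show ?thesis using W by (simp add: ln_ge_iff)
  qed
  have s: "s > 0" using lnW by (simp add: s_def)
  have "(\<Prod>p\<in>?P. 1 + 1 / real p)
      \<le> (\<Prod>p\<in>?P. (1 + real p powr (- 1 - s)) * exp (s * (ln (real p) / real p)))"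
  proof (intro prod_mono conjI)
    fix p assume "p \<in> ?P"
    then have p: "real p > 0" by (auto simp: prime_gt_0_nat)
    define u where "u = real p powr (- 1 - s)"
    have u: "u > 0" using p by (simp add: u_def)
    have "u = exp (- s * ln (real p)) / real p"
    proof -
      have "u = real p powr (- 1) * real p powr (- s)" unfolding u_def powr_add[symmetric] by simp
      also have "real p powr (- 1) = 1 / real p" using p by (rule powr_neg_one)
      finally show ?thesis using p by (simp add: powr_def)
    qed
    moreover have "1 - s * ln (real p) \<le> exp (- s * ln (real p))" using exp_ge_add_one_self[of "- s * ln (real p)"] by simp
    ultimately have "1 / real p - u \<le> s * (ln (real p) / real p)"
      using p divide_right_mono[of "1 - exp (- s * ln (real p))" "s * ln (real p)" "real p"]
      by (simp add: diff_divide_distrib)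
    moreover have "1 + s * (ln (real p) / real p) \<le> exp (s * (ln (real p) / real p))" by (rule exp_ge_add_one_self)
    ultimately have *: "1 + (1 / real p - u) \<le> exp (s * (ln (real p) / real p))" by linarith
    have up: "1 + (1 / real p - u) \<le> (1 + u) * exp (s * (ln (real p) / real p)) - u"
    proof -
      have "(1 :: real) \<le> exp (s * (ln (real p) / real p))"
        using s \<open>p \<in> ?P\<close> by (auto intro!: mult_nonneg_nonneg divide_nonneg_nonneg ln_ge_zero simp: Suc_le_eq prime_gt_0_nat)
      then have "u * 1 \<le> u * exp (s * (ln (real p) / real p))" using u by (intro mult_left_mono) auto
      then show ?thesis using * by (simp add: distrib_right)
    qed
    then show "1 + 1 / real p \<le> (1 + real p powr (- 1 - s)) * exp (s * (ln (real p) / real p))"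
      by (simp add: u_def)
  qed auto
  also have "\<dots> = (\<Prod>p\<in>?P. 1 + real p powr (- 1 - s)) * exp (s * (\<Sum>p\<in>?P. ln (real p) / real p))"
    by (simp add: prod.distrib exp_sum fin sum_distrib_left)
  also have "\<dots> \<le> (1 + ln W) * exp 6"
  proof (intro mult_mono)
    have "s * (\<Sum>p\<in>?P. ln (real p) / real p) \<le> s * (6 * ln W)"
      using s sum_ln_primes_le[of W] W by (intro mult_left_mono) auto
    also have "\<dots> = 6" using lnW by (simp add: s_def)
    finally show "exp (s * (\<Sum>p\<in>?P. ln (real p) / real p)) \<le> exp 6" by simp
    have inj: "inj_on Prod (Pow ?P)"
      by (rule inj_on_subset[OF inj_on_prod_primes]) (use fin finite_subset in auto)
    have pos: "\<Prod>A > 0" if "A \<in> Pow ?P" for A using that by (intro prod_pos) (auto simp: prime_gt_0_nat)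
    define m where "m = Max (Prod ` Pow ?P)"
    have "(\<Prod>p\<in>?P. 1 + real p powr (- 1 - s)) = (\<Sum>A\<in>Pow ?P. \<Prod>p\<in>A. real p powr (- 1 - s))"
      using prod_add[OF fin, of "\<lambda>p. real p powr (- 1 - s)" "\<lambda>_. 1"] by (simp add: add.commute)
    also have "\<dots> = (\<Sum>A\<in>Pow ?P. real (\<Prod>A) powr (- 1 - s))"
      by (simp add: prod_powr_distrib)
    also have "\<dots> = (\<Sum>n\<in>Prod ` Pow ?P. real n powr (- 1 - s))"
      by (simp add: sum.reindex[OF inj])
    also have "\<dots> \<le> (\<Sum>n\<in>{1..m}. real n powr (- 1 - s))"
    proof (rule sum_mono2)
      show "Prod ` Pow ?P \<subseteq> {1..m}"
      proof (intro image_subsetI)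
        fix A assume A: "A \<in> Pow ?P"
        then have "\<Prod>A \<le> m" unfolding m_def using fin by (intro Max_ge) auto
        then show "\<Prod>A \<in> {1..m}" using pos[OF A] by simp
      qed
    qed auto
    also have "\<dots> \<le> 1 + 1 / s" by (rule sum_powr_le[OF s])
    finally show "(\<Prod>p\<in>?P. 1 + real p powr (- 1 - s)) \<le> 1 + ln W" by (simp add: s_def)
  qed (use lnW in \<open>auto intro!: prod_nonneg add_nonneg_nonneg\<close>)
  also have "\<dots> \<le> 2 * exp 6 * ln W" using lnW by (simp add: algebra_simps)
  finally show ?thesis .
qed

lemma sum_inverse_square_le_2: "(\<Sum>n\<in>{1..m}. 1 / (real n)\<^sup>2) \<le> 2"
proof -
  have "(\<Sum>n\<in>{1..Suc m}. 1 / (real n)\<^sup>2) \<le> 2 - 1 / real (Suc m)" for m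
  proof (induction m)
    case (Suc m)
    have "1 / (real (Suc (Suc m)))\<^sup>2 \<le> 1 / (real (Suc m) * real (Suc (Suc m)))"
      by (intro divide_left_mono) (auto simp: power2_eq_square)
    also have "\<dots> = 1 / real (Suc m) - 1 / real (Suc (Suc m))" by (simp add: divide_simps)
    finally show ?case using Suc by simp
  qed simp
  moreover have "2 - 1 / real (Suc m) \<le> 2" for m by simp
  ultimately have "(\<Sum>n\<in>{1..Suc m}. 1 / (real n)\<^sup>2) \<le> 2" for m by (meson order.trans)
  then show ?thesis by (cases m) auto
qed

lemma squarefree_eq_prod_prime_factors:
  fixes n :: nat
  assumes "squarefree n"
  shows "n = \<Prod>(prime_factors n)"
proof -
  have n: "n \<noteq> 0" using assms by (metis not_squarefree_0)
  have "n = (\<Prod>p\<in>prime_factors n. p ^ multiplicity p n)" using n by (intro prime_factorization_nat) simp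
  also have "\<dots> = (\<Prod>p\<in>prime_factors n. p)"
  proof (intro prod.cong refl)
    fix p assume "p \<in> prime_factors n"
    then have "multiplicity p n = 1" using assms n squarefree_factorial_semiring''[of n]
      by (auto simp: prime_factors_multiplicity le_Suc_eq)
    then show "p ^ multiplicity p n = p" by simp
  qed
  finally show ?thesis .
qed

text \<open>
  Every \<open>n \<le> V\<close> is a square times a product of distinct primes from \<open>B\<close> times a product of distinct
  primes from \<open>P\<close>.  Hence the harmonic sum is at most the product of the three corresponding sums.
\<close>

lemma sum_recip_prod_primes_ge:
  fixes P B :: "nat set"
  assumes P: "finite P" "\<And>p. p \<in> P \<Longrightarrow> prime p" and B: "finite B" "\<And>p. p \<in> B \<Longrightarrow> prime p"
    and disj: "P \<inter> B = {}" and V: "V \<ge> 1" and cover: "\<And>p. prime p \<Longrightarrow> real p \<le> V \<Longrightarrow> p \<in> P \<union> B"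
  shows "ln V \<le> 2 * (\<Prod>p\<in>B. 1 + 1 / real p) * (\<Sum>A | A \<subseteq> P \<and> real_prod A \<le> V. 1 / real_prod A)"
proof -
  define m where "m = nat \<lfloor>V\<rfloor>"
  define F where "F = {A. A \<subseteq> P \<and> real_prod A \<le> V}"
  define \<phi> where "\<phi> = (\<lambda>(h, b, a). (1 / (real h)\<^sup>2) * ((1 / real_prod b) * (1 / real_prod a)))"
  define g where "g n = (square_part n, prime_factors (squarefree_part n) \<inter> B, prime_factors (squarefree_part n) \<inter> P)" for n :: nat
  have m: "V < real m + 1" "real m \<le> V" using V unfolding m_def by linarith+
  have finF: "finite F" unfolding F_def by (rule finite_subset[of _ "Pow P"]) (use P in auto)
  have prnn: "real_prod A \<ge> 0" for A unfolding real_prod_def by (intro prod_nonneg) auto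
  have facts: "n = (square_part n)\<^sup>2 * (\<Prod>(prime_factors (squarefree_part n) \<inter> B) * \<Prod>(prime_factors (squarefree_part n) \<inter> P))"
    and sqle: "square_part n \<in> {1..m}" and le: "real_prod (prime_factors (squarefree_part n) \<inter> P) \<le> V"
    if n: "n \<in> {1..m}" for n
  proof -
    define q where "q = squarefree_part n"
    have dec: "n = q * (square_part n)\<^sup>2" unfolding q_def by (rule squarefree_decompose)
    have q0: "q > 0" using dec n by (cases "q = 0") auto
    have "n \<noteq> 0" using n by simp
    then have "square_part n \<noteq> 0" by (subst square_part_0_iff)
    then have sq: "square_part n > 0" by (simp only: neq0_conv)
    have qle: "q \<le> n" "square_part n \<le> n"
    proof -
      have "q * 1 \<le> q * (square_part n)\<^sup>2" using sq by (intro mult_le_mono2) simp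
      then show "q \<le> n" using dec by simp
      have "square_part n * 1 \<le> square_part n * (square_part n * q)" using sq q0 by (intro mult_le_mono2) auto
      also have "\<dots> = n" using dec by (simp add: power2_eq_square mult_ac)
      finally show "square_part n \<le> n" by simp
    qed
    have sub: "prime_factors q \<subseteq> P \<union> B"
    proof
      fix p assume p: "p \<in> prime_factors q"
      then have "p \<le> q" using q0 by (intro dvd_imp_le) auto
      then have "p \<le> m" using qle n by auto
      then have "real p \<le> V" using m by linarith
      then show "p \<in> P \<union> B" using cover p by auto
    qed
    have "q = \<Prod>(prime_factors q)" unfolding q_def by (rule squarefree_eq_prod_prime_factors) simp
    also have "prime_factors q = (prime_factors q \<inter> B) \<union> (prime_factors q \<inter> P)" using sub by blast
    also have "\<Prod>\<dots> = \<Prod>(prime_factors q \<inter> B) * \<Prod>(prime_factors q \<inter> P)"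
      by (rule prod.union_disjoint) (use disj in auto)
    finally have qq: "q = \<Prod>(prime_factors q \<inter> B) * \<Prod>(prime_factors q \<inter> P)" .
    show "n = (square_part n)\<^sup>2 * (\<Prod>(prime_factors (squarefree_part n) \<inter> B) * \<Prod>(prime_factors (squarefree_part n) \<inter> P))"
      unfolding q_def[symmetric] by (rule trans[OF trans[OF dec mult.commute] arg_cong[where f = "\<lambda>u. (square_part n)\<^sup>2 * u", OF qq]])
    show "square_part n \<in> {1..m}" using sq qle n by auto
    have "\<Prod>(prime_factors q \<inter> P) dvd q" by (rule dvdI[OF trans[OF qq mult.commute]])
    then have "\<Prod>(prime_factors q \<inter> P) \<le> q" using q0 by (rule dvd_imp_le)
    then have "\<Prod>(prime_factors q \<inter> P) \<le> m" using qle(1) n by simp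
    then have "real (\<Prod>(prime_factors q \<inter> P)) \<le> V" using m by linarith
    then show "real_prod (prime_factors (squarefree_part n) \<inter> P) \<le> V" by (simp add: real_prod_def q_def)
  qed
  have eq: "1 / real n = \<phi> (g n)" if n: "n \<in> {1..m}" for n
  proof -
    have "real n = (real (square_part n))\<^sup>2 * (real_prod (prime_factors (squarefree_part n) \<inter> B) * real_prod (prime_factors (squarefree_part n) \<inter> P))"
      using arg_cong[OF facts(1)[OF n], of real] by (simp add: real_prod_def)
    then show ?thesis unfolding \<phi>_def g_def by simp
  qed
  have inj: "inj_on g {1..m}"
  proof (rule inj_onI)
    fix x y assume x: "x \<in> {1..m}" and y: "y \<in> {1..m}" and e: "g x = g y"
    have e: "square_part x = square_part y"
      "prime_factors (squarefree_part x) \<inter> B = prime_factors (squarefree_part y) \<inter> B"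
      "prime_factors (squarefree_part x) \<inter> P = prime_factors (squarefree_part y) \<inter> P"
      using e unfolding g_def prod.inject by blast+
    define R where "R h b a = h\<^sup>2 * (\<Prod>b * \<Prod>a)" for h :: nat and b a :: "nat set"
    have R: "R (square_part n) (prime_factors (squarefree_part n) \<inter> B) (prime_factors (squarefree_part n) \<inter> P) = n"
      if "n \<in> {1..m}" for n
      unfolding R_def by (rule facts(1)[OF that, symmetric])
    have "R (square_part x) (prime_factors (squarefree_part x) \<inter> B) (prime_factors (squarefree_part x) \<inter> P)
        = R (square_part y) (prime_factors (squarefree_part y) \<inter> B) (prime_factors (squarefree_part y) \<inter> P)"
      by (simp only: e)
    then show "x = y" unfolding R[OF x] R[OF y] .
  qed
  have "ln V \<le> ln (real m + 1)" using V m by (intro ln_mono) auto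
  also have "\<dots> \<le> harm m" by (rule ln_le_harm)
  also have "\<dots> = (\<Sum>n\<in>{1..m}. \<phi> (g n))"
    unfolding harm_def by (intro sum.cong refl) (simp add: eq[symmetric] inverse_eq_divide)
  also have "\<dots> = (\<Sum>x\<in>g ` {1..m}. \<phi> x)" by (rule sum.reindex[OF inj, unfolded o_def, symmetric])
  also have "\<dots> \<le> (\<Sum>x\<in>{1..m} \<times> Pow B \<times> F. \<phi> x)"
  proof (rule sum_mono2)
    show "finite ({1..m} \<times> Pow B \<times> F)" using B finF by auto
    show "g ` {1..m} \<subseteq> {1..m} \<times> Pow B \<times> F"
      using sqle le by (auto simp: g_def F_def)
    show "0 \<le> \<phi> x" if "x \<in> {1..m} \<times> Pow B \<times> F - g ` {1..m}" for x
      unfolding \<phi>_def using prnn by (auto split: prod.splits)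
  qed
  also have "\<dots> = (\<Sum>h\<in>{1..m}. 1 / (real h)\<^sup>2) * ((\<Sum>b\<in>Pow B. 1 / real_prod b) * (\<Sum>a\<in>F. 1 / real_prod a))"
  proof -
    have "(\<Sum>x\<in>{1..m} \<times> Pow B \<times> F. \<phi> x) = (\<Sum>h\<in>{1..m}. \<Sum>b\<in>Pow B. \<Sum>a\<in>F. \<phi> (h, b, a))"
      by (simp only: sum.cartesian_product')
    then show ?thesis by (simp only: \<phi>_def prod.case sum_product) (simp only: sum_distrib_left)
  qed
  also have "\<dots> \<le> 2 * ((\<Sum>b\<in>Pow B. 1 / real_prod b) * (\<Sum>a\<in>F. 1 / real_prod a))"
    using prnn by (intro mult_right_mono sum_inverse_square_le_2 mult_nonneg_nonneg sum_nonneg) auto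
  also have "(\<Sum>b\<in>Pow B. 1 / real_prod b) = (\<Prod>p\<in>B. 1 + 1 / real p)"
    using prod_add[OF B(1), of "\<lambda>p. 1 / real p" "\<lambda>_. 1"] by (simp add: add.commute real_prod_def prod_dividef)
  finally show ?thesis unfolding F_def by (simp add: mult.assoc)
qed

text \<open>
  A geometric series dominated by its first term, which is at most \<open>1 / L\<close>.
\<close>

lemma dyadic_tail_le:
  fixes L :: real
  assumes L: "L > 1"
  shows "(\<Sum>j\<in>{1..J}. if L \<le> 2 ^ j then 1 / 2 ^ j else 0) \<le> 2 / L"
proof -
  have "if L \<le> 2 ^ J then (\<Sum>j\<in>{1..J}. if L \<le> 2 ^ j then 1 / 2 ^ j else 0) \<le> 2 / L - 1 / 2 ^ J
    else (\<Sum>j\<in>{1..J}. if L \<le> 2 ^ j then 1 / 2 ^ j else (0::real)) = 0"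
  proof (induction J)
    case (Suc J)
    have s: "(\<Sum>j\<in>{1..Suc J}. if L \<le> 2 ^ j then 1 / 2 ^ j else (0::real))
        = (\<Sum>j\<in>{1..J}. if L \<le> 2 ^ j then 1 / 2 ^ j else 0) + (if L \<le> 2 ^ Suc J then 1 / 2 ^ Suc J else 0)" by simp
    have half: "1 / 2 ^ Suc J = 1 / 2 ^ J / (2::real)" by simp
    show ?case
    proof (cases "L \<le> 2 ^ J")
      case True
      then have "L \<le> 2 ^ Suc J" by (simp add: order.trans[OF True])
      then show ?thesis using Suc True unfolding s half by simp
    next
      case False
      then have z: "(\<Sum>j\<in>{1..J}. if L \<le> 2 ^ j then 1 / 2 ^ j else (0::real)) = 0" using Suc by simp
      show ?thesis
      proof (cases "L \<le> 2 ^ Suc J")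
        case True
        then have "1 / 2 ^ Suc J \<le> 1 / L" using L by (intro divide_left_mono) auto
        then show ?thesis unfolding s z using True by simp
      next
        case False
        then show ?thesis unfolding s z by simp
      qed
    qed
  qed (use L in simp)
  note claim = this
  show ?thesis
  proof (cases "L \<le> 2 ^ J")
    case True
    then have "(\<Sum>j\<in>{1..J}. if L \<le> 2 ^ j then 1 / 2 ^ j else 0) \<le> 2 / L - 1 / 2 ^ J" using claim by simp
    also have "\<dots> \<le> 2 / L" by simp
    finally show ?thesis .
  next
    case False
    then show ?thesis using claim L by simp
  qed
qed

text \<open>
  The factor \<open>1 / ln d\<close> is at least half the sum of \<open>1 / ln V\<close> over the scales \<open>V = w^(2^j)\<close> above \<open>d\<close>.  On each scale
  the reciprocals of the admissible \<open>d \<le> V\<close> add up to at least a constant times \<open>ln V / ln w\<close>, so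
  every scale contributes a constant times \<open>1 / ln w\<close>.  The set \<open>B\<close> contains the exceptional primes
  above \<open>w\<close>; having at most \<open>w\<close> elements, it changes the Euler product by a factor of at most \<open>exp 1\<close>.
\<close>

lemma sum_weights_ge:
  fixes P B :: "nat set" and w Z :: real
  assumes P: "finite P" "\<And>p. p \<in> P \<Longrightarrow> prime p" "\<And>p. p \<in> P \<Longrightarrow> w < real p" and w: "w \<ge> 3"
    and B: "finite B" "\<And>p. p \<in> B \<Longrightarrow> prime p" "\<And>p. p \<in> B \<Longrightarrow> w < real p" "real (card B) \<le> w"
    and disj: "P \<inter> B = {}" and cover: "\<And>p. prime p \<Longrightarrow> w < real p \<Longrightarrow> real p \<le> Z \<Longrightarrow> p \<in> P \<union> B"
    and J: "w ^ (2 ^ J) \<le> Z"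
  shows "(real J / (4 * exp 7) - 1) / (2 * ln w) \<le> (\<Sum>A | A \<subseteq> P \<and> A \<noteq> {} \<and> real_prod A \<le> Z. 1 / (real_prod A * ln (real_prod A)))"
proof -
  define divisor_sets where "divisor_sets = {A. A \<subseteq> P \<and> A \<noteq> {} \<and> real_prod A \<le> Z}"
  define V where "V j = w ^ (2 ^ j)" for j :: nat
  \<comment> \<open>Together with \<open>P\<close> this contains all primes up to \<open>Z\<close>.\<close>
  define B' where "B' = {p :: nat. prime p \<and> real p \<le> w} \<union> B"
  have finfam: "finite divisor_sets" unfolding divisor_sets_def by (rule finite_subset[of _ "Pow P"]) (use P in auto)
  have finw: "finite {p :: nat. prime p \<and> real p \<le> w}"
    by (rule finite_subset[of _ "{..nat \<lfloor>w\<rfloor>}"]) (auto simp: le_nat_iff le_floor_iff)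
  have lnw: "ln w \<ge> 1"
  proof -
    have "exp 1 \<le> w" using exp_le w by linarith
    then show ?thesis using w by (simp add: ln_ge_iff)
  qed
  have prodB': "(\<Prod>p\<in>B'. 1 + 1 / real p) \<le> 2 * exp 7 * ln w"
  proof -
    have "(\<Prod>p\<in>B'. 1 + 1 / real p) = (\<Prod>p | prime p \<and> real p \<le> w. 1 + 1 / real p) * (\<Prod>p\<in>B. 1 + 1 / real p)"
      unfolding B'_def using finw B by (intro prod.union_disjoint) force+
    also have "\<dots> \<le> (2 * exp 6 * ln w) * exp 1"
    proof (intro mult_mono mertens_product_upper w)
      have "(\<Prod>p\<in>B. 1 + 1 / real p) \<le> (\<Prod>p\<in>B. exp (1 / w))"
      proof (intro prod_mono conjI)
        fix p assume "p \<in> B"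
        then have "1 / real p \<le> 1 / w" using B(3)[of p] w by (intro divide_left_mono) auto
        then show "1 + 1 / real p \<le> exp (1 / w)" using exp_ge_add_one_self[of "1 / w"] by linarith
      qed auto
      also have "\<dots> = exp (real (card B) * (1 / w))" by (simp flip: exp_of_nat_mult)
      also have "\<dots> \<le> exp 1" using B(4) w by simp
      finally show "(\<Prod>p\<in>B. 1 + 1 / real p) \<le> exp 1" .
    qed (use lnw in \<open>auto intro!: prod_nonneg add_nonneg_nonneg\<close>)
    also have "\<dots> = 2 * exp 7 * ln w" by (simp flip: exp_add)
    finally show ?thesis .
  qed
  have lnpr: "ln (real_prod A) > ln w" "real_prod A > w" if A: "A \<in> divisor_sets" for A
  proof -
    obtain p where p: "p \<in> A" "A \<subseteq> P" using A by (auto simp: divisor_sets_def)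
    have fA: "finite A" using p(2) P(1) finite_subset by blast
    have "1 \<le> real_prod (A - {p})" unfolding real_prod_def using P(2) p(2) by (intro prod_ge_1) (auto simp: Suc_le_eq prime_gt_0_nat)
    then have "real p * 1 \<le> real p * real_prod (A - {p})" by (intro mult_left_mono) auto
    also have "\<dots> = real_prod A" unfolding real_prod_def using p fA by (intro prod.remove[symmetric]) auto
    finally show "real_prod A > w" using P(3)[of p] p by auto
    then show "ln (real_prod A) > ln w" using w by simp
  qed
  have VZ: "V j \<le> Z" if "j \<in> {1..J}" for j
  proof -
    have "(2::nat) ^ j \<le> 2 ^ J" using that by (intro power_increasing) auto
    then have "V j \<le> w ^ (2 ^ J)" unfolding V_def using w by (intro power_increasing) auto
    then show ?thesis using J by linarith
  qed
  have lnV: "ln (V j) = 2 ^ j * ln w" for j unfolding V_def using w by (simp add: ln_realpow)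
  have V1: "V j \<ge> 1" for j unfolding V_def using w by (intro one_le_power) auto
  have rough: "2 ^ j / (4 * exp 7) - 1 \<le> (\<Sum>A | A \<in> divisor_sets \<and> real_prod A \<le> V j. 1 / real_prod A)" if j: "j \<in> {1..J}" for j
  proof -
    have "2 ^ j * ln w \<le> 2 * (\<Prod>p\<in>B'. 1 + 1 / real p) * (\<Sum>A | A \<subseteq> P \<and> real_prod A \<le> V j. 1 / real_prod A)"
      unfolding lnV[symmetric]
    proof (rule sum_recip_prod_primes_ge)
      show "finite B'" unfolding B'_def using finw B by simp
      show "P \<inter> B' = {}"
      proof -
        have "\<not> real p \<le> w" if "p \<in> P" for p using P(3)[OF that] by simp
        then show ?thesis unfolding B'_def using disj by blast
      qed
      show "\<And>p. prime p \<Longrightarrow> real p \<le> V j \<Longrightarrow> p \<in> P \<union> B'"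
      proof -
        fix p :: nat assume p: "prime p" "real p \<le> V j"
        show "p \<in> P \<union> B'"
        proof (cases "real p \<le> w")
          case True then show ?thesis using p by (simp add: B'_def)
        next
          case False
          then have "p \<in> P \<union> B" using p VZ[OF j] by (intro cover) auto
          then show ?thesis by (auto simp: B'_def)
        qed
      qed
      show "finite P" "\<And>p. p \<in> P \<Longrightarrow> prime p" by (fact P)+
      show "\<And>p. p \<in> B' \<Longrightarrow> prime p" unfolding B'_def using B(2) by blast
      show "1 \<le> V j" by (rule V1)
    qed
    also have "\<dots> \<le> 2 * (2 * exp 7 * ln w) * (\<Sum>A | A \<subseteq> P \<and> real_prod A \<le> V j. 1 / real_prod A)"
      using prodB' by (intro mult_right_mono mult_left_mono sum_nonneg) (auto simp: real_prod_def intro!: prod_nonneg)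
    finally have "2 ^ j / (4 * exp 7) \<le> (\<Sum>A | A \<subseteq> P \<and> real_prod A \<le> V j. 1 / real_prod A)"
      using lnw by (simp add: field_simps)
    also have "\<dots> = 1 + (\<Sum>A | A \<in> divisor_sets \<and> real_prod A \<le> V j. 1 / real_prod A)"
    proof -
      have "{A. A \<subseteq> P \<and> real_prod A \<le> V j} = insert {} {A. A \<in> divisor_sets \<and> real_prod A \<le> V j}"
        using VZ[OF j] V1[of j] by (auto simp: divisor_sets_def real_prod_def)
      moreover have "{} \<notin> {A. A \<in> divisor_sets \<and> real_prod A \<le> V j}" by (simp add: divisor_sets_def)
      ultimately show ?thesis using finfam by (simp add: real_prod_def)
    qed
    finally show ?thesis by simp
  qed
  have "(real J / (4 * exp 7) - 1) / (2 * ln w) \<le> (\<Sum>j\<in>{1..J}. (1 / (2 * ln w)) * (1 / (4 * exp 7) - 1 / 2 ^ j))"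
  proof -
    have "(\<Sum>j\<in>{1..J}. 1 / 2 ^ j) = 1 - 1 / (2::real) ^ J" for J :: nat by (induction J) (auto simp: field_simps)
    then have "(\<Sum>j\<in>{1..J}. 1 / (4 * exp 7) - 1 / 2 ^ j) \<ge> real J / (4 * exp 7) - 1" by (simp add: sum_subtractf)
    then have "(real J / (4 * exp 7) - 1) * (1 / (2 * ln w)) \<le> (\<Sum>j\<in>{1..J}. 1 / (4 * exp 7) - 1 / 2 ^ j) * (1 / (2 * ln w))"
      using lnw by (intro mult_right_mono) auto
    then show ?thesis by (simp add: sum_distrib_right sum_distrib_left mult.commute)
  qed
  also have "\<dots> \<le> (\<Sum>j\<in>{1..J}. (1 / (2 * ln w)) * (1 / 2 ^ j * (\<Sum>A | A \<in> divisor_sets \<and> real_prod A \<le> V j. 1 / real_prod A)))"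
  proof (intro sum_mono mult_left_mono)
    fix j assume j: "j \<in> {1..J}"
    have "1 / (4 * exp 7) - 1 / 2 ^ j = 1 / 2 ^ j * (2 ^ j / (4 * exp 7) - 1 :: real)" by (simp add: field_simps)
    also have "\<dots> \<le> 1 / 2 ^ j * (\<Sum>A | A \<in> divisor_sets \<and> real_prod A \<le> V j. 1 / real_prod A)"
      using rough[OF j] by (intro mult_left_mono) auto
    finally show "1 / (4 * exp 7) - 1 / 2 ^ j \<le> 1 / 2 ^ j * (\<Sum>A | A \<in> divisor_sets \<and> real_prod A \<le> V j. 1 / real_prod A)" .
  qed (use lnw in auto)
  also have "\<dots> = (\<Sum>j\<in>{1..J}. \<Sum>A\<in>divisor_sets. 1 / real_prod A * (1 / (2 * ln w) * (if real_prod A \<le> V j then 1 / 2 ^ j else 0)))"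
  proof (rule sum.cong[OF refl])
    fix j
    have eq: "(\<Sum>A | A \<in> divisor_sets \<and> real_prod A \<le> V j. 1 / real_prod A) = (\<Sum>A\<in>divisor_sets. if real_prod A \<le> V j then 1 / real_prod A else 0)"
      by (rule sum.inter_filter[OF finfam])
    show "(1 / (2 * ln w)) * (1 / 2 ^ j * (\<Sum>A | A \<in> divisor_sets \<and> real_prod A \<le> V j. 1 / real_prod A))
        = (\<Sum>A\<in>divisor_sets. 1 / real_prod A * (1 / (2 * ln w) * (if real_prod A \<le> V j then 1 / 2 ^ j else 0)))"
      unfolding eq sum_distrib_left
      by (intro sum.cong refl) simp
  qed
  also have "\<dots> = (\<Sum>A\<in>divisor_sets. 1 / real_prod A * (1 / (2 * ln w) * (\<Sum>j\<in>{1..J}. if real_prod A \<le> V j then 1 / 2 ^ j else 0)))"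
    by (subst sum.swap) (simp only: sum_distrib_left)
  also have "\<dots> \<le> (\<Sum>A\<in>divisor_sets. 1 / real_prod A * (1 / ln (real_prod A)))"
  proof (intro sum_mono mult_left_mono)
    fix A assume A: "A \<in> divisor_sets"
    define L where "L = ln (real_prod A) / ln w"
    have L: "L > 1" using lnpr[OF A] lnw by (simp add: L_def)
    have iff: "real_prod A \<le> V j \<longleftrightarrow> L \<le> 2 ^ j" for j
    proof -
      have "real_prod A \<le> V j \<longleftrightarrow> ln (real_prod A) \<le> ln (V j)" using lnpr(2)[OF A] w V1[of j] by (subst ln_le_cancel_iff) auto
      then show ?thesis unfolding lnV L_def using lnw by (simp add: field_simps)
    qed
    have "1 / (2 * ln w) * (\<Sum>j\<in>{1..J}. if real_prod A \<le> V j then 1 / 2 ^ j else 0) \<le> 1 / (2 * ln w) * (2 / L)"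
      unfolding iff using dyadic_tail_le[OF L] lnw by (intro mult_left_mono) auto
    also have "\<dots> = 1 / ln (real_prod A)" using lnw lnpr[OF A] by (simp add: L_def)
    finally show "1 / (2 * ln w) * (\<Sum>j\<in>{1..J}. if real_prod A \<le> V j then 1 / 2 ^ j else 0) \<le> 1 / ln (real_prod A)" .
    show "0 \<le> 1 / real_prod A" using lnpr(2)[OF A] w by simp
  qed
  finally show ?thesis unfolding divisor_sets_def by simp
qed

section \<open>Covering all shifts\<close>

lemma unique_residue:
  fixes p Q :: nat and c :: int
  assumes p: "prime p" and Q: "\<not> p dvd Q"
  shows "\<exists>r<p. \<forall>t::nat. int p dvd c + int Q * int t \<longleftrightarrow> t mod p = r"
proof -
  have pp: "int p > 0" using p prime_gt_0_nat by simp
  have "coprime Q p" using p Q by (metis coprime_commute prime_imp_coprime)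
  then have "coprime (int Q) (int p)" by simp
  then obtain u where u: "[int Q * u = 1] (mod int p)" using cong_solve_coprime_int by blast
  have cu: "coprime (int p) u"
  proof (rule ccontr)
    assume "\<not> coprime (int p) u"
    then have "int p dvd u" using p prime_imp_coprime[of "int p" u] by auto
    then have "int p dvd int Q * u" by simp
    then have "int p dvd 1" using u cong_dvd_iff by blast
    then show False using p by (simp add: prime_gt_1_nat)
  qed
  define r where "r = nat ((- (c * u)) mod int p)"
  have r: "int r = (- (c * u)) mod int p" unfolding r_def using pp by simp
  have "r < p"
  proof -
    have "int r < int p" unfolding r using pp by (rule pos_mod_bound)
    then show ?thesis by simp
  qed
  moreover have "int p dvd c + int Q * int t \<longleftrightarrow> t mod p = r" for t :: nat
  proof -
    have "int p dvd c + int Q * int t \<longleftrightarrow> int p dvd (c + int Q * int t) * u"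
      using cu by (simp add: coprime_dvd_mult_left_iff)
    also have "\<dots> \<longleftrightarrow> int p dvd c * u + int t"
    proof (rule cong_dvd_iff)
      have "[int Q * u * int t = 1 * int t] (mod int p)" using u by (rule cong_scalar_right)
      then have "[c * u + int Q * u * int t = c * u + 1 * int t] (mod int p)" by (intro cong_add cong_refl)
      then show "[(c + int Q * int t) * u = c * u + int t] (mod int p)" by (simp add: algebra_simps)
    qed
    also have "\<dots> \<longleftrightarrow> [int t = - (c * u)] (mod int p)"
      by (simp add: cong_iff_dvd_diff add.commute)
    also have "\<dots> \<longleftrightarrow> int t mod int p = int r" unfolding r Cong.cong_def ..
    also have "\<dots> \<longleftrightarrow> t mod p = r" by (metis of_nat_eq_iff zmod_int)
    finally show ?thesis .
  qed
  ultimately show ?thesis by blast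
qed

lemma card_large_prime_divisors_le:
  fixes d :: int
  assumes d: "d \<noteq> 0" and D: "finite D" "\<And>p. p \<in> D \<Longrightarrow> prime p" "\<And>p. p \<in> D \<Longrightarrow> 3 \<le> p"
    "\<And>p. p \<in> D \<Longrightarrow> int p dvd d"
  shows "real (card D) \<le> ln \<bar>real_of_int d\<bar>"
proof -
  have pos: "real p > 0" if "p \<in> D" for p using D(3)[OF that] by simp
  have "\<Prod>D dvd nat \<bar>d\<bar>"
  proof (rule prod_primes_dvd[OF D(1,2)])
    fix p assume "p \<in> D"
    then have "int p dvd int (nat \<bar>d\<bar>)" using D(4) by simp
    then show "p dvd nat \<bar>d\<bar>" by (simp only: int_dvd_int_iff)
  qed
  then have "\<Prod>D \<le> nat \<bar>d\<bar>" using d by (intro dvd_imp_le) auto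
  then have le: "real (\<Prod>D) \<le> \<bar>real_of_int d\<bar>" by linarith
  have "real (card D) = (\<Sum>p\<in>D. 1)" by simp
  also have "\<dots> \<le> (\<Sum>p\<in>D. ln (real p))"
  proof (rule sum_mono)
    fix p assume p: "p \<in> D"
    have "exp 1 \<le> real p" using exp_le D(3)[OF p] by linarith
    then show "1 \<le> ln (real p)" using pos[OF p] by (simp add: ln_ge_iff)
  qed
  also have "\<dots> = ln (\<Prod>p\<in>D. real p)" using pos D(1) by (intro ln_prod[symmetric]) auto
  also have "\<dots> \<le> ln \<bar>real_of_int d\<bar>" using le pos by (intro ln_mono) (auto intro!: prod_pos)
  finally show ?thesis .
qed

text \<open>
  A nonzero difference of two shifts is at most \<open>exp (1 + 3 * x)\<close> and so has at most \<open>1 + 3 * x\<close>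
  prime factors above \<open>exp 1\<close>.
\<close>

lemma card_shared_large_primes_le:
  fixes x :: real and k :: nat and s :: "nat \<Rightarrow> int"
  assumes x6: "x \<ge> 6" and kx: "real k \<le> x"
    and inj: "inj_on s {1..k}" and sb: "\<And>i. i \<in> {1..k} \<Longrightarrow> \<bar>real_of_int (s i)\<bar> \<le> exp (3 * x)"
    and finBad: "finite Bad" and Bad: "\<And>p. p \<in> Bad \<Longrightarrow> prime p" "\<And>p. p \<in> Bad \<Longrightarrow> 3 \<le> p"
      "\<And>p. p \<in> Bad \<Longrightarrow> \<exists>i\<in>{1..k}. \<exists>j\<in>{1..k}. i \<noteq> j \<and> int p dvd s i - s j"
  shows "real (card Bad) \<le> x ^ 6"
proof -
  define I where "I = {(i, j). i \<in> {1..k} \<and> j \<in> {1..k} \<and> i \<noteq> j}"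
  define D where "D = (\<lambda>(i, j). {p \<in> Bad. int p dvd s i - s j})"
  have finI: "finite I" by (rule finite_subset[of _ "{1..k} \<times> {1..k}"]) (auto simp: I_def)
  have cI: "card I \<le> k * k"
  proof -
    have "card I \<le> card ({1..k} \<times> {1..k})" by (rule card_mono) (auto simp: I_def)
    then show ?thesis by (simp add: card_cartesian_product)
  qed
  have D: "real (card (D ij)) \<le> 4 * x" if "ij \<in> I" for ij
  proof -
    obtain i j where ij0: "ij = (i, j)" by (cases ij)
    have ij: "ij = (i, j)" "i \<in> {1..k}" "j \<in> {1..k}" "i \<noteq> j" using that by (simp_all add: ij0 I_def)
    have ne: "s i - s j \<noteq> 0" using inj_onD[OF inj, of i j] ij by auto
    have "real (card (D ij)) \<le> ln \<bar>real_of_int (s i - s j)\<bar>"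
    proof (rule card_large_prime_divisors_le[OF ne])
      show "finite (D ij)" using finBad ij by (simp add: D_def)
      fix p assume p: "p \<in> D ij"
      then show "int p dvd s i - s j" using ij(1) by (simp add: D_def)
      have "p \<in> Bad" using p ij(1) by (simp add: D_def)
      then show "prime p" "3 \<le> p" using Bad by blast+
    qed
    also have "\<dots> \<le> ln (exp 1 * exp (3 * x))"
    proof (rule ln_mono)
      show "0 < \<bar>real_of_int (s i - s j)\<bar>" using ne by simp
      have "\<bar>real_of_int (s i - s j)\<bar> \<le> 2 * exp (3 * x)" using sb[OF ij(2)] sb[OF ij(3)] by simp
      also have "\<dots> \<le> exp 1 * exp (3 * x)" using exp_ge_add_one_self[of "1::real"] by (intro mult_right_mono) auto
      finally show "\<bar>real_of_int (s i - s j)\<bar> \<le> exp 1 * exp (3 * x)" .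
    qed
    also have "\<dots> = 1 + 3 * x" by (simp flip: exp_add)
    finally show ?thesis using x6 by linarith
  qed
  have "Bad \<subseteq> (\<Union>ij\<in>I. D ij)" 
  proof
    fix p assume p: "p \<in> Bad"
    then obtain i j where ij: "i \<in> {1..k}" "j \<in> {1..k}" "i \<noteq> j" "int p dvd s i - s j"
      using Bad(3) by blast
    then have "(i, j) \<in> I" "p \<in> D (i, j)" using p by (auto simp: I_def D_def)
    then show "p \<in> (\<Union>ij\<in>I. D ij)" by blast
  qed
  then have "card Bad \<le> card (\<Union>ij\<in>I. D ij)"
    using finI finBad by (intro card_mono finite_UN_I) (auto simp: D_def)
  also have "\<dots> \<le> (\<Sum>ij\<in>I. card (D ij))" by (rule card_UN_le[OF finI])
  finally have "real (card Bad) \<le> (\<Sum>ij\<in>I. real (card (D ij)))" by (simp flip: of_nat_sum)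
  also have "\<dots> \<le> (\<Sum>ij\<in>I. 4 * x)" by (intro sum_mono D)
  also have "\<dots> = real (card I) * (4 * x)" by simp
  also have "\<dots> \<le> (x * x) * (4 * x)"
  proof (intro mult_right_mono)
    have "real (card I) \<le> real k * real k" using cI by (metis of_nat_le_iff of_nat_mult)
    also have "\<dots> \<le> x * x" using kx by (intro mult_mono) auto
    finally show "real (card I) \<le> x * x" .
  qed (use x6 in simp)
  also have "\<dots> \<le> x ^ 3 * x ^ 3"
  proof -
    have "4 * 1 \<le> x * x\<^sup>2" using x6 by (intro mult_mono one_le_power) auto
    then have "x ^ 3 * 4 \<le> x ^ 3 * x ^ 3" using x6 by (intro mult_left_mono) (auto simp: power2_eq_square power3_eq_cube)
    then show ?thesis by (simp add: power3_eq_cube)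
  qed
  also have "\<dots> = x ^ 6" by (simp flip: power_add)
  finally show ?thesis .
qed

text \<open>
  The abstract argument for \<open>w = x\<^sup>6\<close>, \<open>ln Z = x / ln\<^sup>5 x\<close> and \<open>ln Y = x / 8\<close>.  The errors from incomplete periods are
  of order \<open>Y\<^sup>6\<close>, well below \<open>exp x\<close>.  The hypotheses on \<open>x\<close> are the asymptotic inequalities that hold for
  all large \<open>x\<close>.
\<close>

lemma covering_for_large_x:
  fixes x :: real and k :: nat and s :: "nat \<Rightarrow> int" and b :: int
  assumes x6: "x \<ge> 6" and lnx: "ln x \<ge> 2 + 16 * exp 7" and ln5: "x / ln x ^ 5 \<le> x / 8"
    and J: "6 * ln x * x powr (25 / 36) \<le> x / ln x ^ 5"
    and tail: "x * (exp (1 - ln x ^ 5 / 16) + (1 / x ^ 3)\<^sup>2) \<le> 1 / 20"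
    and big: "144 * (x + 1) * exp (x / 8) ^ 6 < exp x - 1"
    and k: "real k \<le> x / (3072 * exp 7)" and k1: "k \<ge> 1"
    and inj: "inj_on s {1..k}" and sb: "\<And>i. i \<in> {1..k} \<Longrightarrow> \<bar>real_of_int (s i)\<bar> \<le> exp (3 * x)"
  shows "\<exists>t::int. 1 \<le> t \<and> real_of_int t \<le> exp x \<and>
        (\<forall>i\<in>{1..k}. \<exists>p::nat. prime p \<and>
          real p \<in> {x ^ 6 <.. exp (x / (ln x) ^ 5)} \<and>
          int p dvd b + int (primorial x) * t + s i)"
proof -
  define w where "w = x ^ 6"
  define l where "l = x / ln x ^ 5"
  define Z where "Z = exp l"
  define Y where "Y = exp (x / 8)"
  define N where "N = nat \<lfloor>exp x\<rfloor>"
  define Bad where "Bad = {p :: nat. prime p \<and> w < real p \<and> real p \<le> Z \<and>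
      (\<exists>i\<in>{1..k}. \<exists>j\<in>{1..k}. i \<noteq> j \<and> int p dvd s i - s j)}"
  define P where "P = {p :: nat. prime p \<and> w < real p \<and> real p \<le> Z} - Bad"
  define r where "r p i = (SOME r. r < p \<and> (\<forall>t::nat. int p dvd (b + s i) + int (primorial x) * int t \<longleftrightarrow> t mod p = r))" for p i
  define F where "F = {A. A \<subseteq> P \<and> A \<noteq> {} \<and> real_prod A \<le> Z}"
  define S where "S = (\<Sum>A\<in>F. 1 / (real_prod A * ln (real_prod A)))"
  define C where "C = 1 / S"
  \<comment> \<open>About \<open>ln x\<close> doublings lead from \<open>ln w\<close> to \<open>ln Z\<close>, since \<open>2 powr ln x\<close> is \<open>x\<close> to an exponent below 1.\<close>
  define Jn where "Jn = nat \<lfloor>ln x\<rfloor>"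
  have L1: "ln x \<ge> 2" using lnx exp_ge_zero[of "7::real"] by linarith
  have l0: "l > 0" using x6 L1 by (simp add: l_def)
  have lx: "l \<le> x" unfolding l_def by (rule order.trans[OF ln5]) (use x6 in simp)
  have lnw: "ln w = 6 * ln x" using x6 by (simp add: w_def ln_realpow)
  have xw: "x \<le> w" using x6 power_increasing[of 1 6 x] by (simp add: w_def)
  have w3: "w \<ge> 3" using xw x6 by linarith
  have kx: "real k \<le> x"
  proof -
    have "1 \<le> exp (7::real)" by simp
    then have "1 \<le> 3072 * exp (7::real)" by linarith
    then have "x / (3072 * exp 7) \<le> x / 1" using x6 by (intro divide_left_mono) auto
    then show ?thesis using k by simp
  qed
  have finZ: "finite {p :: nat. prime p \<and> w < real p \<and> real p \<le> Z}"
    by (rule finite_subset[of _ "{..nat \<lfloor>Z\<rfloor>}"]) (auto simp: le_nat_iff le_floor_iff)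
  have finP: "finite P" using finZ by (simp add: P_def)
  have finBad: "finite Bad" by (rule finite_subset[OF _ finZ]) (auto simp: Bad_def)
  have cardBad: "real (card Bad) \<le> w"
    unfolding w_def
  proof (rule card_shared_large_primes_le[OF x6 kx inj sb finBad])
    fix p assume p: "p \<in> Bad"
    then show "prime p" by (simp add: Bad_def)
    have "w < real p" using p by (simp add: Bad_def)
    then show "3 \<le> p" using w3 by linarith
    show "\<exists>i\<in>{1..k}. \<exists>j\<in>{1..k}. i \<noteq> j \<and> int p dvd s i - s j"
      using p unfolding Bad_def by blast
  qed
  have lnpr: "ln (real_prod A) > 0 \<and> real_prod A > 0" if A: "A \<in> F" for A
  proof -
    obtain p where p: "p \<in> A" "A \<subseteq> P" using A unfolding F_def by blast
    have fA: "finite A" using p(2) finP finite_subset by blast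
    have ge: "real q \<ge> 3" if "q \<in> A" for q
    proof -
      have "w < real q" using that p(2) by (auto simp: P_def)
      then show ?thesis using w3 by linarith
    qed
    have "1 \<le> real_prod (A - {p})" unfolding real_prod_def
    proof (rule prod_ge_1)
      fix q assume "q \<in> A - {p}"
      then show "1 \<le> real q" using ge[of q] by simp
    qed
    then have "real p * 1 \<le> real p * real_prod (A - {p})" by (intro mult_left_mono) auto
    also have "\<dots> = real_prod A" unfolding real_prod_def using p fA by (intro prod.remove[symmetric]) auto
    finally have "real_prod A \<ge> 3" using ge[OF p(1)] by linarith
    then show ?thesis by simp
  qed
  have "(real Jn / (4 * exp 7) - 1) / (2 * ln w) \<le> S"
    unfolding S_def F_def
  proof (rule sum_weights_ge[where B = Bad])
    show "w ^ 2 ^ Jn \<le> Z"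
    proof -
      have "real ((2::nat) ^ Jn) = 2 powr real Jn" by (simp add: powr_realpow)
      also have "\<dots> \<le> 2 powr ln x" using L1 unfolding Jn_def by (intro powr_mono) linarith+
      also have "\<dots> = exp (ln x * ln 2)" by (simp add: powr_def)
      also have "\<dots> \<le> exp (ln x * (25 / 36))" using L1 ln2_le_25_over_36 by simp
      also have "\<dots> = x powr (25 / 36)" using x6 by (simp add: powr_def mult.commute)
      finally have "real (2 ^ Jn) * (6 * ln x) \<le> x powr (25 / 36) * (6 * ln x)" using L1 by (intro mult_right_mono) auto
      also have "\<dots> \<le> l" using J by (simp add: l_def mult_ac)
      finally have "real (2 ^ Jn) * ln w \<le> l" by (simp add: lnw)
      moreover have "w ^ 2 ^ Jn = exp (real (2 ^ Jn) * ln w)"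
        using w3 exp_of_nat_mult[of "2 ^ Jn" "ln w"] by simp
      ultimately show ?thesis by (simp add: Z_def)
    qed
    show "\<And>p. prime p \<Longrightarrow> w < real p \<Longrightarrow> real p \<le> Z \<Longrightarrow> p \<in> P \<union> Bad" by (simp add: P_def)
    show "real (card Bad) \<le> w" by (rule cardBad)
    show "P \<inter> Bad = {}" by (auto simp: P_def)
    show "\<And>p. p \<in> Bad \<Longrightarrow> prime p" "\<And>p. p \<in> Bad \<Longrightarrow> w < real p" by (auto simp: Bad_def)
    show "\<And>p. p \<in> P \<Longrightarrow> prime p" "\<And>p. p \<in> P \<Longrightarrow> w < real p" by (auto simp: P_def)
  qed (use finP finBad w3 in auto)
  moreover have "1 / (96 * exp 7) \<le> (real Jn / (4 * exp 7) - 1) / (2 * ln w)"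
  proof -
    define E where "E = exp (7::real)"
    have E: "E > 0" by (simp add: E_def)
    have "ln x - 1 \<le> real Jn" using L1 unfolding Jn_def by linarith
    then have "(ln x - 1) / (4 * E) - 1 \<le> real Jn / (4 * E) - 1" using E by (simp add: divide_right_mono)
    moreover have "ln x / (8 * E) \<le> (ln x - 1) / (4 * E) - 1"
    proof -
      have "ln x \<ge> 2 + 8 * E" using lnx E unfolding E_def by linarith
      then show ?thesis using E by (simp add: field_simps)
    qed
    ultimately have "ln x / (8 * E) / (2 * ln w) \<le> (real Jn / (4 * E) - 1) / (2 * ln w)"
      using L1 by (intro divide_right_mono) (auto simp: lnw)
    moreover have "ln x / (8 * E) / (2 * ln w) = 1 / (96 * E)" using L1 by (simp add: lnw)
    ultimately show ?thesis by (simp add: E_def)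
  qed
  ultimately have S: "S \<ge> 1 / (96 * exp 7)" by linarith
  then have S0: "S > 0" by (rule less_le_trans[rotated]) simp
  have C: "0 \<le> C" "C \<le> 96 * exp 7"
  proof -
    show "0 \<le> C" using S0 by (simp add: C_def)
    have "1 / S \<le> 1 / (1 / (96 * exp 7))" using S S0 by (intro divide_left_mono) auto
    then show "C \<le> 96 * exp 7" by (simp add: C_def)
  qed
  have notdvd: "\<not> p dvd primorial x" if "p \<in> P" for p
  proof
    assume "p dvd primorial x"
    moreover have "finite {q :: nat. prime q \<and> real q \<le> x}"
      by (rule finite_subset[of _ "{..nat \<lfloor>x\<rfloor>}"]) (auto simp: le_nat_iff le_floor_iff)
    moreover have p: "prime p" "w < real p" using that by (auto simp: P_def)
    ultimately obtain q where "prime q" "real q \<le> x" "p dvd q"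
      unfolding primorial_def using prime_dvd_prod_iff[of "{q :: nat. prime q \<and> real q \<le> x}" p "\<lambda>q. q"] by auto
    then show False using p xw primes_dvd_imp_eq[of p q] by auto
  qed
  have r: "r p i < p" "\<And>t. int p dvd (b + s i) + int (primorial x) * int t \<longleftrightarrow> t mod p = r p i" if "p \<in> P" for p i
  proof -
    have "prime p" using that by (auto simp: P_def)
    then have "\<exists>r. r < p \<and> (\<forall>t::nat. int p dvd (b + s i) + int (primorial x) * int t \<longleftrightarrow> t mod p = r)"
      using unique_residue[OF _ notdvd[OF that]] by simp
    then have "r p i < p \<and> (\<forall>t::nat. int p dvd (b + s i) + int (primorial x) * int t \<longleftrightarrow> t mod p = r p i)"
      unfolding r_def by (rule someI_ex)
    then show "r p i < p" "\<And>t. int p dvd (b + s i) + int (primorial x) * int t \<longleftrightarrow> t mod p = r p i" by auto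
  qed
  interpret residue_system P k r w
  proof
    show "inj_on (r p) {1..k}" if p: "p \<in> P" for p
    proof (rule inj_onI)
      fix i j assume ij: "i \<in> {1..k}" "j \<in> {1..k}" "r p i = r p j"
      have "int p dvd (b + s i) + int (primorial x) * int (r p i)" using r[OF p] by simp
      moreover have "int p dvd (b + s j) + int (primorial x) * int (r p i)" using r[OF p] ij(3) by simp
      ultimately have "int p dvd ((b + s i) + int (primorial x) * int (r p i)) - ((b + s j) + int (primorial x) * int (r p i))"
        by (rule dvd_diff)
      then have "int p dvd s i - s j" by simp
      then show "i = j" using p ij unfolding P_def Bad_def by blast
    qed
    show "finite P" by (rule finP)
    show "prime p" "w < real p" if "p \<in> P" for p using that by (simp_all add: P_def)
    show "3 \<le> w" by (rule w3)
    show "r p i < p" if "p \<in> P" for p i using r(1)[OF that] .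
  qed
  have divisor_sets_F: "divisor_sets Z = F" by (simp add: divisor_sets_def F_def)
  interpret weighted_residue_system P k r w Z C Y
  proof
    show "Z > 1" using l0 by (simp add: Z_def)
    show "0 \<le> C" by (rule C)
    show "C \<le> ln w" using C(2) lnx lnw by linarith
    show "Z \<le> Y" using ln5 by (simp add: Z_def Y_def l_def)
    have "(\<Sum>A\<in>F. C / (real_prod A * ln (real_prod A))) = C * S" by (simp add: S_def sum_distrib_left)
    then show "(\<Sum>A\<in>divisor_sets Z. C / (real_prod A * ln (real_prod A))) = 1" using S0 by (simp add: divisor_sets_F C_def)
  qed
  have "\<exists>t\<in>{1..N}. \<forall>i\<in>{1..k}. \<exists>p\<in>P. t mod p = r p i"
  proof (rule exists_fully_covered)
    show "1 \<le> k" by (rule k1)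
    have lnY: "ln Y = x / 8" and lnZ: "ln Z = l" by (simp_all add: Y_def Z_def)
    show "real k * ln Y \<le> w / 8"
    proof -
      have "real k * x \<le> x * x" using kx x6 by (intro mult_right_mono) auto
      also have "x * x = x ^ 2" by (simp add: power2_eq_square)
      also have "\<dots> \<le> x ^ 6" using x6 by (intro power_increasing) auto
      finally show ?thesis by (simp add: lnY w_def)
    qed
    have l2: "0 \<le> 1 + l" "1 + l \<le> 2 * x" using l0 lx x6 by linarith+
    show "(real k)\<^sup>2 * (1 + ln Z)\<^sup>2 * (2 / w) \<le> 1 / 4"
    proof -
      have "(real k)\<^sup>2 * (1 + l)\<^sup>2 \<le> x\<^sup>2 * (2 * x)\<^sup>2" using kx l2 by (intro mult_mono power_mono) auto
      then have "(real k)\<^sup>2 * (1 + l)\<^sup>2 * (2 / w) \<le> x\<^sup>2 * (2 * x)\<^sup>2 * (2 / w)" using w3 by (intro mult_right_mono) auto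
      also have "\<dots> = 8 / x\<^sup>2" using x6 by (simp add: w_def field_simps flip: power_add)
      also have "\<dots> \<le> 8 / 6\<^sup>2" using x6 by (intro divide_left_mono power_mono) auto
      finally show ?thesis by (simp add: lnZ)
    qed
    show "real k * (exp ((2 * C * real k - ln (Y / Z)) / ln Z) + (ln Y * (1 + ln Z) / w)\<^sup>2) \<le> 1 / 20"
    proof -
      \<comment> \<open>The bound on \<open>k\<close> has the constant \<open>3072 = 32 * 96\<close> so that the energy of all boxes, doubled by the
        Chernoff bound, is at most half of \<open>ln Y\<close>.\<close>
      have "2 * C * real k \<le> 2 * (96 * exp 7) * (x / (3072 * exp 7))"
        using C k by (intro mult_mono) auto
      also have "\<dots> = x / 16" by simp
      finally have ck: "2 * C * real k \<le> x / 16" .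
      have "ln (Y / Z) = x / 8 - l" by (simp add: Y_def Z_def flip: exp_diff)
      then have "(2 * C * real k - ln (Y / Z)) / ln Z \<le> (l - x / 16) / l"
        unfolding lnZ using ck l0 by (intro divide_right_mono) auto
      also have "\<dots> = 1 - x / l / 16" using l0 by (simp add: diff_divide_distrib)
      also have "x / l = ln x ^ 5" using x6 by (simp add: l_def)
      finally have e1: "exp ((2 * C * real k - ln (Y / Z)) / ln Z) \<le> exp (1 - ln x ^ 5 / 16)" by simp
      have "ln Y * (1 + ln Z) / w \<le> (x / 8) * (2 * x) / w"
        unfolding lnY lnZ using l2 x6 w3 by (intro divide_right_mono mult_left_mono) auto
      also have "\<dots> \<le> 1 / x ^ 3"
      proof -
        have "(x / 8) * (2 * x) \<le> x ^ 2" by (simp add: power2_eq_square)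
        also have "\<dots> \<le> x ^ 3" using x6 by (intro power_increasing) auto
        finally have "(x / 8) * (2 * x) / w \<le> x ^ 3 / w" using w3 by (intro divide_right_mono) auto
        also have "x ^ 3 / w = 1 / x ^ 3"
        proof -
          have "w = x ^ 3 * x ^ 3" by (simp add: w_def flip: power_add)
          show ?thesis unfolding \<open>w = x ^ 3 * x ^ 3\<close>
            by (rule nonzero_divide_mult_cancel_left) (use x6 in simp)
        qed
        finally show ?thesis .
      qed
      finally have le3: "ln Y * (1 + ln Z) / w \<le> 1 / x ^ 3" .
      have "0 \<le> ln Y * (1 + ln Z) / w"
        unfolding lnY lnZ using l2 x6 w3 by (intro divide_nonneg_nonneg mult_nonneg_nonneg) auto
      then have e2: "(ln Y * (1 + ln Z) / w)\<^sup>2 \<le> (1 / x ^ 3)\<^sup>2" by (rule power_mono[OF le3])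
      have "real k * (exp ((2 * C * real k - ln (Y / Z)) / ln Z) + (ln Y * (1 + ln Z) / w)\<^sup>2)
          \<le> x * (exp (1 - ln x ^ 5 / 16) + (1 / x ^ 3)\<^sup>2)"
        using kx e1 e2 x6 by (intro mult_mono add_mono) auto
      then show ?thesis using tail by linarith
    qed
    show "144 * (real k + 1) * Y ^ 6 < real N"
    proof -
      have "144 * (real k + 1) * Y ^ 6 \<le> 144 * (x + 1) * Y ^ 6" using kx by (intro mult_right_mono) (auto simp: Y_def)
      moreover have "exp x - 1 \<le> real N" unfolding N_def by linarith
      ultimately show ?thesis using big unfolding Y_def by linarith
    qed
  qed
  then obtain t where t: "t \<in> {1..N}" "\<And>i. i \<in> {1..k} \<Longrightarrow> \<exists>p\<in>P. t mod p = r p i" by blast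
  show ?thesis
  proof (intro exI[of _ "int t"] conjI ballI)
    show "1 \<le> int t" using t by simp
    have "real N \<le> exp x" unfolding N_def by simp
    then show "real_of_int (int t) \<le> exp x" using t(1) by simp
    fix i assume "i \<in> {1..k}"
    then obtain p where p: "p \<in> P" "t mod p = r p i" using t(2) by blast
    have "int p dvd (b + s i) + int (primorial x) * int t" using r(2)[OF p(1)] p(2) by blast
    then have "int p dvd b + int (primorial x) * int t + s i" by (simp add: algebra_simps)
    moreover have "prime p" "real p \<in> {x ^ 6 <.. exp (x / (ln x) ^ 5)}"
      using p(1) by (auto simp: P_def w_def Z_def l_def)
    ultimately show "\<exists>p::nat. prime p \<and> real p \<in> {x ^ 6 <.. exp (x / (ln x) ^ 5)} \<and>
          int p dvd b + int (primorial x) * int t + s i" by blast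
  qed
qed

theorem lemma3p1:
  shows "\<exists>\<eta>::real. \<eta> > 0 \<and> (\<exists>x\<^sub>0::real. \<forall>x::real. x > x\<^sub>0 \<longrightarrow>
    (\<forall>(k::nat) (s :: nat \<Rightarrow> int).
      real k \<le> \<eta> * x \<longrightarrow>
      inj_on s {1..k} \<longrightarrow>
      (\<forall>i\<in>{1..k}. \<bar>real_of_int (s i)\<bar> \<le> exp (3 * x)) \<longrightarrow>
      (\<forall>b::int. \<exists>t::int. 1 \<le> t \<and> real_of_int t \<le> exp x \<and>
        (\<forall>i\<in>{1..k}. \<exists>p::nat. prime p \<and>
          real p \<in> {x ^ 6 <.. exp (x / (ln x) ^ 5)} \<and>
          int p dvd b + int (primorial x) * t + s i))))"
proof -
  define large :: "real \<Rightarrow> bool" where "large x \<longleftrightarrow> x \<ge> 6 \<and> ln x \<ge> 2 + 16 * exp 7 \<and> x / ln x ^ 5 \<le> x / 8 \<and>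
      6 * ln x * x powr (25 / 36) \<le> x / ln x ^ 5 \<and> x * (exp (1 - ln x ^ 5 / 16) + (1 / x ^ 3)\<^sup>2) \<le> 1 / 20 \<and>
      144 * (x + 1) * exp (x / 8) ^ 6 < exp x - 1" for x
  have "\<forall>\<^sub>F x::real in at_top. x \<ge> 6" by (rule eventually_ge_at_top)
  moreover have "\<forall>\<^sub>F x::real in at_top. ln x \<ge> 2 + 16 * exp 7"
    using ln_at_top unfolding filterlim_at_top by blast
  moreover have "\<forall>\<^sub>F x::real in at_top. x / ln x ^ 5 \<le> x / 8" by real_asymp
  moreover have "\<forall>\<^sub>F x::real in at_top. 6 * ln x * x powr (25 / 36) \<le> x / ln x ^ 5" by real_asymp
  moreover have "\<forall>\<^sub>F x::real in at_top. x * (exp (1 - ln x ^ 5 / 16) + (1 / x ^ 3)\<^sup>2) \<le> 1 / 20" by real_asymp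
  moreover have "\<forall>\<^sub>F x::real in at_top. 144 * (x + 1) * exp (x / 8) ^ 6 < exp x - 1" by real_asymp
  ultimately have "\<forall>\<^sub>F x in at_top. large x" unfolding large_def by eventually_elim blast
  then obtain x\<^sub>0 where x\<^sub>0: "\<And>x. x \<ge> x\<^sub>0 \<Longrightarrow> large x"
    unfolding eventually_at_top_linorder by blast
  have main: "\<exists>t::int. 1 \<le> t \<and> real_of_int t \<le> exp x \<and>
        (\<forall>i\<in>{1..k}. \<exists>p::nat. prime p \<and>
          real p \<in> {x ^ 6 <.. exp (x / (ln x) ^ 5)} \<and>
          int p dvd b + int (primorial x) * t + s i)"
    if x: "x\<^sub>0 < x" and k: "real k \<le> 1 / (3072 * exp 7) * x" and inj: "inj_on s {1..k}"
      and sb: "\<forall>i\<in>{1..k}. \<bar>real_of_int (s i)\<bar> \<le> exp (3 * x)"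
    for x :: real and k :: nat and s :: "nat \<Rightarrow> int" and b :: int
  proof -
    have "large x" using x by (intro x\<^sub>0) simp
    then have X: "x \<ge> 6" "ln x \<ge> 2 + 16 * exp 7" "x / ln x ^ 5 \<le> x / 8"
      "6 * ln x * x powr (25 / 36) \<le> x / ln x ^ 5"
      "x * (exp (1 - ln x ^ 5 / 16) + (1 / x ^ 3)\<^sup>2) \<le> 1 / 20"
      "144 * (x + 1) * exp (x / 8) ^ 6 < exp x - 1"
      unfolding large_def by blast+
    show ?thesis
    proof (cases "k = 0")
      case True
      have "1 \<le> exp x" using X(1) by simp
      then show ?thesis using True by (intro exI[of _ 1]) simp
    next
      case False
      have k': "real k \<le> x / (3072 * exp 7)" using k by simp
      have k1: "k \<ge> 1" using False by simp
      have sb': "\<bar>real_of_int (s i)\<bar> \<le> exp (3 * x)" if "i \<in> {1..k}" for i using sb that by blast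
      show ?thesis by (rule covering_for_large_x[OF X k' k1 inj sb'])
    qed
  qed
  show ?thesis
  proof (rule exI[of _ "1 / (3072 * exp 7)"], rule conjI)
    show "(0::real) < 1 / (3072 * exp 7)" by simp
  qed (use main in blast)
qed

end
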